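(* If $p = p(n)$ satisfies $n^{-1}\log n \ll 1 - p \ll n^{-7/9}$, then $$\frac{\chi\big( G(n,p) \big) - \mathbb{E}\big[ \chi\big( G(n,p) \big) \big]}{\sqrt{\mathrm{Var}\big( \chi\big( G(n,p) \big) \big)}} \stackrel{d}{\longrightarrow} \mathcal{N}(0,1)$$ as $n \to \infty$. Moreover, $\mathrm{Var}\big( \chi(G(n,p)) \big) = \Theta\big( n^3 (1-p)^3 \big)$.
   Context: $G(n,p)$ is the binomial random graph on $n$ labelled vertices with edge probability $p$; $\chi$ denotes the chromatic number; $\mathcal{N}(0,1)$ is the standard normal distribution and $\stackrel{d}{\longrightarrow}$ is convergence in distribution. For functions of $n$, $f \ll g$ means $f(n)/g(n) \to 0$ as $n \to \infty$. *)

theory Defs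
  imports
    "HOL-Probability.Probability"
    "HOL-Library.Landau_Symbols"
    "HOL-Library.Ramsey"
begin

text \<open>
  A finite simple graph on a vertex set \<open>V\<close> is given by its edge set
  \<open>E \<subseteq> nsets V 2\<close>, a set of two-element subsets of \<open>V\<close>.
\<close>

definition proper_colouring :: "'a set \<Rightarrow> 'a set set \<Rightarrow> nat \<Rightarrow> ('a \<Rightarrow> nat) \<Rightarrow> bool" where
  "proper_colouring V E k c \<longleftrightarrow>
     c ` V \<subseteq> {..<k} \<and> (\<forall>x\<in>V. \<forall>y\<in>V. {x, y} \<in> E \<longrightarrow> c x \<noteq> c y)"

definition chromatic_number :: "'a set \<Rightarrow> 'a set set \<Rightarrow> nat" where
  "chromatic_number V E = (LEAST k. \<exists>c. proper_colouring V E k c)"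

text \<open>The minimum is attained, so \<^const>\<open>Least\<close> is meaningful here.\<close>

lemma chromatic_number_attained:
  assumes "finite V" and "E \<subseteq> nsets V 2"
  shows "\<exists>c. proper_colouring V E (chromatic_number V E) c"
proof -
  obtain c where c: "bij_betw c V {..<card V}"
    using ex_bij_betw_finite_nat[OF assms(1)] by (auto simp: atLeast0LessThan)
  have "c x \<noteq> c y" if "x \<in> V" "y \<in> V" "{x, y} \<in> E" for x y
  proof -
    have "card {x, y} = 2"
      using that assms(2) by (auto simp: nsets_def)
    then have "x \<noteq> y" by auto
    then show ?thesis
      using c that by (auto simp: bij_betw_def inj_on_def)
  qed
  then have "proper_colouring V E (card V) c"
    using c by (auto simp: proper_colouring_def bij_betw_def)
  then have "\<exists>c. proper_colouring V E (card V) c" by blast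
  then show ?thesis
    unfolding chromatic_number_def
    by (rule LeastI[where P = "\<lambda>k. \<exists>c. proper_colouring V E k c"])
qed

text \<open>
  The binomial random graph on the vertex set \<open>{1..n}\<close>, as a distribution on edge sets:
  an independent biased coin \<open>b e\<close> is tossed for each possible edge \<open>e\<close>.
\<close>

definition binomial_random_graph :: "nat \<Rightarrow> real \<Rightarrow> nat set set pmf" where
  "binomial_random_graph n p =
     map_pmf (\<lambda>b. {e \<in> nsets {1..n} 2. b e})
       (Pi_pmf (nsets {1..n} 2) False (\<lambda>_. bernoulli_pmf p))"

definition chi :: "nat \<Rightarrow> nat set set \<Rightarrow> real" where
  "chi n E = real (chromatic_number {1..n} E)"

definition mean_chi :: "nat \<Rightarrow> real \<Rightarrow> real" where
  "mean_chi n p = measure_pmf.expectation (binomial_random_graph n p) (chi n)"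

definition var_chi :: "nat \<Rightarrow> real \<Rightarrow> real" where
  "var_chi n p = measure_pmf.variance (binomial_random_graph n p) (chi n)"

end

theory Submission
  imports Defs "HOL-Real_Asymp.Real_Asymp"
begin

text \<open>
  Put \<open>q = 1 - p\<close> and let \<open>H \<sim> G(n, q)\<close> be the complement, so that the chromatic number is the
  clique cover number of \<open>H\<close>. A colour class of size \<open>m\<close> contains \<open>m choose 3 \<ge> m - 2\<close> triangles,
  hence \<open>2 \<chi> \<ge> n - X\<close>, where \<open>X\<close> counts the triangles of \<open>H\<close>. Conversely, cover \<open>H\<close> by its
  isolated triangles and a nearly perfect matching of the other vertices: then
  \<open>2 \<chi> \<le> n + 1 - X + P\<close>, where \<open>P\<close> counts the ordered pairs of distinct triangles with a common
  vertex. The matching comes from Hall's theorem, applied across a cut of the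
  vertex set, and exists with very high probability because \<open>n q\<close> is much larger than \<open>log n\<close>; few edges
  lead to the removed triangles because \<open>n\<^sup>3 q\<^sup>4 \<rightarrow> 0\<close> polynomially. As \<open>q\<close> is much smaller than \<open>n\<close> to
  the power \<open>-7/9\<close>, the second moment of \<open>P\<close> is negligible against the variance
  of \<open>X\<close>, which is asymptotic to its mean \<open>\<lambda> = (n choose 3) q\<^sup>3\<close>. So \<open>\<chi> = (n - X)/2\<close> up to an error
  that is small in mean square, and it suffices to prove the normal limit for \<open>X\<close>. Forcing the edges
  of one triangle changes \<open>X\<close> by \<open>1\<close> up to a small expected error; by this size-bias coupling the
  characteristic function of \<open>X\<close> nearly satisfies the differential equation of the Poisson
  characteristic function.
\<close>

section \<open>Random subsets of a finite set\<close>

text \<open>The exponent 7/9 is where the error stops being negligible: pairs of triangles with one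
  common vertex number about n^5 q^6, so the mean square of \<open>P\<close> can reach order n^10
  q^12, and division by n^3 q^3 leaves n^7 q^9. The other obstacle is that the isolated triangles
  are determined by the same random graph in which the matching is sought, so no fresh randomness is
  left after their removal. The matching is therefore deduced from properties that hold for all
  vertex sets and all families of disjoint triangles at once and that survive deletion. The cut
  follows the order of the labels: wherever it has to fall, the first quarter of the labels lies on
  one side and the last quarter on the other, so degrees into two fixed blocks suffice. If these
  properties fail, only a polynomial bound on the error is available; failure must have probability
  O(n^-6), and this governs the numerical constants. Controlling the error in mean square, and not
  merely in probability, gives the variance together with the limit law.\<close>

definition random_subset :: "'a set \<Rightarrow> real \<Rightarrow> 'a set pmf" where
  "random_subset A q = map_pmf (\<lambda>b. {e \<in> A. b e}) (Pi_pmf A False (\<lambda>_. bernoulli_pmf q))"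

lemma binomial_random_graph_eq: "binomial_random_graph n p = random_subset (nsets {1..n} 2) p"
  by (simp add: binomial_random_graph_def random_subset_def)

lemma set_pmf_random_subset: "set_pmf (random_subset A q) \<subseteq> Pow A"
  by (auto simp: random_subset_def)

lemma finite_set_pmf_random_subset: "finite A \<Longrightarrow> finite (set_pmf (random_subset A q))"
  by (meson finite_Pow_iff finite_subset set_pmf_random_subset)

lemma integrable_random_subset [simp]:
  fixes f :: "'a set \<Rightarrow> 'b::{banach, second_countable_topology}"
  shows "finite A \<Longrightarrow> integrable (random_subset A q) f"
  by (intro integrable_measure_pmf_finite finite_set_pmf_random_subset)

lemma random_subset_empty [simp]: "random_subset {} q = return_pmf {}"
  by (simp add: random_subset_def)

lemma random_subset_insert:
  assumes "finite A" "e \<notin> A"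
  shows "random_subset (insert e A) q =
    bernoulli_pmf q \<bind> (\<lambda>b. map_pmf (\<lambda>S. if b then insert e S else S) (random_subset A q))"
  using assms unfolding random_subset_def
  by (subst Pi_pmf_insert')
     (auto simp: map_bind_pmf bind_map_pmf map_pmf_comp map_pmf_def[symmetric] intro!: bind_pmf_cong map_pmf_cong
      split: if_splits)

lemma random_subset_complement:
  assumes "finite A" "0 \<le> q" "q \<le> 1"
  shows "random_subset A (1 - q) = map_pmf (\<lambda>S. A - S) (random_subset A q)"
  using assms(1)
proof (induction A rule: finite_induct)
  case (insert e A)
  have N: "bernoulli_pmf (1 - q) = map_pmf Not (bernoulli_pmf q)"
  proof (rule pmf_eqI)
    fix b
    show "pmf (bernoulli_pmf (1 - q)) b = pmf (map_pmf Not (bernoulli_pmf q)) b"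
      using pmf_map_inj'[of Not "bernoulli_pmf q" "\<not> b"] assms by (cases b) (auto simp: inj_def)
  qed
  have S: "insert e A - insert e S = A - S" "S \<subseteq> A \<Longrightarrow> insert e A - S = insert e (A - S)" for S
    using insert.hyps by auto
  show ?case
    unfolding random_subset_insert[OF insert.hyps] insert.IH N map_bind_pmf bind_map_pmf map_pmf_comp
    using set_pmf_random_subset[of A q] insert.hyps(2)
    by (intro bind_pmf_cong map_pmf_cong refl) (auto simp: S)
qed simp

text \<open>Only the membership of \<open>e\<close> is resampled. Both expectations on the right
  stay over the full ground set \<open>A\<close>, so an induction that treats elements one by one
  never has to change the distribution.\<close>

lemma expectation_random_subset_step:
  fixes f :: "'a set \<Rightarrow> 'b::{banach, second_countable_topology}"
  assumes "finite A" "e \<in> A" "0 \<le> q" "q \<le> 1"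
  shows "measure_pmf.expectation (random_subset A q) f =
    q *\<^sub>R measure_pmf.expectation (random_subset A q) (\<lambda>S. f (insert e S)) +
    (1 - q) *\<^sub>R measure_pmf.expectation (random_subset A q) (\<lambda>S. f (S - {e}))"
proof -
  define B where "B = A - {e}"
  have B: "finite B" "e \<notin> B" "A = insert e B" using assms by (auto simp: B_def)
  have E: "measure_pmf.expectation (random_subset A q) g =
     q *\<^sub>R measure_pmf.expectation (random_subset B q) (\<lambda>S. g (insert e S)) +
    (1 - q) *\<^sub>R measure_pmf.expectation (random_subset B q) g" for g :: "'a set \<Rightarrow> 'b"
    unfolding B(3) random_subset_insert[OF B(1,2)]
    by (subst pmf_expectation_bind[where A=UNIV])
       (use assms in \<open>auto simp: UNIV_bool finite_set_pmf_random_subset B\<close>)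
  have C: "measure_pmf.expectation (random_subset B q) (\<lambda>S. f (S - {e})) = measure_pmf.expectation (random_subset B q) f"
    using set_pmf_random_subset[of B q] B
    by (intro integral_cong_AE) (auto simp: AE_measure_pmf_iff intro!: arg_cong[where f=f])
  have D: "q *\<^sub>R x + (1 - q) *\<^sub>R x = x" for x :: 'b
    by (simp add: algebra_simps)
  show ?thesis
    unfolding E[of f] E[of "\<lambda>S. f (insert e S)"] E[of "\<lambda>S. f (S - {e})"]
    by (simp add: C D)
qed

text \<open>By independence, conditioning on the presence of \<open>F\<close> has the same effect as
  adding \<open>F\<close> to a sample. This is the source both of containment probabilities and of
  the size-bias coupling.\<close>

lemma expectation_random_subset_supset:
  fixes f :: "'a set \<Rightarrow> 'b::{banach, second_countable_topology}"
  assumes "finite A" "F \<subseteq> A" "0 \<le> q" "q \<le> 1"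
  shows "measure_pmf.expectation (random_subset A q) (\<lambda>S. if F \<subseteq> S then f S else 0) =
    q ^ card F *\<^sub>R measure_pmf.expectation (random_subset A q) (\<lambda>S. f (S \<union> F))"
proof -
  have "finite F" using assms finite_subset by blast
  then show ?thesis using assms(2)
  proof (induction F arbitrary: f rule: finite_induct)
    case (insert e F)
    show ?case
      apply (subst expectation_random_subset_step[OF assms(1) _ assms(3,4), of e])
      using insert.prems apply simp
      using insert.IH[of "\<lambda>S. f (insert e S)"] insert.prems insert.hyps
      apply (simp add: subset_insert)
      done
  qed simp
qed

lemma prob_random_subset_supset:
  assumes "finite A" "F \<subseteq> A" "0 \<le> q" "q \<le> 1"
  shows "measure_pmf.prob (random_subset A q) {S. F \<subseteq> S} = q ^ card F"
proof -
  have "measure_pmf.prob (random_subset A q) {S. F \<subseteq> S} = measure_pmf.expectation (random_subset A q) (indicator {S. F \<subseteq> S})"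
    by simp
  also have "indicator {S. F \<subseteq> S} = (\<lambda>S. if F \<subseteq> S then 1 else (0::real))"
    by (auto simp: indicator_def)
  finally show ?thesis
    using expectation_random_subset_supset[OF assms, of "\<lambda>_. 1::real"] by simp
qed

text \<open>The generating function of a binomial variable. It is evaluated at
  \<open>c = 1 / 2\<close> for the lower tail of a degree and at \<open>c = 0\<close> for the event
  that \<open>F\<close> is avoided.\<close>

lemma expectation_random_subset_power:
  assumes "finite A" "F \<subseteq> A" "0 \<le> q" "q \<le> 1"
  shows "measure_pmf.expectation (random_subset A q) (\<lambda>S. (c::real) ^ card (S \<inter> F)) = (1 - q + q * c) ^ card F"
proof -
  have "finite F" using assms finite_subset by blast
  then show ?thesis using assms(2)
  proof (induction F rule: finite_induct)
    case (insert e F)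
    have 1: "c ^ card (insert e S \<inter> insert e F) = c * c ^ card (S \<inter> F)" for S
    proof -
      have "insert e S \<inter> insert e F = insert e (S \<inter> F)" by auto
      moreover have "e \<notin> S \<inter> F" "finite (S \<inter> F)" using insert by auto
      ultimately show ?thesis by simp
    qed
    have 2: "(S - {e}) \<inter> insert e F = S \<inter> F" for S using insert by auto
    show ?case
      apply (subst expectation_random_subset_step[OF assms(1) _ assms(3,4), of e])
      using insert apply simp
      using insert by (simp add: 1 2 algebra_simps)
  qed simp
qed

lemma prob_UN_le:
  assumes "finite I"
  shows "measure_pmf.prob M (\<Union>i\<in>I. B i) \<le> (\<Sum>i\<in>I. measure_pmf.prob M (B i))"
  by (intro measure_pmf.finite_measure_subadditive_finite) (use assms in auto)

text \<open>A first-moment bound over the candidate families: disjointness makes the union of a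
  family consist of exactly \<open>m * k\<close> independent elements. It is applied to single edges
  (\<open>m = 1\<close>), triangles (\<open>m = 3\<close>) and triangles with an edge to a fixed
  vertex (\<open>m = 4\<close>).\<close>

lemma prob_disjoint_members_le:
  assumes "finite A" "\<F> \<subseteq> nsets A m" "0 \<le> q" "q \<le> 1"
  shows "measure_pmf.prob (random_subset A q)
     {S. \<exists>\<G>\<subseteq>\<F>. card \<G> = k \<and> disjoint \<G> \<and> \<Union>\<G> \<subseteq> S} \<le> (real (card \<F>) * q ^ m) ^ k / fact k"
proof -
  have fF: "finite \<F>" using assms(1,2) finite_imp_finite_nsets finite_subset by blast
  define I where "I = {\<G>. \<G> \<subseteq> \<F> \<and> card \<G> = k \<and> disjoint \<G>}"
  have fI: "finite I" using fF by (simp add: I_def)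
  have cI: "card I \<le> card \<F> choose k"
    unfolding n_subsets[OF fF, symmetric] I_def by (rule card_mono) (use fF in auto)
  have "measure_pmf.prob (random_subset A q) {S. \<exists>\<G>\<subseteq>\<F>. card \<G> = k \<and> disjoint \<G> \<and> \<Union>\<G> \<subseteq> S}
     = measure_pmf.prob (random_subset A q) (\<Union>\<G>\<in>I. {S. \<Union>\<G> \<subseteq> S})"
    by (rule arg_cong[where f="measure_pmf.prob _"]) (auto simp: I_def)
  also have "\<dots> \<le> (\<Sum>\<G>\<in>I. measure_pmf.prob (random_subset A q) {S. \<Union>\<G> \<subseteq> S})"
    by (rule prob_UN_le[OF fI])
  also have "\<dots> = (\<Sum>\<G>\<in>I. (q ^ m) ^ k)"
  proof (rule sum.cong)
    fix \<G> assume G: "\<G> \<in> I"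
    have fG: "finite \<G>" using G fF finite_subset by (auto simp: I_def)
    have mem: "finite X \<and> card X = m \<and> X \<subseteq> A" if "X \<in> \<G>" for X
      using that G assms(2) by (auto simp: I_def nsets_def)
    have "card (\<Union>\<G>) = (\<Sum>X\<in>\<G>. card X)"
      by (rule card_Union_disjoint) (use G mem in \<open>auto simp: I_def disjoint_def pairwise_def disjnt_def\<close>)
    also have "\<dots> = m * k" using mem G by (simp add: I_def)
    finally have "card (\<Union>\<G>) = m * k" .
    moreover have "\<Union>\<G> \<subseteq> A" using mem by blast
    ultimately show "measure_pmf.prob (random_subset A q) {S. \<Union>\<G> \<subseteq> S} = (q ^ m) ^ k"
      using prob_random_subset_supset[OF assms(1) _ assms(3,4), of "\<Union>\<G>"] by (simp add: power_mult)
  qed simp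
  also have "\<dots> = real (card I) * (q ^ m) ^ k" by simp
  also have "\<dots> \<le> real (card \<F> choose k) * (q ^ m) ^ k"
    using cI assms by (intro mult_right_mono) auto
  also have "\<dots> \<le> (real (card \<F>) ^ k / fact k) * (q ^ m) ^ k"
  proof (intro mult_right_mono)
    have "(card \<F> choose k) * fact k \<le> card \<F> ^ k"
      by (rule binomial_fact_pow)
    then have "real (card \<F> choose k) * fact k \<le> real (card \<F>) ^ k"
      by (metis (mono_tags) of_nat_fact of_nat_le_iff of_nat_mult of_nat_power)
    then show "real (card \<F> choose k) \<le> real (card \<F>) ^ k / fact k"
      by (simp add: field_simps)
  qed (use assms in auto)
  finally show ?thesis by (simp add: power_mult_distrib)
qed

section \<open>Clique covers and the chromatic number of a complement\<close>

text \<open>Induction in the style of Halmos and Vaughan. If a nonempty proper subset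
  \<open>S\<close> is tight, it is matched first, and Hall's condition persists on the rest after
  the neighbours of \<open>S\<close> are deleted. If none is tight, every nonempty proper subset has
  a spare neighbour, so some \<open>a\<close> can be matched to any of its neighbours
  \<open>b\<close> and both removed.\<close>

theorem hall_marriage:
  fixes N :: "'a \<Rightarrow> 'b set"
  assumes "finite A" "\<And>a. a \<in> A \<Longrightarrow> finite (N a)"
    and "\<And>S. S \<subseteq> A \<Longrightarrow> card S \<le> card (\<Union>(N ` S))"
  shows "\<exists>f. inj_on f A \<and> (\<forall>a\<in>A. f a \<in> N a)"
  using assms
proof (induction A arbitrary: N rule: finite_psubset_induct)
  case (psubset A)
  show ?case
  proof (cases "A = {}")
    case False
    then obtain a where a: "a \<in> A" by blast
    show ?thesis
    proof (cases "\<exists>S. S \<noteq> {} \<and> S \<subset> A \<and> card (\<Union>(N ` S)) = card S")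
      case True
      then obtain S where S: "S \<noteq> {}" "S \<subset> A" "card (\<Union>(N ` S)) = card S" by blast
      define N' where "N' = (\<lambda>a. N a - \<Union>(N ` S))"
      have finS: "finite S" using S psubset.hyps finite_subset by blast
      have finNS: "finite (\<Union>(N ` T))" if "T \<subseteq> A" for T
        using that psubset.prems(1) psubset.hyps finite_subset by blast
      obtain f where f: "inj_on f S" "\<forall>a\<in>S. f a \<in> N a"
        using psubset.IH[OF S(2), of N] S(2) psubset.prems by blast
      have "A - S \<subset> A" using S by blast
      moreover have "card T \<le> card (\<Union>(N' ` T))" if T: "T \<subseteq> A - S" for T
      proof -
        have finT: "finite T" using T psubset.hyps finite_subset by blast
        have "card S + card T = card (S \<union> T)"
          using T finS finT by (subst card_Un_disjoint) auto
        also have "\<dots> \<le> card (\<Union>(N ` (S \<union> T)))"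
          by (rule psubset.prems(2)) (use S T in auto)
        also have "\<Union>(N ` (S \<union> T)) = \<Union>(N ` S) \<union> \<Union>(N' ` T)" by (auto simp: N'_def)
        also have "card \<dots> = card (\<Union>(N ` S)) + card (\<Union>(N' ` T))"
          by (rule card_Un_disjoint)
             (use finNS[of S] finNS[of T] S T in \<open>auto simp: N'_def\<close>)
        finally show ?thesis using S by simp
      qed
      ultimately obtain g where g: "inj_on g (A - S)" "\<forall>a\<in>A - S. g a \<in> N' a"
        using psubset.IH[of "A - S" N'] psubset.prems(1) by (auto simp: N'_def)
      define h where "h = (\<lambda>a. if a \<in> S then f a else g a)"
      have "inj_on h (S \<union> (A - S))"
        unfolding inj_on_Un
      proof (intro conjI)
        show "inj_on h S" using f(1) by (auto simp: h_def inj_on_def)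
        show "inj_on h (A - S)" using g(1) by (auto simp: h_def inj_on_def)
        have "h ` S \<subseteq> \<Union>(N ` S)" using f(2) by (auto simp: h_def)
        moreover have "h ` (A - S) \<inter> \<Union>(N ` S) = {}" using g(2) by (auto simp: h_def N'_def)
        ultimately show "h ` (S - (A - S)) \<inter> h ` (A - S - S) = {}" by blast
      qed
      then have "inj_on h A" using S by (simp add: Un_absorb1 psubset_imp_subset)
      moreover have "\<forall>a\<in>A. h a \<in> N a" using f g by (auto simp: h_def N'_def)
      ultimately show ?thesis by blast
    next
      case False
      have "card {a} \<le> card (\<Union>(N ` {a}))" by (rule psubset.prems(2)) (use a in auto)
      then obtain b where b: "b \<in> N a" by fastforce
      define N' where "N' = (\<lambda>a. N a - {b})"
      have "card T \<le> card (\<Union>(N' ` T))" if T: "T \<subseteq> A - {a}" for T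
      proof (cases "T = {}")
        case nonempty: False
        have "T \<subset> A" using T a by blast
        then have "card T < card (\<Union>(N ` T))"
          using False nonempty psubset.prems(2)[of T] by (metis nat_less_le psubset_imp_subset)
        also have "\<dots> \<le> card (insert b (\<Union>(N' ` T)))"
        proof (rule card_mono)
          have "finite T" using T psubset.hyps finite_subset by blast
          then show "finite (insert b (\<Union>(N' ` T)))" using T psubset.prems(1) by (auto simp: N'_def)
        qed (auto simp: N'_def)
        also have "\<dots> \<le> Suc (card (\<Union>(N' ` T)))" by (rule card_insert_le_m1) auto
        finally show ?thesis by simp
      qed simp
      moreover have "A - {a} \<subset> A" using a by blast
      ultimately obtain g where g: "inj_on g (A - {a})" "\<forall>x\<in>A - {a}. g x \<in> N' x"
        using psubset.IH[of "A - {a}" N'] psubset.prems(1) by (auto simp: N'_def)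
      have "b \<notin> g ` (A - {a})" using g(2) by (auto simp: N'_def)
      have "inj_on (g(a := b)) A"
      proof (rule inj_onI)
        fix x y assume xy: "x \<in> A" "y \<in> A" "(g(a := b)) x = (g(a := b)) y"
        show "x = y"
        proof (cases "x = a \<or> y = a")
          case True
          then show ?thesis using xy \<open>b \<notin> g ` (A - {a})\<close> by (metis DiffI fun_upd_apply imageI singletonD)
        next
          case False
          then show ?thesis using xy inj_onD[OF g(1), of x y] by simp
        qed
      qed
      moreover have "\<forall>x\<in>A. (g(a := b)) x \<in> N x" using g(2) b by (simp add: N'_def)
      ultimately show ?thesis by blast
    qed
  qed auto
qed

section \<open>Clique covers and triangle counts\<close>

definition triangles :: "'a set \<Rightarrow> 'a set set \<Rightarrow> 'a set set" where
  "triangles V H = {t \<in> nsets V 3. nsets t 2 \<subseteq> H}"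

lemma finite_triangles [simp]: "finite V \<Longrightarrow> finite (triangles V H)"
  by (simp add: triangles_def finite_imp_finite_nsets)

lemma chromatic_number_le:
  "proper_colouring V E k c \<Longrightarrow> chromatic_number V E \<le> k"
  unfolding chromatic_number_def by (rule Least_le) blast

text \<open>The cliques may overlap: each vertex takes as its colour the index of one chosen clique
  that contains it.\<close>

lemma chromatic_number_complement_le:
  assumes "finite \<P>" "V \<subseteq> \<Union>\<P>" "\<And>P. P \<in> \<P> \<Longrightarrow> nsets P 2 \<subseteq> H"
  shows "chromatic_number V (nsets V 2 - H) \<le> card \<P>"
proof -
  obtain i where i: "bij_betw i \<P> {..<card \<P>}"
    using ex_bij_betw_finite_nat[OF assms(1)] by (auto simp: atLeast0LessThan)
  define P where "P = (\<lambda>v. SOME P. P \<in> \<P> \<and> v \<in> P)"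
  have P: "P v \<in> \<P> \<and> v \<in> P v" if "v \<in> V" for v
    unfolding P_def by (rule someI_ex) (use that assms in auto)
  have "i (P x) \<noteq> i (P y)" if "x \<in> V" "y \<in> V" "{x, y} \<in> nsets V 2 - H" for x y
  proof
    assume "i (P x) = i (P y)"
    then have "P x = P y" using i P that by (auto simp: bij_betw_def inj_on_def)
    then have "{x, y} \<in> nsets (P x) 2" using P that by auto
    then show False using assms(3) P that by blast
  qed
  moreover have "i (P x) < card \<P>" if "x \<in> V" for x
    using i P[OF that] by (auto simp: bij_betw_def)
  ultimately have "proper_colouring V (nsets V 2 - H) (card \<P>) (i \<circ> P)"
    by (auto simp: proper_colouring_def)
  then show ?thesis by (rule chromatic_number_le)
qed

text \<open>Equality holds at \<open>m = 2\<close> and \<open>m = 3\<close>, the sizes of the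
  cliques used in the upper bound on the chromatic number; this is why the two bounds agree to first
  order.\<close>

lemma le_2_plus_choose_3: "m \<le> 2 + (m choose 3)"
proof (induction m)
  case (Suc m)
  show ?case
  proof (cases "m \<ge> 2")
    case True
    then have "1 \<le> m choose 2" by (simp add: Suc_le_eq zero_less_binomial)
    then show ?thesis using Suc by (simp add: eval_nat_numeral)
  qed auto
qed simp

lemma card_le_chromatic_number_complement:
  assumes "finite V"
  shows "card V \<le> 2 * chromatic_number V (nsets V 2 - H) + card (triangles V H)"
proof -
  define k where "k = chromatic_number V (nsets V 2 - H)"
  obtain c where c: "proper_colouring V (nsets V 2 - H) k c"
    using chromatic_number_attained[OF assms, of "nsets V 2 - H"] by (auto simp: k_def)
  define C where "C = (\<lambda>i. {v \<in> V. c v = i})"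
  have fin: "finite (C i)" for i using assms by (simp add: C_def)
  have "V = (\<Union>i<k. C i)" using c by (auto simp: C_def proper_colouring_def)
  then have "card V \<le> (\<Sum>i<k. card (C i))" using card_UN_le[of "{..<k}" C] by simp
  also have "\<dots> \<le> (\<Sum>i<k. 2 + card (nsets (C i) 3))"
    using le_2_plus_choose_3 by (intro sum_mono) (simp add: card_nsets fin)
  also have "\<dots> = 2 * k + (\<Sum>i<k. card (nsets (C i) 3))" by (subst sum.distrib) simp
  also have "(\<Sum>i<k. card (nsets (C i) 3)) = card (\<Union>i<k. nsets (C i) 3)"
  proof (rule card_UN_disjoint[symmetric])
    show "\<forall>i\<in>{..<k}. \<forall>j\<in>{..<k}. i \<noteq> j \<longrightarrow> nsets (C i) 3 \<inter> nsets (C j) 3 = {}"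
    proof (intro ballI impI)
      fix i j :: nat assume "i \<noteq> j"
      have False if t: "t \<in> nsets (C i) 3" "t \<in> nsets (C j) 3" for t
      proof -
        have "t \<noteq> {}" using t by (auto simp: nsets_def)
        then obtain x where "x \<in> t" by blast
        then show False using t \<open>i \<noteq> j\<close> by (auto simp: nsets_def C_def)
      qed
      then show "nsets (C i) 3 \<inter> nsets (C j) 3 = {}" by blast
    qed
  qed (auto simp: fin finite_imp_finite_nsets)
  also have "\<dots> \<le> card (triangles V H)"
  proof (rule card_mono)
    show "(\<Union>i<k. nsets (C i) 3) \<subseteq> triangles V H"
    proof clarify
      fix i t assume t: "t \<in> nsets (C i) 3"
      have "nsets t 2 \<subseteq> H"
      proof
        fix e assume "e \<in> nsets t 2"
        then obtain x y where e: "e = {x, y}" "x \<in> t" "y \<in> t" "x \<noteq> y" by (auto simp: nsets_2_eq)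
        then have "x \<in> C i" "y \<in> C i" using t by (auto simp: nsets_def)
        then show "e \<in> H" using c e unfolding C_def proper_colouring_def by fastforce
      qed
      then show "t \<in> triangles V H" using t by (auto simp: triangles_def nsets_def C_def)
    qed
  qed (use assms in simp)
  finally show ?thesis by (simp add: k_def)
qed

lemma card_edges_between_ge:
  assumes "finite S" "finite T" "S \<inter> T = {}" "\<And>s. s \<in> S \<Longrightarrow> d \<le> card {t \<in> T. {s, t} \<in> H}"
  shows "d * card S \<le> card (H \<inter> nsets (S \<union> T) 2)"
proof -
  have "d * card S = (\<Sum>s\<in>S. d)" by simp
  also have "\<dots> \<le> (\<Sum>s\<in>S. card {t \<in> T. {s, t} \<in> H})" using assms(4) by (rule sum_mono)
  also have "\<dots> = card (SIGMA s:S. {t \<in> T. {s, t} \<in> H})" using assms by (simp add: card_SigmaI)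
  also have "\<dots> = card ((\<lambda>(s, t). {s, t}) ` (SIGMA s:S. {t \<in> T. {s, t} \<in> H}))"
    using assms(3) by (intro card_image[symmetric]) (auto simp: inj_on_def doubleton_eq_iff)
  also have "\<dots> \<le> card (H \<inter> nsets (S \<union> T) 2)"
    using assms by (intro card_mono) (auto intro: finite_imp_finite_nsets)
  finally show ?thesis .
qed

text \<open>Hall's condition is verified separately for small and large sets. A violating set of
  size at most \<open>m\<close> would, together with its neighbours, span too many edges on fewer
  than twice as many vertices. For a larger violating set \<open>S\<close>, no edge leads to the
  part \<open>T2\<close> of \<open>B\<close> outside its neighbourhood, so \<open>hole\<close> makes
  \<open>T2\<close> smaller than \<open>m\<close>; then \<open>T2\<close> is a small violating set
  on the other side, since its neighbours in \<open>A\<close> all lie in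
  \<open>A - S\<close>.\<close>

lemma bipartite_perfect_matching:
  assumes fin: "finite A" "finite B" and disj: "A \<inter> B = {}" and eq: "card A = card B"
    and degA: "\<And>a. a \<in> A \<Longrightarrow> d \<le> card {b \<in> B. {a, b} \<in> H}"
    and degB: "\<And>b. b \<in> B \<Longrightarrow> d \<le> card {a \<in> A. {b, a} \<in> H}"
    and sparse: "\<And>Z. Z \<subseteq> A \<union> B \<Longrightarrow> Z \<noteq> {} \<Longrightarrow> card Z \<le> 2 * m \<Longrightarrow> 2 * card (H \<inter> nsets Z 2) < d * card Z"
    and hole: "\<And>S T. S \<subseteq> A \<Longrightarrow> T \<subseteq> B \<Longrightarrow> card S = m \<Longrightarrow> card T = m \<Longrightarrow> \<exists>s\<in>S. \<exists>t\<in>T. {s, t} \<in> H"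
  shows "\<exists>f. bij_betw f A B \<and> (\<forall>a\<in>A. {a, f a} \<in> H)"
proof -
  \<comment> \<open>Stated without reference to a side, because it is applied once to a set in
    \<open>A\<close> and once to a set in \<open>B\<close>.\<close>
  have expand: False
    if "S \<noteq> {}" "S \<subseteq> A \<union> B" "T \<subseteq> A \<union> B" "S \<inter> T = {}" "card S \<le> m" "card T \<le> card S"
      "\<And>s. s \<in> S \<Longrightarrow> d \<le> card {t \<in> T. {s, t} \<in> H}" for S T
  proof -
    have f: "finite S" "finite T" using that(2,3) fin by (auto intro: finite_subset)
    have c: "card (S \<union> T) \<le> 2 * card S" using card_Un_le[of S T] that(6) by simp
    have "2 * (d * card S) \<le> 2 * card (H \<inter> nsets (S \<union> T) 2)"
      using card_edges_between_ge[OF f that(4,7)] by simp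
    also have "\<dots> < d * card (S \<union> T)" by (rule sparse) (use that c in auto)
    also have "\<dots> \<le> d * (2 * card S)" using c by (rule mult_le_mono2)
    finally show False by simp
  qed
  define N where "N = (\<lambda>a. {b \<in> B. {a, b} \<in> H})"
  have "card S \<le> card (\<Union>(N ` S))" if S: "S \<subseteq> A" for S
  proof (rule ccontr)
    define T where "T = \<Union>(N ` S)"
    define T2 where "T2 = B - T"
    assume "\<not> ?thesis"
    then have lt: "card T < card S" by (simp add: T_def)
    have TB: "T \<subseteq> B" by (auto simp: T_def N_def)
    have fS: "finite S" "finite T" "finite T2" using S TB fin finite_subset by (auto simp: T2_def)
    have ne: "S \<noteq> {}" using lt by auto
    have noedge: "{s, t} \<notin> H" if "s \<in> S" "t \<in> T2" for s t
      using that by (auto simp: T_def T2_def N_def)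
    have cT2: "card T2 = card A - card T" using card_Diff_subset[OF fS(2) TB] eq by (simp add: T2_def)
    have cSA: "card S \<le> card A" using S fin card_mono by blast
    show False
    proof (cases "card S \<le> m")
      case True
      show False
      proof (rule expand[of S T])
        fix s assume "s \<in> S"
        then have "{b \<in> B. {s, b} \<in> H} = {b \<in> T. {s, b} \<in> H}" using TB by (auto simp: T_def N_def)
        then show "d \<le> card {t \<in> T. {s, t} \<in> H}" using degA[of s] \<open>s \<in> S\<close> S by auto
      qed (use ne S TB disj lt True in auto)
    next
      case False
      then obtain S' where S': "S' \<subseteq> S" "card S' = m"
        by (meson le_cases obtain_subset_with_card_n)
      have "card T2 < m"
      proof (rule ccontr)
        assume "\<not> card T2 < m"
        then obtain T' where T': "T' \<subseteq> T2" "card T' = m"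
          by (meson not_less obtain_subset_with_card_n)
        have "\<exists>s\<in>S'. \<exists>t\<in>T'. {s, t} \<in> H" by (rule hole) (use S' T' S in \<open>auto simp: T2_def\<close>)
        then show False using noedge S' T' by blast
      qed
      moreover have "card (A - S) = card A - card S" using card_Diff_subset[OF fS(1) S] .
      moreover have "T2 \<noteq> {}" using cT2 lt cSA by auto
      ultimately show False
      proof (intro expand[of T2 "A - S"])
        fix b assume b: "b \<in> T2"
        then have "{a \<in> A. {b, a} \<in> H} = {a \<in> A - S. {b, a} \<in> H}"
          using noedge by (auto simp: insert_commute)
        then show "d \<le> card {t \<in> A - S. {b, t} \<in> H}" using degB[of b] b by (auto simp: T2_def)
      qed (use cT2 lt cSA disj in \<open>auto simp: T2_def\<close>)
    qed
  qed
  then obtain f where f: "inj_on f A" "\<forall>a\<in>A. f a \<in> N a"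
    using hall_marriage[of A N] fin by (auto simp: N_def)
  have "f ` A \<subseteq> B" using f by (auto simp: N_def)
  then have "f ` A = B" using f eq fin by (metis card_image card_subset_eq)
  then show ?thesis using f by (auto simp: bij_betw_def N_def)
qed

text \<open>The count in an initial segment grows by at most one per step and hence takes every
  value up to \<open>card W\<close>. This provides the cut that halves the vertices outside the
  removed triangles.\<close>

lemma initial_segment_of_card:
  assumes "W \<subseteq> {1..n::nat}" "h \<le> card W"
  shows "\<exists>m\<le>n. card (W \<inter> {1..m}) = h"
  using assms
proof (induction n arbitrary: W h)
  case (Suc n)
  have W: "finite W" using Suc.prems finite_subset by blast
  show ?case
  proof (cases "h = card W")
    case True
    then show ?thesis using Suc.prems by (intro exI[of _ "Suc n"]) (auto simp: Int_absorb2)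
  next
    case False
    have "W \<subseteq> insert (Suc n) (W \<inter> {1..n})" using Suc.prems by (auto simp: le_Suc_eq)
    then have "card W \<le> card (insert (Suc n) (W \<inter> {1..n}))" by (intro card_mono) auto
    also have "\<dots> \<le> Suc (card (W \<inter> {1..n}))" by (rule card_insert_le_m1) auto
    finally have "h \<le> card (W \<inter> {1..n})" using False Suc.prems by simp
    then obtain m where "m \<le> n" "card (W \<inter> {1..n} \<inter> {1..m}) = h"
      using Suc.IH[of "W \<inter> {1..n}" h] by auto
    then show ?thesis
      by (intro exI[of _ m]) (auto simp: Int_assoc intro: arg_cong[where f=card])
  qed
qed auto

section \<open>The deterministic upper bound on the chromatic number\<close>

definition touching_pairs :: "'a set \<Rightarrow> 'a set set \<Rightarrow> ('a set \<times> 'a set) set" where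
  "touching_pairs V H =
     {(s, t). s \<in> triangles V H \<and> t \<in> triangles V H \<and> s \<noteq> t \<and> s \<inter> t \<noteq> {}}"

definition isolated_triangles :: "'a set \<Rightarrow> 'a set set \<Rightarrow> 'a set set" where
  "isolated_triangles V H = {s \<in> triangles V H. \<forall>t\<in>triangles V H. s \<noteq> t \<longrightarrow> s \<inter> t = {}}"

text \<open>Pairs are ordered, so every triangle that is not isolated is the first component of some
  touching pair.\<close>

lemma card_triangles_le:
  assumes "finite V"
  shows "card (triangles V H) \<le> card (isolated_triangles V H) + card (touching_pairs V H)"
proof -
  have fin: "finite (touching_pairs V H)"
    by (rule finite_subset[of _ "triangles V H \<times> triangles V H"]) (use assms in \<open>auto simp: touching_pairs_def\<close>)
  have "triangles V H \<subseteq> isolated_triangles V H \<union> fst ` touching_pairs V H"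
    by (force simp: isolated_triangles_def touching_pairs_def)
  then have "card (triangles V H) \<le> card (isolated_triangles V H \<union> fst ` touching_pairs V H)"
    using fin assms by (intro card_mono) (auto simp: isolated_triangles_def)
  also have "\<dots> \<le> card (isolated_triangles V H) + card (fst ` touching_pairs V H)" by (rule card_Un_le)
  also have "card (fst ` touching_pairs V H) \<le> card (touching_pairs V H)" by (rule card_image_le[OF fin])
  finally show ?thesis by simp
qed

text \<open>Conditions are imposed on all sets and families because the triangles to be removed
  depend on \<open>H\<close>. The two fixed blocks of \<open>n div 4\<close> labels serve every cut
  that can arise. The margin \<open>3 * k\<close> in the degrees pays for at most
  \<open>3 * (k - 1)\<close> neighbours lost to removed triangles and for one vertex dropped by
  parity; \<open>d\<close> is what remains for the matching.\<close>

locale good_graph =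
  fixes n d k m :: nat and H :: "nat set set"
  assumes low_degree: "\<And>v. v \<in> {1..n} \<Longrightarrow> d + 3 * k \<le> card {u \<in> {1..n div 4}. {v, u} \<in> H}"
    and high_degree: "\<And>v. v \<in> {1..n} \<Longrightarrow> d + 3 * k \<le> card {u \<in> {n - n div 4 + 1..n}. {v, u} \<in> H}"
    and sparse: "\<And>Z. Z \<subseteq> {1..n} \<Longrightarrow> Z \<noteq> {} \<Longrightarrow> card Z \<le> 2 * m \<Longrightarrow> 2 * card (H \<inter> nsets Z 2) < d * card Z"
    and hole: "\<And>S T. S \<subseteq> {1..n} \<Longrightarrow> T \<subseteq> {1..n} \<Longrightarrow> S \<inter> T = {} \<Longrightarrow> card S = m \<Longrightarrow> card T = m \<Longrightarrow>
      \<exists>s\<in>S. \<exists>t\<in>T. {s, t} \<in> H"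
    and few_adjacent: "\<And>v \<S>. v \<in> {1..n} \<Longrightarrow> \<S> \<subseteq> triangles {1..n} H \<Longrightarrow> disjoint \<S> \<Longrightarrow> v \<notin> \<Union>\<S> \<Longrightarrow>
      (\<And>t. t \<in> \<S> \<Longrightarrow> \<exists>u\<in>t. {v, u} \<in> H) \<Longrightarrow> card \<S> < k"
    and few_disjoint: "\<And>\<S>. \<S> \<subseteq> triangles {1..n} H \<Longrightarrow> disjoint \<S> \<Longrightarrow> 24 * card \<S> \<le> n"
    and n_ge: "4 \<le> n"
begin

text \<open>The cover consists of the isolated triangles \<open>F\<close>, \<open>h\<close> matching
  edges and at most one single vertex. Twice its size is at most
  \<open>2 * card F + card W + 1\<close>, and \<open>card W = n - 3 * card F\<close>.\<close>

lemma two_chromatic_number_le: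
  "2 * chromatic_number {1..n} (nsets {1..n} 2 - H) + card (isolated_triangles {1..n} H) \<le> n + 1"
proof -
  define F where "F = isolated_triangles {1..n} H"
  define U where "U = \<Union>F"
  define W where "W = {1..n} - U"
  define h where "h = card W div 2"
  have F_tri: "F \<subseteq> triangles {1..n} H" by (auto simp: F_def isolated_triangles_def)
  have F_disj: "disjoint F"
    using F_tri by (auto simp: F_def isolated_triangles_def disjoint_def)
  have F_card: "finite t \<and> card t = 3 \<and> t \<subseteq> {1..n} \<and> nsets t 2 \<subseteq> H" if "t \<in> F" for t
    using that F_tri by (auto simp: triangles_def nsets_def[of _ 3])
  have finF: "finite F" using F_tri finite_subset by fastforce
  have U_sub: "U \<subseteq> {1..n}" using F_card by (auto simp: U_def)
  have "card U = (\<Sum>t\<in>F. card t)" unfolding U_def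
    by (rule card_Union_disjoint) (use F_card F_disj in \<open>auto simp: disjoint_def pairwise_def disjnt_def\<close>)
  also have "\<dots> = 3 * card F" using F_card by simp
  finally have cU: "card U = 3 * card F" .
  have F_small: "24 * card F \<le> n" using few_disjoint[OF F_tri F_disj] .
  have cW: "card W = n - 3 * card F"
    unfolding W_def using U_sub cU card_Diff_subset[of U "{1..n}"] finite_subset[of U "{1..n}"] by simp
  \<comment> \<open>The triangles of \<open>F\<close> containing a neighbour of \<open>v\<close>
    form a disjoint family to which \<open>few_adjacent\<close> applies; each accounts for at most
    three neighbours.\<close>
  have few: "card {u \<in> U. {v, u} \<in> H} \<le> 3 * (k - 1)" if "v \<in> W" for v
  proof -
    define S where "S = {t \<in> F. \<exists>u\<in>t. {v, u} \<in> H}"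
    have "card S < k"
    proof (rule few_adjacent[of v])
      show "disjoint S" by (rule pairwise_subset[OF F_disj]) (auto simp: S_def)
    qed (use that F_tri in \<open>auto simp: S_def W_def U_def\<close>)
    moreover have "card {u \<in> U. {v, u} \<in> H} \<le> card (\<Union>S)"
    proof (rule card_mono)
      show "finite (\<Union>S)" using finF F_card by (auto simp: S_def)
    qed (auto simp: S_def U_def)
    moreover have "card (\<Union>S) \<le> (\<Sum>t\<in>S. card t)" by (rule card_Union_le_sum_card)
    moreover have "(\<Sum>t\<in>S. card t) = 3 * card S" using F_card by (simp add: S_def)
    ultimately show ?thesis by simp
  qed
  obtain c where c: "c \<le> n" "card (W \<inter> {1..c}) = h"
    using initial_segment_of_card[of W n h] by (auto simp: W_def h_def)
  define A where "A = W \<inter> {1..c}"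
  have finW: "finite W" by (simp add: W_def)
  have "card (W - {1..c}) = card W - h"
    using card_Diff_subset_Int[of W "{1..c}"] c by (simp add: finW)
  moreover have "card W \<ge> 2 * h" "card W \<le> 2 * h + 1" by (auto simp: h_def)
  ultimately have Bsize: "h \<le> card (W - {1..c})" "card (W - {1..c}) \<le> h + 1" by auto
  obtain B where B: "B \<subseteq> W - {1..c}" "card B = h" using obtain_subset_with_card_n[OF Bsize(1)] by blast
  have finB: "finite B" using B finW finite_subset by blast
  have A: "card A = h" "A \<subseteq> W" using c by (auto simp: A_def)
  have finA: "finite A" using A finW finite_subset by blast
  have rest: "card (W - (A \<union> B)) = card W - 2 * h"
  proof -
    have "card (A \<union> B) = 2 * h" using A B finA finB by (subst card_Un_disjoint) (auto simp: A_def)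
    then show ?thesis using A B finA finB by (subst card_Diff_subset) auto
  qed
  \<comment> \<open>Since \<open>24 * card F \<le> n\<close>, at least 7/8 of the vertices stay in
    \<open>W\<close>, so half of \<open>W\<close> is at least a quarter of all. Hence the first
    block lies before the cut \<open>c\<close> and the last block after it.\<close>
  have h_ge: "n div 4 \<le> h" using cW F_small n_ge by (simp add: h_def)
  have c_ge: "h \<le> c" using c card_mono[of "{1..c}" "W \<inter> {1..c}"] by simp
  have c_le: "h \<le> n - c"
  proof -
    have "W - {1..c} \<subseteq> {c+1..n}" by (auto simp: W_def)
    then show ?thesis using Bsize card_mono[of "{c+1..n}" "W - {1..c}"] by simp
  qed
  have "\<exists>f. bij_betw f A B \<and> (\<forall>a\<in>A. {a, f a} \<in> H)"
  proof (rule bipartite_perfect_matching[OF finA finB])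
    show "A \<inter> B = {}" using B by (auto simp: A_def)
    show "card A = card B" using A B by simp
    fix a assume a: "a \<in> A"
    then have aW: "a \<in> W" "a \<in> {1..n}" using A by (auto simp: W_def)
    have "{u \<in> {n - n div 4 + 1..n}. {a, u} \<in> H} \<subseteq>
        {b \<in> B. {a, b} \<in> H} \<union> {u \<in> U. {a, u} \<in> H} \<union> (W - {1..c} - B)"
      using c_le h_ge by (auto simp: W_def)
    then have "card {u \<in> {n - n div 4 + 1..n}. {a, u} \<in> H} \<le>
        card ({b \<in> B. {a, b} \<in> H} \<union> {u \<in> U. {a, u} \<in> H} \<union> (W - {1..c} - B))"
      using finB finW finite_subset[OF U_sub] by (intro card_mono) auto
    also have "\<dots> \<le> card ({b \<in> B. {a, b} \<in> H} \<union> {u \<in> U. {a, u} \<in> H}) + card (W - {1..c} - B)"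
      by (rule card_Un_le)
    also have "\<dots> \<le> card {b \<in> B. {a, b} \<in> H} + card {u \<in> U. {a, u} \<in> H} + card (W - {1..c} - B)"
      using card_Un_le by (rule add_right_mono)
    also have "card (W - {1..c} - B) \<le> 1"
      using B Bsize finB by (subst card_Diff_subset) auto
    \<comment> \<open>The empty family in \<open>few_adjacent\<close> yields \<open>0 < k\<close>;
      with truncated subtraction this is what makes \<open>3 * (k - 1) + 1\<close> at most
      \<open>3 * k\<close>.\<close>
    finally show "d \<le> card {b \<in> B. {a, b} \<in> H}"
      using few[OF aW(1)] high_degree[OF aW(2)] few_adjacent[OF aW(2), of "{}"] by simp
  next
    fix b assume b: "b \<in> B"
    then have bW: "b \<in> W" "b \<in> {1..n}" using B by (auto simp: W_def)
    have "{u \<in> {1..n div 4}. {b, u} \<in> H} \<subseteq> {a \<in> A. {b, a} \<in> H} \<union> {u \<in> U. {b, u} \<in> H}"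
      using c_ge h_ge c(1) by (auto simp: W_def A_def)
    then have "card {u \<in> {1..n div 4}. {b, u} \<in> H} \<le> card ({a \<in> A. {b, a} \<in> H} \<union> {u \<in> U. {b, u} \<in> H})"
      using finA finite_subset[OF U_sub] by (intro card_mono) auto
    also have "\<dots> \<le> card {a \<in> A. {b, a} \<in> H} + card {u \<in> U. {b, u} \<in> H}" by (rule card_Un_le)
    finally show "d \<le> card {a \<in> A. {b, a} \<in> H}"
      using few[OF bW(1)] low_degree[OF bW(2)] by simp
  next
    fix Z assume "Z \<subseteq> A \<union> B" "Z \<noteq> {}" "card Z \<le> 2 * m"
    then show "2 * card (H \<inter> nsets Z 2) < d * card Z"
      using A B by (intro sparse) (auto simp: W_def)
  next
    fix S T assume "S \<subseteq> A" "T \<subseteq> B" "card S = m" "card T = m"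
    then show "\<exists>s\<in>S. \<exists>t\<in>T. {s, t} \<in> H"
      using A B by (intro hole) (auto simp: W_def A_def)
  qed
  then obtain f where f: "bij_betw f A B" "\<forall>a\<in>A. {a, f a} \<in> H" by blast
  define \<P> where "\<P> = F \<union> (\<lambda>a. {a, f a}) ` A \<union> (\<lambda>v. {v}) ` (W - (A \<union> B))"
  have "chromatic_number {1..n} (nsets {1..n} 2 - H) \<le> card \<P>"
  proof (rule chromatic_number_complement_le)
    show "finite \<P>" using finF finA finW by (simp add: \<P>_def)
    have "B = f ` A" using f by (simp add: bij_betw_def)
    then show "{1..n} \<subseteq> \<Union>\<P>" by (auto simp: \<P>_def W_def U_def)
    show "nsets P 2 \<subseteq> H" if "P \<in> \<P>" for P
      using that f F_card by (auto simp: \<P>_def nsets_singleton_iff split: if_splits)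
  qed
  also have "card \<P> \<le> card F + card ((\<lambda>a. {a, f a}) ` A) + card ((\<lambda>v. {v}) ` (W - (A \<union> B)))"
    unfolding \<P>_def by (meson add_right_mono card_Un_le le_trans)
  also have "\<dots> \<le> card F + h + (card W - 2 * h)"
    using card_image_le[OF finA, of "\<lambda>a. {a, f a}"] card_image_le[of "W - (A \<union> B)" "\<lambda>v. {v}"] A rest finW by simp
  finally have "chromatic_number {1..n} (nsets {1..n} 2 - H) \<le> card F + h + (card W - 2 * h)" .
  moreover have "card W \<ge> 2 * h" "card W \<le> 2 * h + 1" by (auto simp: h_def)
  ultimately show ?thesis using cW F_small by (simp add: F_def)
qed

end

section \<open>Poisson approximation of the triangle count\<close>

abbreviation random_graph_on :: "'a set \<Rightarrow> real \<Rightarrow> 'a set set pmf" where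
  "random_graph_on V q \<equiv> random_subset (nsets V 2) q"

section \<open>Characteristic functions close to Poisson\<close>

lemma one_minus_cos_le: "1 - cos s \<le> s\<^sup>2 / 2" for s :: real
proof -
  have "1 - cos s = 2 * (sin (s / 2))\<^sup>2" using cos_double_sin[of "s / 2"] by simp
  also have "(sin (s / 2))\<^sup>2 \<le> (s / 2)\<^sup>2" using abs_sin_x_le_abs_x[of "s/2"] by (metis abs_le_square_iff)
  finally show ?thesis by (simp add: power_divide)
qed

text \<open>The characteristic function \<open>exp (l * (iexp s - 1))\<close> of the Poisson distribution solves
  \<open>f' s = \<i> * l * iexp s * f s\<close>; the product of an approximate solution with the reciprocal of
  the exact one is nearly constant.\<close>

lemma approx_poisson_char:
  fixes f f' :: "real \<Rightarrow> complex"
  assumes deriv: "\<And>s. (f has_vector_derivative f' s) (at s)" and "f 0 = 1" "0 \<le> l" "0 \<le> \<delta>"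
    and bound: "\<And>s. cmod (f' s - \<i> * l * iexp s * f s) \<le> l * \<bar>s\<bar> * \<delta>"
  shows "cmod (f s - exp (l * (iexp s - 1))) \<le> l * s\<^sup>2 * \<delta> * exp (l * s\<^sup>2 / 2)"
proof -
  define g where "g = (\<lambda>s. exp (- (l * (iexp s - 1))))"
  define h where "h = (\<lambda>s. f s * g s)"
  define B where "B = l * \<bar>s\<bar> * \<delta> * exp (l * s\<^sup>2 / 2)"
  have dg: "(g has_vector_derivative (- (\<i> * l * iexp s) * g s)) (at s)" for s
  proof -
    have "((\<lambda>s. - (l * (iexp s - 1))) has_vector_derivative - (l * (\<i> * iexp s))) (at s)"
      using has_vector_derivative_minus[OF has_vector_derivative_mult_right[OF
          has_vector_derivative_diff[OF has_vector_derivative_iexp has_vector_derivative_const]]]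
      by simp
    from field_vector_diff_chain_at[OF this DERIV_exp] show ?thesis
      by (simp add: g_def o_def mult_ac)
  qed
  have dh: "(h has_vector_derivative ((f' s - \<i> * l * iexp s * f s) * g s)) (at s)" for s
    using has_vector_derivative_mult[OF deriv dg, of s] by (simp add: h_def algebra_simps)
  have cg: "cmod (g s) = exp (l * (1 - cos s))" for s
    by (simp add: g_def norm_exp_eq_Re cis_conv_exp[symmetric] algebra_simps)
  \<comment> \<open>The mean value inequality on the segment from 0 to \<open>s\<close>. The factor
    \<open>exp (l * s\<^sup>2 / 2)\<close> bounds the modulus of the reciprocal \<open>g\<close>,
    through \<open>1 - cos u \<le> s\<^sup>2 / 2\<close>.\<close>
  have "norm (h s - h 0) \<le> B * norm (s - 0)"
  proof (rule differentiable_bound[where S="closed_segment 0 s" and f'="\<lambda>u x. x *\<^sub>R ((f' u - \<i> * l * iexp u * f u) * g u)"])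
    fix u assume "u \<in> closed_segment 0 s"
    then have u: "\<bar>u\<bar> \<le> \<bar>s\<bar>" by (auto simp: closed_segment_eq_real_ivl split: if_splits)
    show "(h has_derivative (\<lambda>x. x *\<^sub>R ((f' u - \<i> * l * iexp u * f u) * g u))) (at u within closed_segment 0 s)"
      using dh[of u] by (simp add: has_vector_derivative_def has_derivative_at_withinI)
    have "cmod ((f' u - \<i> * l * iexp u * f u) * g u) \<le> (l * \<bar>u\<bar> * \<delta>) * exp (l * (1 - cos u))"
      unfolding norm_mult cg by (intro mult_right_mono bound) auto
    also have "\<dots> \<le> (l * \<bar>s\<bar> * \<delta>) * exp (l * s\<^sup>2 / 2)"
    proof (intro mult_mono)
      have "1 - cos u \<le> s\<^sup>2 / 2"
        using one_minus_cos_le[of u] u by (simp add: abs_le_square_iff)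
      then show "exp (l * (1 - cos u)) \<le> exp (l * s\<^sup>2 / 2)"
        using mult_left_mono[OF _ assms(3), of "1 - cos u" "s\<^sup>2 / 2"] by simp
    qed (use u assms in \<open>auto intro!: mult_right_mono mult_left_mono\<close>)
    finally show "onorm (\<lambda>x. x *\<^sub>R ((f' u - \<i> * l * iexp u * f u) * g u)) \<le> B"
      by (intro onorm_le) (simp add: B_def mult.commute mult_right_mono mult_left_mono)
  qed auto
  then have "cmod (h s - 1) \<le> B * \<bar>s\<bar>" using assms(2) by (simp add: h_def g_def)
  \<comment> \<open>The exact solution is a characteristic function, of modulus at most 1, so
    multiplying back by it loses nothing.\<close>
  moreover have "cmod (f s - exp (l * (iexp s - 1))) \<le> cmod (h s - 1)"
  proof -
    have "g s * exp (l * (iexp s - 1)) = 1" unfolding g_def by (simp add: exp_minus)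
    then have "f s - exp (l * (iexp s - 1)) = (h s - 1) * exp (l * (iexp s - 1))"
      unfolding h_def by (simp add: left_diff_distrib mult.assoc)
    moreover have "cmod (exp (l * (iexp s - 1))) = exp (- (l * (1 - cos s)))"
      by (simp add: norm_exp_eq_Re cis_conv_exp[symmetric] algebra_simps)
    moreover have "exp (- (l * (1 - cos s))) \<le> 1" using assms(3) by simp
    ultimately show ?thesis by (simp add: norm_mult mult_left_le)
  qed
  ultimately have "cmod (f s - exp (l * (iexp s - 1))) \<le> B * \<bar>s\<bar>" by linarith
  also have "B * \<bar>s\<bar> = l * (\<bar>s\<bar> * \<bar>s\<bar>) * \<delta> * exp (l * s\<^sup>2 / 2)"
    unfolding B_def by (simp only: ac_simps)
  also have "\<bar>s\<bar> * \<bar>s\<bar> = s\<^sup>2" by (simp add: power2_eq_square)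
  finally show ?thesis .
qed

text \<open>The central limit theorem for Poisson variables of growing mean. The exponents are
  compared: with \<open>x = t / sqrt (l n)\<close>, the expansion of \<open>iexp x\<close> to second
  order leaves at most \<open>l n * \<bar>x\<bar> ^ 3\<close>, which is
  \<open>\<bar>t\<bar> ^ 3 / sqrt (l n)\<close>.\<close>

lemma poisson_char_limit:
  fixes l :: "nat \<Rightarrow> real"
  assumes "filterlim l at_top sequentially"
  shows "(\<lambda>n. exp (l n * (iexp (t / sqrt (l n)) - 1) - \<i> * t * sqrt (l n)) :: complex)
    \<longlonglongrightarrow> exp (- (t\<^sup>2 / 2))"
proof -
  have pos: "\<forall>\<^sub>F n in sequentially. 0 < l n" using assms by (simp add: filterlim_at_top_dense)
  have "(\<lambda>n. (l n * (iexp (t / sqrt (l n)) - 1) - \<i> * t * sqrt (l n)) - (- (t\<^sup>2 / 2)) :: complex) \<longlonglongrightarrow> 0"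
  proof (rule Lim_null_comparison)
    show "(\<lambda>n. \<bar>t\<bar> ^ 3 / sqrt (l n)) \<longlonglongrightarrow> 0"
      by (intro tendsto_divide_0[OF tendsto_const] filterlim_at_top_imp_at_infinity
          filterlim_compose[OF sqrt_at_top assms])
    show "\<forall>\<^sub>F n in sequentially. cmod ((l n * (iexp (t / sqrt (l n)) - 1) - \<i> * t * sqrt (l n)) - (- (t\<^sup>2 / 2))) \<le> \<bar>t\<bar> ^ 3 / sqrt (l n)"
      using pos
    proof eventually_elim
      case (elim n)
      define r where "r = sqrt (l n)"
      have r: "r > 0" "l n = r\<^sup>2" using elim by (auto simp: r_def)
      define x where "x = t / r"
      have t: "t = x * r" using r by (simp add: x_def)
      have e: "sqrt (l n) = r" by (simp add: r_def)
      have "(l n * (iexp x - 1) - \<i> * t * r) - (- (t\<^sup>2 / 2)) =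
        r\<^sup>2 * (iexp x - (\<Sum>k\<le>2. (\<i> * x) ^ k / fact k))"
      proof -
        have sum: "(\<Sum>k\<le>2. (\<i> * complex_of_real x) ^ k / fact k) = 1 + \<i> * x - x * x / 2"
          by (simp add: numeral_2_eq_2 mult_ac)
        show ?thesis unfolding r(2) t sum by (simp add: power2_eq_square algebra_simps)
      qed
      then have "(l n * (iexp (t / sqrt (l n)) - 1) - \<i> * t * sqrt (l n)) - (- (t\<^sup>2 / 2)) =
        r\<^sup>2 * (iexp x - (\<Sum>k\<le>2. (\<i> * x) ^ k / fact k))"
        by (simp add: e x_def)
      then have "cmod ((l n * (iexp (t / sqrt (l n)) - 1) - \<i> * t * sqrt (l n)) - (- (t\<^sup>2 / 2)))
        = r\<^sup>2 * cmod (iexp x - (\<Sum>k\<le>2. (\<i> * x) ^ k / fact k))"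
        by (simp only: norm_mult norm_of_real) simp
      also have "\<dots> \<le> r\<^sup>2 * (\<bar>x\<bar> ^ Suc 2 / fact (Suc 2))"
        by (intro mult_left_mono iexp_approx1) simp
      also have "\<bar>x\<bar> ^ Suc 2 / fact (Suc 2) \<le> \<bar>x\<bar> ^ 3"
      proof -
        have six: "y / 6 \<le> y" if "0 \<le> y" for y :: real using that by simp
        have f: "Suc 2 = 3" "fact 3 = (6 :: real)" by (simp_all add: fact_numeral)
        show ?thesis unfolding f by (rule six) simp
      qed
      finally have "cmod ((l n * (iexp (t / sqrt (l n)) - 1) - \<i> * t * sqrt (l n)) - (- (t\<^sup>2 / 2)))
        \<le> r\<^sup>2 * \<bar>x\<bar> ^ 3" by (simp add: mult_left_mono)
      also have "\<dots> = \<bar>t\<bar> ^ 3 / r" using r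
        by (simp add: x_def power_divide power2_eq_square power3_eq_cube)
      finally show ?case by (simp add: r_def)
    qed
  qed
  then have "(\<lambda>n. l n * (iexp (t / sqrt (l n)) - 1) - \<i> * t * sqrt (l n) :: complex) \<longlonglongrightarrow> - (t\<^sup>2 / 2)"
    by (rule LIM_zero_cancel)
  then show ?thesis by (rule tendsto_exp[THEN tendsto_eq_rhs]) (simp flip: exp_of_real)
qed

text \<open>A triangle created by adding the edges of \<open>\<alpha>\<close> is
  \<open>\<alpha>\<close> itself or shares exactly one edge \<open>f\<close> with it; in the second
  case its third vertex \<open>z\<close> is joined to both ends of \<open>f\<close> by edges of
  \<open>S\<close>. So the count grows by one, with a loss if \<open>\<alpha>\<close> was present
  already and a gain controlled by the pairs \<open>(f, z)\<close>.\<close>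

lemma card_triangles_union_bounds:
  assumes "finite V" "\<alpha> \<in> nsets V 3"
  shows "card (triangles V S) + 1 \<le> card (triangles V (S \<union> nsets \<alpha> 2)) + (if nsets \<alpha> 2 \<subseteq> S then 1 else 0)"
    and "card (triangles V (S \<union> nsets \<alpha> 2)) \<le> card (triangles V S) + 1 +
      card {(f, z) \<in> nsets \<alpha> 2 \<times> V. z \<notin> \<alpha> \<and> (\<lambda>v. {v, z}) ` f \<subseteq> S}"
proof -
  let ?T = "triangles V S" and ?T' = "triangles V (S \<union> nsets \<alpha> 2)"
  let ?Y = "{(f, z) \<in> nsets \<alpha> 2 \<times> V. z \<notin> \<alpha> \<and> (\<lambda>v. {v, z}) ` f \<subseteq> S}"
  have \<alpha>: "\<alpha> \<subseteq> V" "finite \<alpha>" "card \<alpha> = 3" using assms(2) by (auto simp: nsets_def)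
  have sub: "insert \<alpha> ?T \<subseteq> ?T'" using assms(2) by (auto simp: triangles_def)
  have "card (insert \<alpha> ?T) \<le> card ?T'" using sub assms(1) by (intro card_mono) auto
  moreover have "card (insert \<alpha> ?T) = card ?T + (if nsets \<alpha> 2 \<subseteq> S then 0 else 1)"
    using assms by (auto simp: insert_absorb triangles_def[of V S] card_insert_if finite_imp_finite_nsets)
  ultimately show "card ?T + 1 \<le> card ?T' + (if nsets \<alpha> 2 \<subseteq> S then 1 else 0)" by (simp split: if_splits)
  have finY: "finite ?Y"
    by (rule finite_subset[of _ "nsets \<alpha> 2 \<times> V"]) (use assms \<alpha> in \<open>auto intro: finite_imp_finite_nsets\<close>)
  have "?T' \<subseteq> insert \<alpha> ?T \<union> (\<lambda>(f, z). insert z f) ` ?Y"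
  proof
    fix \<beta> assume \<beta>: "\<beta> \<in> ?T'"
    then have b: "\<beta> \<subseteq> V" "finite \<beta>" "card \<beta> = 3" by (auto simp: triangles_def nsets_def)
    show "\<beta> \<in> insert \<alpha> ?T \<union> (\<lambda>(f, z). insert z f) ` ?Y"
    proof (cases "\<beta> = \<alpha> \<or> nsets \<beta> 2 \<subseteq> S")
      case True
      then show ?thesis using \<beta> by (auto simp: triangles_def)
    next
      case False
      then obtain f where f: "f \<in> nsets \<beta> 2" "f \<in> nsets \<alpha> 2" using \<beta> by (auto simp: triangles_def)
      then have f2: "f \<subseteq> \<beta>" "f \<subseteq> \<alpha>" "card f = 2" "finite f" by (auto simp: nsets_def)
      then have "card (\<beta> - f) = 1" using b by (subst card_Diff_subset) auto
      then obtain z where z: "\<beta> - f = {z}" by (metis card_1_singletonE)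
      then have bz: "\<beta> = insert z f" "z \<notin> f" using f2 by auto
      have "z \<notin> \<alpha>"
      proof
        assume "z \<in> \<alpha>"
        then have "\<beta> \<subseteq> \<alpha>" using bz f2 by auto
        then have "\<beta> = \<alpha>" using card_subset_eq \<alpha> b by metis
        then show False using False by simp
      qed
      moreover have "(\<lambda>v. {v, z}) ` f \<subseteq> S"
      proof clarify
        fix v assume v: "v \<in> f"
        then have "{v, z} \<in> nsets \<beta> 2" using bz by auto
        then have "{v, z} \<in> S \<union> nsets \<alpha> 2" using \<beta> unfolding triangles_def by blast
        then show "{v, z} \<in> S" using \<open>z \<notin> \<alpha>\<close> by simp
      qed
      moreover have "z \<in> V" using bz b by auto
      ultimately show ?thesis using bz f by force
    qed
  qed
  then have "card ?T' \<le> card (insert \<alpha> ?T \<union> (\<lambda>(f, z). insert z f) ` ?Y)"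
    using finY assms by (intro card_mono) auto
  also have "\<dots> \<le> card (insert \<alpha> ?T) + card ((\<lambda>(f, z). insert z f) ` ?Y)" by (rule card_Un_le)
  also have "\<dots> \<le> (card ?T + 1) + card ?Y"
    using card_image_le[OF finY] card_insert_le_m1[of "card ?T + 1" ?T \<alpha>]
    by (intro add_mono) auto
  finally show "card ?T' \<le> card ?T + 1 + card ?Y" by simp
qed

lemma iexp_diff_le: "cmod (iexp a - iexp b) \<le> \<bar>a - b\<bar>"
proof -
  have "iexp a - iexp b = iexp b * (iexp (a - b) - 1)"
    by (simp add: right_diff_distrib mult_exp_exp algebra_simps)
  then have "cmod (iexp a - iexp b) = cmod (iexp (a - b) - 1)" by (simp add: norm_mult)
  then show ?thesis using iexp_approx1[of "a - b" 0] by simp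
qed

lemma nsets_2_triangle:
  assumes "\<alpha> \<in> nsets V 3"
  shows "nsets \<alpha> 2 \<subseteq> nsets V 2" "card (nsets \<alpha> 2) = 3" "finite (nsets \<alpha> 2)"
  using assms nsets_mono[of \<alpha> V 2] card_nsets[of \<alpha> 2]
  by (auto simp: nsets_def[of _ 3] finite_imp_finite_nsets choose_two)

lemma card_triangles_eq_sum:
  assumes "finite V"
  shows "real (card (triangles V S)) = (\<Sum>\<alpha>\<in>nsets V 3. if nsets \<alpha> 2 \<subseteq> S then 1 else 0)"
  using assms by (simp add: triangles_def finite_imp_finite_nsets flip: sum.inter_filter)

context
  fixes V :: "'a set" and q :: real
  assumes V: "finite V" and q: "0 \<le> q" "q \<le> 1"
begin

lemma fin_pairs: "finite (nsets V 2)" by (rule finite_imp_finite_nsets[OF V])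

lemma integrable_random_graph [simp]:
  "integrable (random_graph_on V q) (f :: _ \<Rightarrow> 'b::{banach, second_countable_topology})"
  by (rule integrable_random_subset[OF fin_pairs])

text \<open>The size-bias identity: the count is expanded over triples and the edges of each triple
  are forced. Vector values of \<open>g\<close> let it cover the derivative of the characteristic
  function as well as the second moment.\<close>

lemma expectation_triangles_times:
  fixes g :: "'a set set \<Rightarrow> 'b::{banach, second_countable_topology}"
  shows "measure_pmf.expectation (random_graph_on V q) (\<lambda>S. real (card (triangles V S)) *\<^sub>R g S) =
    (\<Sum>\<alpha>\<in>nsets V 3. q ^ 3 *\<^sub>R measure_pmf.expectation (random_graph_on V q) (\<lambda>S. g (S \<union> nsets \<alpha> 2)))"
proof -
  have "measure_pmf.expectation (random_graph_on V q) (\<lambda>S. real (card (triangles V S)) *\<^sub>R g S) =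
    measure_pmf.expectation (random_graph_on V q) (\<lambda>S. \<Sum>\<alpha>\<in>nsets V 3. if nsets \<alpha> 2 \<subseteq> S then g S else 0)"
    by (simp add: card_triangles_eq_sum[OF V] scaleR_sum_left if_distrib[of "\<lambda>x. x *\<^sub>R _"] cong: if_cong)
  also have "\<dots> = (\<Sum>\<alpha>\<in>nsets V 3. measure_pmf.expectation (random_graph_on V q) (\<lambda>S. if nsets \<alpha> 2 \<subseteq> S then g S else 0))"
    by (rule Bochner_Integration.integral_sum) simp
  also have "\<dots> = (\<Sum>\<alpha>\<in>nsets V 3. q ^ 3 *\<^sub>R measure_pmf.expectation (random_graph_on V q) (\<lambda>S. g (S \<union> nsets \<alpha> 2)))"
  proof (rule sum.cong[OF refl])
    fix \<alpha> assume a: "\<alpha> \<in> nsets V 3"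
    show "measure_pmf.expectation (random_graph_on V q) (\<lambda>S. if nsets \<alpha> 2 \<subseteq> S then g S else 0) =
      q ^ 3 *\<^sub>R measure_pmf.expectation (random_graph_on V q) (\<lambda>S. g (S \<union> nsets \<alpha> 2))"
      using expectation_random_subset_supset[OF fin_pairs nsets_2_triangle(1)[OF a] q, of g]
      unfolding nsets_2_triangle(2)[OF a] .
  qed
  finally show ?thesis .
qed

lemma expectation_triangles:
  "measure_pmf.expectation (random_graph_on V q) (\<lambda>S. real (card (triangles V S))) = real (card V choose 3) * q ^ 3"
  using expectation_triangles_times[of "\<lambda>_. 1::real"] by (simp add: card_nsets)

text \<open>There are at most \<open>3 * card V\<close> pairs \<open>(f, z)\<close>, and each
  requires the two distinct edges from \<open>z\<close> to the ends of \<open>f\<close>.\<close>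

lemma expectation_new_triangles_le:
  assumes "\<alpha> \<in> nsets V 3"
  shows "measure_pmf.expectation (random_graph_on V q)
     (\<lambda>S. real (card {(f, z) \<in> nsets \<alpha> 2 \<times> V. z \<notin> \<alpha> \<and> (\<lambda>v. {v, z}) ` f \<subseteq> S})) \<le> 3 * card V * q\<^sup>2"
proof -
  define I where "I = {(f, z) \<in> nsets \<alpha> 2 \<times> V. z \<notin> \<alpha>}"
  have I: "I \<subseteq> nsets \<alpha> 2 \<times> V" by (auto simp: I_def)
  have finI: "finite I" by (rule finite_subset[OF I]) (use V nsets_2_triangle[OF assms] in auto)
  have "card I \<le> card (nsets \<alpha> 2 \<times> V)"
    by (rule card_mono[OF _ I]) (use V nsets_2_triangle[OF assms] in auto)
  then have cI: "card I \<le> 3 * card V" using nsets_2_triangle[OF assms] by (simp add: card_cartesian_product)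
  have "real (card {(f, z) \<in> nsets \<alpha> 2 \<times> V. z \<notin> \<alpha> \<and> (\<lambda>v. {v, z}) ` f \<subseteq> S}) =
    (\<Sum>i\<in>I. if (\<lambda>v. {v, snd i}) ` fst i \<subseteq> S then 1 else 0)" for S
  proof -
    have "{(f, z) \<in> nsets \<alpha> 2 \<times> V. z \<notin> \<alpha> \<and> (\<lambda>v. {v, z}) ` f \<subseteq> S} = {i \<in> I. (\<lambda>v. {v, snd i}) ` fst i \<subseteq> S}"
      by (auto simp: I_def)
    then show ?thesis using finI by (simp flip: sum.inter_filter)
  qed
  then have "measure_pmf.expectation (random_graph_on V q)
     (\<lambda>S. real (card {(f, z) \<in> nsets \<alpha> 2 \<times> V. z \<notin> \<alpha> \<and> (\<lambda>v. {v, z}) ` f \<subseteq> S})) =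
     (\<Sum>i\<in>I. measure_pmf.expectation (random_graph_on V q) (\<lambda>S. if (\<lambda>v. {v, snd i}) ` fst i \<subseteq> S then 1 else 0))"
    by (simp add: Bochner_Integration.integral_sum)
  also have "\<dots> = (\<Sum>i\<in>I. q\<^sup>2)"
  proof (rule sum.cong[OF refl])
    fix i assume i: "i \<in> I"
    obtain f z where fz: "i = (f, z)" by (cases i)
    have f: "f \<subseteq> \<alpha>" "card f = 2" "z \<in> V" "z \<notin> \<alpha>" "\<alpha> \<subseteq> V" using i fz assms by (auto simp: I_def nsets_def)
    have "card ((\<lambda>v. {v, z}) ` f) = 2"
      using f by (subst card_image) (auto simp: inj_on_def doubleton_eq_iff)
    moreover have "(\<lambda>v. {v, z}) ` f \<subseteq> nsets V 2"
    proof clarify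
      fix v assume "v \<in> f"
      then have "v \<in> V" "v \<noteq> z" using f by blast+
      then show "{v, z} \<in> nsets V 2" using f by simp
    qed
    ultimately show "measure_pmf.expectation (random_graph_on V q) (\<lambda>S. if (\<lambda>v. {v, snd i}) ` fst i \<subseteq> S then 1 else 0) = q\<^sup>2"
      using expectation_random_subset_supset[OF fin_pairs _ q, of "(\<lambda>v. {v, z}) ` f" "\<lambda>_. 1::real"] fz by simp
  qed
  also have "\<dots> = real (card I) * q\<^sup>2" by simp
  also have "\<dots> \<le> real (3 * card V) * q\<^sup>2" by (rule mult_right_mono[OF of_nat_mono[OF cI]]) simp
  finally show ?thesis by simp
qed

text \<open>Bounds the expected deviation from \<open>+ 1\<close> when a triangle is forced:
  \<open>q ^ 3\<close> is the chance that it was present already, and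
  \<open>3 * card V * q\<^sup>2\<close> bounds the expected number of other triangles that
  appear.\<close>

definition "coupling_error = q ^ 3 + 3 * card V * q\<^sup>2"

lemma expectation_triangle_change_le:
  assumes "\<alpha> \<in> nsets V 3"
  shows "measure_pmf.expectation (random_graph_on V q)
     (\<lambda>S. \<bar>real (card (triangles V (S \<union> nsets \<alpha> 2))) - (real (card (triangles V S)) + 1)\<bar>) \<le> coupling_error"
proof -
  have "measure_pmf.expectation (random_graph_on V q)
     (\<lambda>S. \<bar>real (card (triangles V (S \<union> nsets \<alpha> 2))) - (real (card (triangles V S)) + 1)\<bar>) \<le>
    measure_pmf.expectation (random_graph_on V q)
     (\<lambda>S. (if nsets \<alpha> 2 \<subseteq> S then 1 else 0) +
      real (card {(f, z) \<in> nsets \<alpha> 2 \<times> V. z \<notin> \<alpha> \<and> (\<lambda>v. {v, z}) ` f \<subseteq> S}))"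
  proof (rule integral_mono)
    fix S
    show "\<bar>real (card (triangles V (S \<union> nsets \<alpha> 2))) - (real (card (triangles V S)) + 1)\<bar> \<le>
      (if nsets \<alpha> 2 \<subseteq> S then 1 else 0) +
      real (card {(f, z) \<in> nsets \<alpha> 2 \<times> V. z \<notin> \<alpha> \<and> (\<lambda>v. {v, z}) ` f \<subseteq> S})"
      using card_triangles_union_bounds[OF V assms, of S] by (auto split: if_splits)
  qed simp_all
  also have "\<dots> = q ^ 3 + measure_pmf.expectation (random_graph_on V q)
     (\<lambda>S. real (card {(f, z) \<in> nsets \<alpha> 2 \<times> V. z \<notin> \<alpha> \<and> (\<lambda>v. {v, z}) ` f \<subseteq> S}))"
    using expectation_random_subset_supset[OF fin_pairs nsets_2_triangle(1)[OF assms] q, of "\<lambda>_. 1::real"]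
    unfolding nsets_2_triangle(2)[OF assms]
    by (subst Bochner_Integration.integral_add) simp_all
  finally show ?thesis
    using expectation_new_triangles_le[OF assms] by (simp add: coupling_error_def)
qed

lemma triangles_char_deriv:
  "((\<lambda>s. measure_pmf.expectation (random_graph_on V q) (\<lambda>S. iexp (s * real (card (triangles V S)))))
    has_vector_derivative
    measure_pmf.expectation (random_graph_on V q)
      (\<lambda>S. real (card (triangles V S)) *\<^sub>R (\<i> * iexp (s * real (card (triangles V S)))))) (at s)"
proof -
  let ?A = "Pow (nsets V 2)"
  have E: "measure_pmf.expectation (random_graph_on V q) g = (\<Sum>S\<in>?A. pmf (random_graph_on V q) S *\<^sub>R g S)"
    for g :: "'a set set \<Rightarrow> complex"
    by (rule integral_measure_pmf) (use fin_pairs set_pmf_random_subset in auto)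
  have "((\<lambda>s. iexp (s * c)) has_vector_derivative c *\<^sub>R (\<i> * iexp (s * c))) (at s)" for c :: real
  proof -
    have "((\<lambda>s. s * c) has_vector_derivative c) (at s)" by (auto intro!: derivative_eq_intros)
    from vector_diff_chain_at[OF this has_vector_derivative_iexp] show ?thesis by (simp add: o_def)
  qed
  then show ?thesis unfolding E
    by (intro has_vector_derivative_sum bounded_linear.has_vector_derivative[OF bounded_linear_scaleR_right])
qed

text \<open>The size-bias identity writes the derivative as a sum over forced triangles. Replacing
  the count after forcing by the old count plus one turns the sum into the right-hand side of the
  Poisson equation; as \<open>iexp\<close> is 1-Lipschitz, this costs at most
  \<open>\<bar>s\<bar> * coupling_error\<close> for each triple, with weight
  \<open>q ^ 3\<close>.\<close>

lemma triangles_char_approx: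
  defines "l \<equiv> real (card V choose 3) * q ^ 3"
  shows "cmod (measure_pmf.expectation (random_graph_on V q) (\<lambda>S. iexp (s * real (card (triangles V S)))) -
      exp (l * (iexp s - 1))) \<le> l * s\<^sup>2 * coupling_error * exp (l * s\<^sup>2 / 2)"
proof (rule approx_poisson_char[OF triangles_char_deriv])
  show "0 \<le> l" "0 \<le> coupling_error" using q by (simp_all add: l_def coupling_error_def)
  fix s :: real
  let ?E = "measure_pmf.expectation (random_graph_on V q)"
  let ?X = "\<lambda>S. real (card (triangles V S))"
  have 1: "?E (\<lambda>S. ?X S *\<^sub>R (\<i> * iexp (s * ?X S))) =
      (\<Sum>\<alpha>\<in>nsets V 3. q ^ 3 *\<^sub>R ?E (\<lambda>S. \<i> * iexp (s * ?X (S \<union> nsets \<alpha> 2))))"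
    by (rule expectation_triangles_times)
  have 2: "\<i> * l * iexp s * ?E (\<lambda>S. iexp (s * ?X S)) =
     (\<Sum>\<alpha>\<in>nsets V 3. q ^ 3 *\<^sub>R ?E (\<lambda>S. \<i> * iexp (s * (?X S + 1))))"
  proof -
    have "?E (\<lambda>S. \<i> * iexp (s * (?X S + 1))) = ?E (\<lambda>S. (\<i> * iexp s) * iexp (s * ?X S))"
      by (simp add: ring_distribs exp_add mult_ac)
    also have "\<dots> = \<i> * iexp s * ?E (\<lambda>S. iexp (s * ?X S))" by (rule integral_mult_right_zero)
    finally show ?thesis by (simp add: l_def card_nsets scaleR_conv_of_real)
  qed
  have "cmod (?E (\<lambda>S. ?X S *\<^sub>R (\<i> * iexp (s * ?X S))) - \<i> * l * iexp s * ?E (\<lambda>S. iexp (s * ?X S))) =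
    cmod (\<Sum>\<alpha>\<in>nsets V 3. q ^ 3 *\<^sub>R ?E (\<lambda>S. \<i> * (iexp (s * ?X (S \<union> nsets \<alpha> 2)) - iexp (s * (?X S + 1)))))"
    unfolding 1 2 sum_subtractf[symmetric] scaleR_diff_right[symmetric] right_diff_distrib
    by (subst Bochner_Integration.integral_diff) simp_all
  also have "\<dots> \<le> (\<Sum>\<alpha>\<in>nsets V 3. q ^ 3 * (\<bar>s\<bar> * coupling_error))"
  proof (rule sum_norm_le)
    fix \<alpha> assume a: "\<alpha> \<in> nsets V 3"
    have "cmod (?E (\<lambda>S. \<i> * (iexp (s * ?X (S \<union> nsets \<alpha> 2)) - iexp (s * (?X S + 1))))) \<le>
        ?E (\<lambda>S. cmod (\<i> * (iexp (s * ?X (S \<union> nsets \<alpha> 2)) - iexp (s * (?X S + 1)))))"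
      by (rule integral_norm_bound)
    also have "\<dots> \<le> ?E (\<lambda>S. \<bar>s\<bar> * \<bar>?X (S \<union> nsets \<alpha> 2) - (?X S + 1)\<bar>)"
    proof (rule integral_mono)
      fix S
      show "cmod (\<i> * (iexp (s * ?X (S \<union> nsets \<alpha> 2)) - iexp (s * (?X S + 1)))) \<le> \<bar>s\<bar> * \<bar>?X (S \<union> nsets \<alpha> 2) - (?X S + 1)\<bar>"
        using iexp_diff_le[of "s * ?X (S \<union> nsets \<alpha> 2)" "s * (?X S + 1)"]
        by (simp only: norm_mult norm_ii mult_1 right_diff_distrib[symmetric] abs_mult[symmetric])
    qed simp_all
    also have "\<dots> = \<bar>s\<bar> * ?E (\<lambda>S. \<bar>?X (S \<union> nsets \<alpha> 2) - (?X S + 1)\<bar>)" by (rule integral_mult_right_zero)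
    also have "\<dots> \<le> \<bar>s\<bar> * coupling_error"
      by (intro mult_left_mono expectation_triangle_change_le a) simp
    finally show "norm (q ^ 3 *\<^sub>R ?E (\<lambda>S. \<i> * (iexp (s * ?X (S \<union> nsets \<alpha> 2)) - iexp (s * (?X S + 1)))))
      \<le> q ^ 3 * (\<bar>s\<bar> * coupling_error)"
      using q by (simp only: norm_scaleR) (simp add: mult_left_mono)
  qed
  also have "\<dots> = l * \<bar>s\<bar> * coupling_error" by (simp add: l_def card_nsets mult_ac)
  finally show "cmod (?E (\<lambda>S. ?X S *\<^sub>R (\<i> * iexp (s * ?X S))) - \<i> * l * iexp s * ?E (\<lambda>S. iexp (s * ?X S)))
    \<le> l * \<bar>s\<bar> * coupling_error" .
qed simp

text \<open>The same coupling with the count itself as test function; \<open>l\<^sup>2 + l\<close>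
  is the second moment of a Poisson variable with mean \<open>l\<close>.\<close>

lemma expectation_triangles_square_bounds:
  defines "l \<equiv> real (card V choose 3) * q ^ 3"
  shows "\<bar>measure_pmf.expectation (random_graph_on V q) (\<lambda>S. (real (card (triangles V S)))\<^sup>2) - (l\<^sup>2 + l)\<bar> \<le> l * coupling_error"
proof -
  let ?E = "measure_pmf.expectation (random_graph_on V q)"
  let ?X = "\<lambda>S. real (card (triangles V S))"
  have "?E (\<lambda>S. (?X S)\<^sup>2) = (\<Sum>\<alpha>\<in>nsets V 3. q ^ 3 * ?E (\<lambda>S. ?X (S \<union> nsets \<alpha> 2)))"
    using expectation_triangles_times[of ?X] by (simp add: power2_eq_square)
  moreover have "l\<^sup>2 + l = (\<Sum>\<alpha>\<in>nsets V 3. q ^ 3 * ?E (\<lambda>S. ?X S + 1))"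
  proof -
    have "?E (\<lambda>S. ?X S + 1) = l + 1"
      by (subst Bochner_Integration.integral_add) (simp_all add: expectation_triangles l_def)
    then show ?thesis by (simp add: l_def card_nsets power2_eq_square algebra_simps)
  qed
  ultimately have "?E (\<lambda>S. (?X S)\<^sup>2) - (l\<^sup>2 + l) =
     (\<Sum>\<alpha>\<in>nsets V 3. q ^ 3 * ?E (\<lambda>S. ?X (S \<union> nsets \<alpha> 2) - (?X S + 1)))"
    unfolding Bochner_Integration.integral_diff[OF integrable_random_graph integrable_random_graph]
    by (simp only: sum_subtractf right_diff_distrib)
  also have "\<bar>\<dots>\<bar> \<le> (\<Sum>\<alpha>\<in>nsets V 3. q ^ 3 * coupling_error)"
  proof (rule sum_norm_le[where 'a=real, unfolded real_norm_def])
    fix \<alpha> assume a: "\<alpha> \<in> nsets V 3"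
    have "\<bar>?E (\<lambda>S. ?X (S \<union> nsets \<alpha> 2) - (?X S + 1))\<bar> \<le> ?E (\<lambda>S. \<bar>?X (S \<union> nsets \<alpha> 2) - (?X S + 1)\<bar>)"
      using integral_norm_bound[of "random_graph_on V q" "\<lambda>S. ?X (S \<union> nsets \<alpha> 2) - (?X S + 1)"] by simp
    also have "\<dots> \<le> coupling_error" by (rule expectation_triangle_change_le[OF a])
    finally show "\<bar>q ^ 3 * ?E (\<lambda>S. ?X (S \<union> nsets \<alpha> 2) - (?X S + 1))\<bar> \<le> q ^ 3 * coupling_error"
      using q by (simp add: abs_mult mult_left_mono)
  qed
  also have "\<dots> = l * coupling_error" by (simp add: l_def card_nsets)
  finally show ?thesis .
qed

end

section \<open>Second moment of the number of touching triangles\<close>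

definition touching_index :: "'a set \<Rightarrow> ('a set \<times> 'a set) set" where
  "touching_index V = {(s, t). s \<in> nsets V 3 \<and> t \<in> nsets V 3 \<and> s \<noteq> t \<and> s \<inter> t \<noteq> {}}"

definition pair_edges :: "'a set \<times> 'a set \<Rightarrow> 'a set set" where
  "pair_edges = (\<lambda>(s, t). nsets s 2 \<union> nsets t 2)"

text \<open>The probability that both triangles of the pair occur when all edges inside
  \<open>A\<close> are forced; \<open>A = {}\<close> gives the unconditional probability.\<close>

definition pair_weight :: "real \<Rightarrow> 'a set \<Rightarrow> 'a set \<times> 'a set \<Rightarrow> real" where
  "pair_weight q A \<pi> = q ^ card (pair_edges \<pi> - nsets A 2)"

text \<open>Defined on the diagonal too, so that sums over all tuples of vertices factor; the
  degenerate tuples add nonnegative terms to an upper bound.\<close>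

definition edge_weight :: "real \<Rightarrow> 'a set \<Rightarrow> 'a \<Rightarrow> 'a \<Rightarrow> real" where
  "edge_weight q A x y = (if x \<in> A \<and> y \<in> A then 1 else q)"

lemma power_card_Diff:
  fixes q :: real
  assumes "finite E"
  shows "q ^ card (E - F) = (\<Prod>e\<in>E. if e \<in> F then 1 else q)"
  using assms by (simp add: prod.If_cases Diff_eq)

lemma nsets_2_three: "a \<noteq> b \<Longrightarrow> a \<noteq> c \<Longrightarrow> b \<noteq> c \<Longrightarrow> nsets {a, b, c} 2 = {{a, b}, {a, c}, {b, c}}"
  by (auto simp: nsets_2_eq)

text \<open>The six edges are distinct, so for a fixed centre \<open>v\<close> the weight splits
  into a factor in \<open>a\<close>, \<open>b\<close> and the same factor in \<open>c\<close>,
  \<open>d\<close>; summation then produces a square.\<close>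

lemma pair_weight_bowtie:
  assumes "distinct [v, a, b, c, d]"
  shows "pair_weight q A ({v, a, b}, {v, c, d}) =
    (edge_weight q A v a * edge_weight q A v b * edge_weight q A a b) *
    (edge_weight q A v c * edge_weight q A v d * edge_weight q A c d)"
proof -
  have "pair_edges ({v, a, b}, {v, c, d}) = {{v, a}, {v, b}, {a, b}, {v, c}, {v, d}, {c, d}}"
    using assms by (auto simp: pair_edges_def nsets_2_three)
  then show ?thesis
    unfolding pair_weight_def
    by (subst power_card_Diff) (use assms in \<open>auto simp: doubleton_eq_iff edge_weight_def\<close>)
qed

lemma pair_weight_diamond:
  assumes "distinct [u, v, a, b]"
  shows "pair_weight q A ({u, v, a}, {u, v, b}) =
    edge_weight q A u v * ((edge_weight q A u a * edge_weight q A v a) *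
    (edge_weight q A u b * edge_weight q A v b))"
proof -
  have "pair_edges ({u, v, a}, {u, v, b}) = {{u, v}, {u, a}, {v, a}, {u, b}, {v, b}}"
    using assms by (auto simp: pair_edges_def nsets_2_three)
  then show ?thesis
    unfolding pair_weight_def
    by (subst power_card_Diff) (use assms in \<open>auto simp: doubleton_eq_iff edge_weight_def\<close>)
qed

definition "bowtie_pair = (\<lambda>(v, a, b, c, d). ({v, a, b}, {v, c, d}))"
definition "diamond_pair = (\<lambda>(u, v, a, b). ({u, v, a}, {u, v, b}))"
definition "bowties V = {(v, a, b, c, d) \<in> V \<times> V \<times> V \<times> V \<times> V. distinct [v, a, b, c, d]}"
definition "diamonds V = {(u, v, a, b) \<in> V \<times> V \<times> V \<times> V. distinct [u, v, a, b]}"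

text \<open>Distinct triples that meet share one vertex (a bowtie) or two (a diamond). The tuples
  name each pair several times, which an upper bound tolerates.\<close>

lemma touching_index_subset:
  "touching_index V \<subseteq> bowtie_pair ` bowties V \<union> diamond_pair ` diamonds V"
proof clarify
  fix s t assume st: "(s, t) \<in> touching_index V" "(s, t) \<notin> diamond_pair ` diamonds V"
  then have s: "s \<subseteq> V" "finite s" "card s = 3" and t: "t \<subseteq> V" "finite t" "card t = 3"
    and ne: "s \<noteq> t" "s \<inter> t \<noteq> {}" by (auto simp: touching_index_def nsets_def)
  have ne3: "card (s \<inter> t) \<noteq> 3"
  proof
    assume "card (s \<inter> t) = 3"
    then have "s \<inter> t = s" "s \<inter> t = t" using s t by (metis Int_lower1 Int_lower2 card_subset_eq)+
    then show False using ne by simp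
  qed
  have "card (s \<inter> t) \<le> 3" "card (s \<inter> t) \<noteq> 0"
    using s card_mono[of s "s \<inter> t"] ne by auto
  then consider "card (s \<inter> t) = 1" | "card (s \<inter> t) = 2" using ne3 by linarith
  then show "(s, t) \<in> bowtie_pair ` bowties V"
  proof cases
    case 1
    then obtain v where v: "s \<inter> t = {v}" by (metis card_1_singletonE)
    then have "v \<in> s" "v \<in> t" by auto
    then have "card (s - {v}) = 2" "card (t - {v}) = 2" using s t by simp_all
    then obtain a b c d where abcd: "s - {v} = {a, b}" "a \<noteq> b" "t - {v} = {c, d}" "c \<noteq> d"
      by (meson card_2_iff)
    have "s = {v, a, b}" "t = {v, c, d}" using abcd \<open>v \<in> s\<close> \<open>v \<in> t\<close> by blast+
    moreover have "distinct [v, a, b, c, d]" using abcd v by auto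
    ultimately have "(v, a, b, c, d) \<in> bowties V" "(s, t) = bowtie_pair (v, a, b, c, d)"
      using s t by (auto simp: bowties_def bowtie_pair_def)
    then show ?thesis by blast
  next
    case 2
    then obtain u v where uv: "s \<inter> t = {u, v}" "u \<noteq> v" by (meson card_2_iff)
    have "card (s - {u, v}) = 1" "card (t - {u, v}) = 1" using s t uv by (subst card_Diff_subset; auto)+
    then obtain a b where ab: "s - {u, v} = {a}" "t - {u, v} = {b}" by (metis card_1_singletonE)
    have "s = {u, v, a}" "t = {u, v, b}" using ab uv by blast+
    moreover have "distinct [u, v, a, b]" using ab uv by auto
    ultimately have "(u, v, a, b) \<in> diamonds V" "(s, t) = diamond_pair (u, v, a, b)"
      using s t by (auto simp: diamonds_def diamond_pair_def)
    then show ?thesis using st by blast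
  qed
qed

lemma edge_weight_nonneg: "0 \<le> q \<Longrightarrow> 0 \<le> edge_weight q A x y"
  by (simp add: edge_weight_def)

lemma sum_of_bool_mem: "finite V \<Longrightarrow> A \<subseteq> V \<Longrightarrow> (\<Sum>x\<in>V. of_bool (x \<in> A)) = real (card A)"
  by (simp add: Int_absorb1)

context
  fixes V A :: "'a set" and q :: real
  assumes V: "finite V" "A \<subseteq> V" and q: "0 \<le> q" "q \<le> 1"
begin

private abbreviation (input) "w \<equiv> edge_weight q A"
private abbreviation (input) "n \<equiv> real (card V)"
private abbreviation (input) "k \<equiv> real (card A)"

text \<open>The weights are dominated by separable expressions: with \<open>s\<close> indicating
  \<open>v \<in> A\<close>, the edge from \<open>v\<close> to \<open>a\<close> is bounded by
  \<open>r a\<close>, and the edge from \<open>a\<close> to \<open>b\<close> by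
  \<open>q + of_bool (a \<in> A) * of_bool (b \<in> A)\<close>. The double sum then becomes a
  combination of two squares of single sums.\<close>

lemma sum_pairs_weight_le:
  "(\<Sum>a\<in>V. \<Sum>b\<in>V. w v a * w v b * w a b) \<le>
    (if v \<in> A then q * (n * q + k)\<^sup>2 + (k * (1 + q))\<^sup>2 else q\<^sup>2 * (n\<^sup>2 * q + k\<^sup>2))"
proof -
  define s where "s = (of_bool (v \<in> A) :: real)"
  define r where "r = (\<lambda>a. q + s * of_bool (a \<in> A))"
  have r0: "0 \<le> r a" for a using q by (simp add: r_def s_def)
  have "(\<Sum>a\<in>V. \<Sum>b\<in>V. w v a * w v b * w a b) \<le>
     (\<Sum>a\<in>V. \<Sum>b\<in>V. r a * r b * (q + of_bool (a \<in> A) * of_bool (b \<in> A)))"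
    using q by (intro sum_mono mult_mono) (auto simp: r_def s_def edge_weight_def)
  also have "\<dots> = q * (\<Sum>a\<in>V. r a)\<^sup>2 + (\<Sum>a\<in>V. r a * of_bool (a \<in> A))\<^sup>2"
  proof -
    have "(\<Sum>a\<in>V. \<Sum>b\<in>V. r a * r b * (q + of_bool (a \<in> A) * of_bool (b \<in> A))) =
      (\<Sum>a\<in>V. \<Sum>b\<in>V. q * (r a * r b) + (r a * of_bool (a \<in> A)) * (r b * of_bool (b \<in> A)))"
      by (intro sum.cong refl) (simp only: ring_distribs mult_ac)
    also have "\<dots> = q * (\<Sum>a\<in>V. \<Sum>b\<in>V. r a * r b) +
      (\<Sum>a\<in>V. \<Sum>b\<in>V. (r a * of_bool (a \<in> A)) * (r b * of_bool (b \<in> A)))"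
      by (simp only: sum.distrib sum_distrib_left)
    finally show ?thesis by (simp only: power2_eq_square sum_product)
  qed
  also have "(\<Sum>a\<in>V. r a) = n * q + s * k"
    using sum_of_bool_mem[OF V] by (simp add: r_def sum.distrib flip: sum_distrib_left)
  also have "(\<Sum>a\<in>V. r a * of_bool (a \<in> A)) = (\<Sum>a\<in>V. (q + s) * of_bool (a \<in> A))"
    by (intro sum.cong refl) (simp add: r_def)
  also have "\<dots> = (q + s) * k" using sum_of_bool_mem[OF V] by (simp flip: sum_distrib_left)
  finally show ?thesis
    by (cases "v \<in> A") (simp_all add: s_def power2_eq_square algebra_simps)
qed

lemma sum_common_weight_le:
  "(\<Sum>a\<in>V. w u a * w v a) \<le> n * q\<^sup>2 + k * q * (of_bool (u \<in> A) + of_bool (v \<in> A)) + k * of_bool (u \<in> A \<and> v \<in> A)"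
proof -
  have "(\<Sum>a\<in>V. w u a * w v a) \<le>
    (\<Sum>a\<in>V. (q + of_bool (u \<in> A) * of_bool (a \<in> A)) * (q + of_bool (v \<in> A) * of_bool (a \<in> A)))"
    using q by (intro sum_mono mult_mono) (auto simp: edge_weight_def)
  also have "\<dots> = (\<Sum>a\<in>V. q\<^sup>2 + (q * (of_bool (u \<in> A) + of_bool (v \<in> A)) + of_bool (u \<in> A \<and> v \<in> A)) * of_bool (a \<in> A))"
    by (intro sum.cong refl) (simp add: power2_eq_square algebra_simps)
  also have "\<dots> = n * q\<^sup>2 + (q * (of_bool (u \<in> A) + of_bool (v \<in> A)) + of_bool (u \<in> A \<and> v \<in> A)) * k"
    using sum_of_bool_mem[OF V] by (simp add: sum.distrib flip: sum_distrib_left)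
  finally show ?thesis by (simp add: algebra_simps)
qed

text \<open>For a fixed centre the sum is the square of a one-triangle sum; centres inside and
  outside \<open>A\<close> are bounded separately.\<close>

lemma sum_bowtie_weight_le:
  "(\<Sum>x\<in>bowties V. pair_weight q A (bowtie_pair x)) \<le>
    k * (q * (n * q + k)\<^sup>2 + (k * (1 + q))\<^sup>2)\<^sup>2 + n * (q\<^sup>2 * (n\<^sup>2 * q + k\<^sup>2))\<^sup>2"
proof -
  define t where "t = (\<lambda>v. \<Sum>a\<in>V. \<Sum>b\<in>V. w v a * w v b * w a b)"
  define M1 where "M1 = q * (n * q + k)\<^sup>2 + (k * (1 + q))\<^sup>2"
  define M2 where "M2 = q\<^sup>2 * (n\<^sup>2 * q + k\<^sup>2)"
  have "(\<Sum>x\<in>bowties V. pair_weight q A (bowtie_pair x)) =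
    (\<Sum>(v, a, b, c, d)\<in>bowties V. (w v a * w v b * w a b) * (w v c * w v d * w c d))"
    by (intro sum.cong refl) (auto simp: bowties_def bowtie_pair_def pair_weight_bowtie)
  also have "\<dots> \<le> (\<Sum>(v, a, b, c, d)\<in>V \<times> V \<times> V \<times> V \<times> V. (w v a * w v b * w a b) * (w v c * w v d * w c d))"
    using V q by (intro sum_mono2) (auto simp: bowties_def edge_weight_nonneg)
  also have "\<dots> = (\<Sum>v\<in>V. \<Sum>a\<in>V. \<Sum>b\<in>V. \<Sum>c\<in>V. \<Sum>d\<in>V. (w v a * w v b * w a b) * (w v c * w v d * w c d))"
    by (simp only: sum.cartesian_product)
  also have "\<dots> = (\<Sum>v\<in>V. (t v)\<^sup>2)"
    unfolding t_def power2_eq_square sum_distrib_left sum_distrib_right by (simp add: mult_ac)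
  also have "\<dots> \<le> (\<Sum>v\<in>V. M1\<^sup>2 * of_bool (v \<in> A) + M2\<^sup>2)"
  proof (rule sum_mono)
    fix v
    have "0 \<le> t v" unfolding t_def using q by (intro sum_nonneg mult_nonneg_nonneg edge_weight_nonneg)
    moreover have "t v \<le> (if v \<in> A then M1 else M2)"
      using sum_pairs_weight_le[of v] by (cases "v \<in> A") (simp_all add: t_def M1_def M2_def)
    ultimately have "(t v)\<^sup>2 \<le> (if v \<in> A then M1 else M2)\<^sup>2" by (rule power_mono[rotated])
    then show "(t v)\<^sup>2 \<le> M1\<^sup>2 * of_bool (v \<in> A) + M2\<^sup>2" by (auto split: if_splits simp: add_increasing2)
  qed
  also have "\<dots> = M1\<^sup>2 * k + n * M2\<^sup>2"
    using sum_of_bool_mem[OF V] by (simp add: sum.distrib flip: sum_distrib_left)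
  finally show ?thesis by (simp add: M1_def M2_def mult_ac)
qed

text \<open>For a fixed common edge the sum is its weight times the squared weighted number of
  common neighbours. The three summands correspond to no, one or both ends of that edge lying in
  \<open>A\<close>.\<close>

lemma sum_diamond_weight_le:
  "(\<Sum>x\<in>diamonds V. pair_weight q A (diamond_pair x)) \<le>
    n\<^sup>2 * q * (n * q\<^sup>2)\<^sup>2 + 2 * (k * n) * q * (n * q\<^sup>2 + k * q)\<^sup>2 + k\<^sup>2 * (n * q\<^sup>2 + 2 * k * q + k)\<^sup>2"
proof -
  define c where "c = (\<lambda>u v. \<Sum>a\<in>V. w u a * w v a)"
  define M1 where "M1 = q * (n * q\<^sup>2)\<^sup>2"
  define M2 where "M2 = q * (n * q\<^sup>2 + k * q)\<^sup>2"
  define M3 where "M3 = (n * q\<^sup>2 + 2 * k * q + k)\<^sup>2"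
  have M: "0 \<le> M1" "0 \<le> M2" "0 \<le> M3" using q by (auto simp: M1_def M2_def M3_def)
  have "(\<Sum>x\<in>diamonds V. pair_weight q A (diamond_pair x)) =
    (\<Sum>(u, v, a, b)\<in>diamonds V. w u v * ((w u a * w v a) * (w u b * w v b)))"
    by (intro sum.cong refl) (auto simp: diamonds_def diamond_pair_def pair_weight_diamond)
  also have "\<dots> \<le> (\<Sum>(u, v, a, b)\<in>V \<times> V \<times> V \<times> V. w u v * ((w u a * w v a) * (w u b * w v b)))"
    using V q by (intro sum_mono2) (auto simp: diamonds_def edge_weight_nonneg)
  also have "\<dots> = (\<Sum>u\<in>V. \<Sum>v\<in>V. \<Sum>a\<in>V. \<Sum>b\<in>V. w u v * ((w u a * w v a) * (w u b * w v b)))"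
    by (simp only: sum.cartesian_product)
  also have "\<dots> = (\<Sum>u\<in>V. \<Sum>v\<in>V. w u v * (c u v)\<^sup>2)"
    unfolding c_def power2_eq_square sum_distrib_left sum_distrib_right by (simp add: mult_ac)
  also have "\<dots> \<le> (\<Sum>u\<in>V. \<Sum>v\<in>V. M1 + M2 * (of_bool (u \<in> A) + of_bool (v \<in> A)) + M3 * (of_bool (u \<in> A) * of_bool (v \<in> A)))"
  proof (intro sum_mono)
    fix u v
    have c0: "0 \<le> c u v" unfolding c_def using q by (intro sum_nonneg mult_nonneg_nonneg edge_weight_nonneg)
    have c: "c u v \<le> n * q\<^sup>2 + k * q * (of_bool (u \<in> A) + of_bool (v \<in> A)) + k * of_bool (u \<in> A \<and> v \<in> A)"
      unfolding c_def by (rule sum_common_weight_le)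
    note B = power_mono[OF c c0, of 2]
    have "(c u v)\<^sup>2 \<le> M3" if "u \<in> A" "v \<in> A"
      using B that by (simp add: M3_def algebra_simps)
    moreover have "q * (c u v)\<^sup>2 \<le> M2" if "(u \<in> A) \<noteq> (v \<in> A)"
      using mult_left_mono[OF B q(1)] that by (cases "u \<in> A") (simp_all add: M2_def)
    moreover have "q * (c u v)\<^sup>2 \<le> M1" if "u \<notin> A" "v \<notin> A"
      using mult_left_mono[OF B q(1)] that by (simp add: M1_def)
    ultimately show "w u v * (c u v)\<^sup>2 \<le> M1 + M2 * (of_bool (u \<in> A) + of_bool (v \<in> A)) + M3 * (of_bool (u \<in> A) * of_bool (v \<in> A))"
      using M by (cases "u \<in> A"; cases "v \<in> A") (simp_all add: edge_weight_def)
  qed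
  also have "\<dots> = n\<^sup>2 * M1 + 2 * (k * n) * M2 + k\<^sup>2 * M3"
  proof -
    have "(\<Sum>u\<in>V. \<Sum>v\<in>V. of_bool (u \<in> A) * of_bool (v \<in> A)) = k\<^sup>2"
      using sum_of_bool_mem[OF V] by (simp add: power2_eq_square flip: sum_product)
    then show ?thesis
      using sum_of_bool_mem[OF V]
      by (simp add: sum.distrib power2_eq_square algebra_simps flip: sum_distrib_left)
  qed
  finally show ?thesis by (simp add: M1_def M2_def M3_def mult_ac)
qed

lemma sum_pair_weight_le:
  "(\<Sum>\<pi>\<in>touching_index V. pair_weight q A \<pi>) \<le>
    k * (q * (n * q + k)\<^sup>2 + (k * (1 + q))\<^sup>2)\<^sup>2 + n * (q\<^sup>2 * (n\<^sup>2 * q + k\<^sup>2))\<^sup>2 +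
    (n\<^sup>2 * q * (n * q\<^sup>2)\<^sup>2 + 2 * (k * n) * q * (n * q\<^sup>2 + k * q)\<^sup>2 + k\<^sup>2 * (n * q\<^sup>2 + 2 * k * q + k)\<^sup>2)"
proof -
  have fin: "finite (bowties V)" "finite (diamonds V)"
    unfolding bowties_def diamonds_def
    by (rule finite_subset[of _ "V \<times> V \<times> V \<times> V \<times> V"], use V in auto)
       (rule finite_subset[of _ "V \<times> V \<times> V \<times> V"], use V in auto)
  have nonneg: "0 \<le> pair_weight q A \<pi>" for \<pi> :: "'a set \<times> 'a set" using q by (simp add: pair_weight_def)
  have "(\<Sum>\<pi>\<in>touching_index V. pair_weight q A \<pi>) \<le>
      (\<Sum>\<pi>\<in>bowtie_pair ` bowties V \<union> diamond_pair ` diamonds V. pair_weight q A \<pi>)"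
    by (rule sum_mono2[OF _ touching_index_subset nonneg]) (use fin in simp)
  also have "\<dots> \<le> (\<Sum>\<pi>\<in>bowtie_pair ` bowties V. pair_weight q A \<pi>) + (\<Sum>\<pi>\<in>diamond_pair ` diamonds V. pair_weight q A \<pi>)"
    using fin sum.union_inter[of "bowtie_pair ` bowties V" "diamond_pair ` diamonds V" "pair_weight q A"]
      sum_nonneg[of "bowtie_pair ` bowties V \<inter> diamond_pair ` diamonds V" "pair_weight q A", OF nonneg] by simp
  also have "(\<Sum>\<pi>\<in>bowtie_pair ` bowties V. pair_weight q A \<pi>) \<le> (\<Sum>x\<in>bowties V. pair_weight q A (bowtie_pair x))"
    using sum_image_le[OF fin(1), of "pair_weight q A" bowtie_pair] nonneg by (simp add: o_def)
  also have "(\<Sum>\<pi>\<in>diamond_pair ` diamonds V. pair_weight q A \<pi>) \<le> (\<Sum>x\<in>diamonds V. pair_weight q A (diamond_pair x))"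
    using sum_image_le[OF fin(2), of "pair_weight q A" diamond_pair] nonneg by (simp add: o_def)
  finally show ?thesis using sum_bowtie_weight_le sum_diamond_weight_le by linarith
qed

end

section \<open>Moments of the number of touching pairs\<close>

lemma touching_pairs_eq: "touching_pairs V S = {\<pi> \<in> touching_index V. pair_edges \<pi> \<subseteq> S}"
  by (auto simp: touching_pairs_def touching_index_def pair_edges_def triangles_def)

lemma finite_touching_index: "finite V \<Longrightarrow> finite (touching_index V)"
  by (rule finite_subset[of _ "nsets V 3 \<times> nsets V 3"])
     (auto simp: touching_index_def finite_imp_finite_nsets)

lemma pair_edges_touching:
  assumes "\<pi> \<in> touching_index V"
  shows "pair_edges \<pi> \<subseteq> nsets V 2" "finite (pair_edges \<pi>)"
    "pair_edges \<pi> \<subseteq> nsets (fst \<pi> \<union> snd \<pi>) 2" "card (fst \<pi> \<union> snd \<pi>) \<le> 5" "fst \<pi> \<union> snd \<pi> \<subseteq> V"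
proof -
  obtain s t where st: "\<pi> = (s, t)" by (cases \<pi>)
  then have s: "s \<subseteq> V" "finite s" "card s = 3" and t: "t \<subseteq> V" "finite t" "card t = 3"
    and "s \<inter> t \<noteq> {}" using assms by (auto simp: touching_index_def nsets_def)
  then have "card (s \<inter> t) \<noteq> 0" by simp
  moreover have "card (s \<union> t) + card (s \<inter> t) = 6" using card_Un_Int[OF s(2) t(2)] s t by simp
  ultimately show "card (fst \<pi> \<union> snd \<pi>) \<le> 5" by (simp add: st)
  show "fst \<pi> \<union> snd \<pi> \<subseteq> V" using s t by (simp add: st)
  show *: "pair_edges \<pi> \<subseteq> nsets (fst \<pi> \<union> snd \<pi>) 2"
    using nsets_mono[of s "s \<union> t" 2] nsets_mono[of t "s \<union> t" 2] by (simp add: st pair_edges_def)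
  then show "pair_edges \<pi> \<subseteq> nsets V 2"
    using nsets_mono[of "s \<union> t" V 2] s t by (simp add: st)
  show "finite (pair_edges \<pi>)" using s t by (simp add: st pair_edges_def finite_imp_finite_nsets)
qed

context
  fixes V :: "'a set" and q :: real
  assumes V: "finite V" and q: "0 \<le> q" "q \<le> 1"
begin

lemma fin_edges: "finite (nsets V 2)" by (rule finite_imp_finite_nsets[OF V])

lemma card_touching_pairs_eq_sum:
  "real (card (touching_pairs V S)) = (\<Sum>\<pi>\<in>touching_index V. if pair_edges \<pi> \<subseteq> S then 1 else 0)"
  by (simp add: touching_pairs_eq finite_touching_index[OF V] flip: sum.inter_filter)

lemma expectation_supset_indicator:
  "F \<subseteq> nsets V 2 \<Longrightarrow>
    measure_pmf.expectation (random_subset (nsets V 2) q) (\<lambda>S. if F \<subseteq> S then 1 else 0 :: real) = q ^ card F"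
  using expectation_random_subset_supset[OF fin_edges _ q, of F "\<lambda>_. 1::real"] by simp

lemma expectation_touching_pairs:
  "measure_pmf.expectation (random_subset (nsets V 2) q) (\<lambda>S. real (card (touching_pairs V S))) =
    (\<Sum>\<pi>\<in>touching_index V. pair_weight q {} \<pi>)"
  unfolding card_touching_pairs_eq_sum
  by (simp add: Bochner_Integration.integral_sum fin_edges expectation_supset_indicator
      pair_edges_touching pair_weight_def nsets_empty_iff)

text \<open>Conditioning on the edges of one touching pair only forces edges inside a set of at most
  five vertices.\<close>

lemma expectation_touching_pairs_square_le:
  assumes M: "\<And>A. A \<subseteq> V \<Longrightarrow> card A \<le> 5 \<Longrightarrow> (\<Sum>\<pi>\<in>touching_index V. pair_weight q A \<pi>) \<le> M"
  shows "measure_pmf.expectation (random_subset (nsets V 2) q) (\<lambda>S. (real (card (touching_pairs V S)))\<^sup>2) \<le>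
    measure_pmf.expectation (random_subset (nsets V 2) q) (\<lambda>S. real (card (touching_pairs V S))) * M"
proof -
  let ?I = "touching_index V"
  let ?E = "measure_pmf.expectation (random_subset (nsets V 2) q)"
  have "(real (card (touching_pairs V S)))\<^sup>2 =
     (\<Sum>\<pi>\<in>?I. \<Sum>\<rho>\<in>?I. if pair_edges \<pi> \<union> pair_edges \<rho> \<subseteq> S then 1 else 0)" for S
    unfolding card_touching_pairs_eq_sum power2_eq_square sum_product
    by (intro sum.cong refl) auto
  then have "?E (\<lambda>S. (real (card (touching_pairs V S)))\<^sup>2) =
      (\<Sum>\<pi>\<in>?I. \<Sum>\<rho>\<in>?I. ?E (\<lambda>S. if pair_edges \<pi> \<union> pair_edges \<rho> \<subseteq> S then 1 else 0))"
    by (simp add: Bochner_Integration.integral_sum fin_edges)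
  also have "\<dots> \<le> (\<Sum>\<pi>\<in>?I. \<Sum>\<rho>\<in>?I. pair_weight q {} \<pi> * pair_weight q (fst \<pi> \<union> snd \<pi>) \<rho>)"
  proof (intro sum_mono)
    fix \<pi> \<rho> assume p: "\<pi> \<in> ?I" and r: "\<rho> \<in> ?I"
    note p' = pair_edges_touching[OF p] and r' = pair_edges_touching[OF r]
    have "?E (\<lambda>S. if pair_edges \<pi> \<union> pair_edges \<rho> \<subseteq> S then 1 else 0) = q ^ card (pair_edges \<pi> \<union> pair_edges \<rho>)"
      by (rule expectation_supset_indicator) (use p' r' in simp)
    also have "card (pair_edges \<pi> \<union> pair_edges \<rho>) = card (pair_edges \<pi>) + card (pair_edges \<rho> - pair_edges \<pi>)"
      using p' r' by (subst Un_Diff_cancel[symmetric], subst card_Un_disjoint) auto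
    \<comment> \<open>Discarding all edges inside the vertex set of \<open>\<pi>\<close>, and not
      only those of \<open>\<pi>\<close>, lowers the exponent; as \<open>q \<le> 1\<close>, this
      gives an upper bound whose second factor depends on \<open>\<pi>\<close> through that vertex
      set alone.\<close>
    also have "q ^ \<dots> \<le> q ^ card (pair_edges \<pi>) * q ^ card (pair_edges \<rho> - nsets (fst \<pi> \<union> snd \<pi>) 2)"
      unfolding power_add using q p' r'
      by (intro mult_left_mono power_decreasing card_mono) auto
    finally show "?E (\<lambda>S. if pair_edges \<pi> \<union> pair_edges \<rho> \<subseteq> S then 1 else 0)
      \<le> pair_weight q {} \<pi> * pair_weight q (fst \<pi> \<union> snd \<pi>) \<rho>"
      by (simp add: pair_weight_def nsets_empty_iff)
  qed
  also have "\<dots> \<le> (\<Sum>\<pi>\<in>?I. pair_weight q {} \<pi> * M)"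
    unfolding sum_distrib_left[symmetric]
  proof (rule sum_mono)
    fix \<pi> assume "\<pi> \<in> ?I"
    from pair_edges_touching(4,5)[OF this]
    show "pair_weight q {} \<pi> * (\<Sum>\<rho>\<in>?I. pair_weight q (fst \<pi> \<union> snd \<pi>) \<rho>) \<le> pair_weight q {} \<pi> * M"
      using q by (intro mult_left_mono M) (simp_all add: pair_weight_def)
  qed
  finally show ?thesis by (simp add: expectation_touching_pairs sum_distrib_right)
qed

lemma expectation_touching_pairs_le:
  "measure_pmf.expectation (random_subset (nsets V 2) q) (\<lambda>S. real (card (touching_pairs V S)))
    \<le> real (card V) ^ 5 * q ^ 6 + real (card V) ^ 4 * q ^ 5"
  using sum_pair_weight_le[OF V empty_subsetI q]
  unfolding expectation_touching_pairs by (simp add: eval_nat_numeral algebra_simps)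

text \<open>As \<open>A\<close> has at most five vertices and \<open>n * q\<^sup>2\<close>,
  \<open>n\<^sup>2 * q ^ 3\<close> are at most 1, forcing the edges inside \<open>A\<close> adds
  only a constant; the cross term of a square is absorbed by doubling \<open>n ^ 5 * q ^ 6\<close>.
  The constants sum to 5 * 136^2 + 1250 + 360 + 25 * 256 = 100490, rounded up to 100500.\<close>

lemma sum_pair_weight_bounded:
  assumes A: "A \<subseteq> V" "card A \<le> 5" and small: "real (card V) * q\<^sup>2 \<le> 1" "(real (card V))\<^sup>2 * q ^ 3 \<le> 1"
  shows "(\<Sum>\<pi>\<in>touching_index V. pair_weight q A \<pi>) \<le> 2 * real (card V) ^ 5 * q ^ 6 + real (card V) ^ 4 * q ^ 5 + 100500"
proof -
  define n k where "n = real (card V)" and "k = real (card A)"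
  have n: "0 \<le> n" and k: "0 \<le> k" "k \<le> 5" using A by (simp_all add: n_def k_def)
  have s: "n * q\<^sup>2 \<le> 1" "n\<^sup>2 * q ^ 3 \<le> 1" using small by (simp_all add: n_def)
  have c: "q * (n * q + k)\<^sup>2 \<le> 36"
  proof -
    have "q * (n * q + k)\<^sup>2 \<le> q * (n * q + 5)\<^sup>2"
      using q n k by (intro mult_left_mono power_mono) auto
    also have "\<dots> = n\<^sup>2 * q ^ 3 + 10 * (n * q\<^sup>2) + 25 * q"
      by (simp add: power2_eq_square power3_eq_cube algebra_simps)
    finally show ?thesis using s q by simp
  qed
  have 1: "k * (q * (n * q + k)\<^sup>2 + (k * (1 + q))\<^sup>2)\<^sup>2 \<le> 5 * 136\<^sup>2"
  proof (intro mult_mono power_mono)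
    have "k * (1 + q) \<le> 5 * 2" using k q by (intro mult_mono) auto
    then have "(k * (1 + q))\<^sup>2 \<le> (5 * 2)\<^sup>2" using k q by (intro power_mono) auto
    then show "q * (n * q + k)\<^sup>2 + (k * (1 + q))\<^sup>2 \<le> 136" using c by simp
  qed (use k q in auto)
  have 2: "n * (q\<^sup>2 * (n\<^sup>2 * q + k\<^sup>2))\<^sup>2 \<le> 2 * n ^ 5 * q ^ 6 + 1250"
  proof -
    have "n * (q\<^sup>2 * (n\<^sup>2 * q + k\<^sup>2))\<^sup>2 = n * q ^ 4 * (n\<^sup>2 * q + k\<^sup>2)\<^sup>2"
      by (simp add: power_mult_distrib)
    also have "\<dots> \<le> n * q ^ 4 * (2 * (n\<^sup>2 * q)\<^sup>2 + 1250)"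
    proof (intro mult_left_mono)
      have "k\<^sup>2 \<le> 5\<^sup>2" using k by (intro power_mono) auto
      then have "(n\<^sup>2 * q + k\<^sup>2)\<^sup>2 \<le> (n\<^sup>2 * q + 25)\<^sup>2" using n q by (intro power_mono) auto
      also have "\<dots> \<le> 2 * (n\<^sup>2 * q)\<^sup>2 + 1250"
        using sum_squares_bound[of "n\<^sup>2 * q" 25] by (simp add: power2_sum)
      finally show "(n\<^sup>2 * q + k\<^sup>2)\<^sup>2 \<le> 2 * (n\<^sup>2 * q)\<^sup>2 + 1250" .
    qed (use n q in auto)
    also have "\<dots> = 2 * n ^ 5 * q ^ 6 + 1250 * (n * q\<^sup>2 * q\<^sup>2)"
      by (simp add: eval_nat_numeral algebra_simps)
    also have "n * q\<^sup>2 * q\<^sup>2 \<le> 1 * 1"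
      using s q n power_mono[of q 1 2] by (intro mult_mono) auto
    finally show ?thesis by simp
  qed
  have 3: "n\<^sup>2 * q * (n * q\<^sup>2)\<^sup>2 = n ^ 4 * q ^ 5" by (simp add: eval_nat_numeral)
  have 4: "2 * (k * n) * q * (n * q\<^sup>2 + k * q)\<^sup>2 \<le> 360"
  proof -
    have "2 * (k * n) * q * (n * q\<^sup>2 + k * q)\<^sup>2 = 2 * k * ((n * q\<^sup>2) * (q * (n * q + k)\<^sup>2))"
      by (simp add: power2_eq_square algebra_simps)
    also have "\<dots> \<le> 2 * 5 * (1 * 36)"
      using c s n q k by (intro mult_mono) auto
    finally show ?thesis by simp
  qed
  have 5: "k\<^sup>2 * (n * q\<^sup>2 + 2 * k * q + k)\<^sup>2 \<le> 5\<^sup>2 * 16\<^sup>2"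
  proof (intro mult_mono power_mono)
    have "k * q \<le> 5 * 1" using k q by (intro mult_mono) auto
    then show "n * q\<^sup>2 + 2 * k * q + k \<le> 16" using s k by simp
  qed (use k q n in auto)
  show ?thesis
    using sum_pair_weight_le[OF V A(1) q] 1 2 3 4 5 unfolding n_def[symmetric] k_def[symmetric] by simp
qed

lemma expectation_touching_pairs_square_le':
  assumes small: "real (card V) * q\<^sup>2 \<le> 1" "(real (card V))\<^sup>2 * q ^ 3 \<le> 1"
  shows "measure_pmf.expectation (random_subset (nsets V 2) q) (\<lambda>S. (real (card (touching_pairs V S)))\<^sup>2) \<le>
    (real (card V) ^ 5 * q ^ 6 + real (card V) ^ 4 * q ^ 5) *
    (2 * real (card V) ^ 5 * q ^ 6 + real (card V) ^ 4 * q ^ 5 + 100500)"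
  using expectation_touching_pairs_square_le[OF sum_pair_weight_bounded[OF _ _ small]]
  by (rule order_trans) (use q in \<open>auto intro!: mult_right_mono expectation_touching_pairs_le\<close>)

end

section \<open>Tail bounds\<close>

lemma power_self_le_exp_fact: "real r ^ r \<le> exp (real r) * fact r"
proof (induction r)
  case (Suc r)
  have "real (Suc r) ^ r \<le> exp 1 * real r ^ r"
  proof (cases "r = 0")
    case False
    have "(1 + 1 / real r) ^ r \<le> exp (1 / real r) ^ r"
      by (intro power_mono exp_ge_add_one_self) simp
    also have "\<dots> = exp 1" using False by (simp flip: exp_of_nat_mult)
    finally have "(1 + 1 / real r) ^ r * real r ^ r \<le> exp 1 * real r ^ r" by (intro mult_right_mono) auto
    also have "(1 + 1 / real r) ^ r * real r ^ r = real (Suc r) ^ r"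
      using False by (simp add: field_simps flip: power_mult_distrib)
    finally show ?thesis .
  qed simp
  then have "real (Suc r) ^ Suc r \<le> real (Suc r) * (exp 1 * real r ^ r)"
    unfolding power_Suc by (intro mult_left_mono) auto
  also have "\<dots> \<le> real (Suc r) * (exp 1 * (exp (real r) * fact r))"
    using Suc by (intro mult_left_mono) auto
  finally show ?case by (simp add: exp_add mult_ac)
qed simp

text \<open>A crude Stirling bound, with 3 in place of e. It makes the estimate of
  \<open>prob_disjoint_members_le\<close> exponentially small once the expected count is a small
  fraction of the required number.\<close>

lemma power_div_fact_le:
  assumes "0 \<le> x" "0 < r"
  shows "x ^ r / fact r \<le> (3 * x / real r) ^ r"
proof -
  have "real r ^ r \<le> 3 ^ r * fact r"
  proof -
    have "exp (real r) = exp 1 ^ r" by (simp flip: exp_of_nat_mult)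
    also have "\<dots> \<le> 3 ^ r" by (intro power_mono exp_le) simp
    finally have "exp (real r) * fact r \<le> 3 ^ r * fact r" by (intro mult_right_mono) auto
    then show ?thesis using power_self_le_exp_fact[of r] by linarith
  qed
  then have "x ^ r * real r ^ r \<le> x ^ r * (3 ^ r * fact r)" using assms by (intro mult_left_mono) auto
  then show ?thesis using assms by (simp add: power_divide power_mult_distrib field_simps)
qed

lemma disjoint_nsets_2:
  assumes "s \<inter> t = {}"
  shows "nsets s 2 \<inter> nsets t 2 = {}"
proof -
  have False if "e \<in> nsets s 2" "e \<in> nsets t 2" for e
  proof -
    have "e \<subseteq> s \<inter> t" "card e = 2" using that by (auto simp: nsets_def)
    then show False using assms by simp
  qed
  then show ?thesis by blast
qed

lemma choose_3_le: "real (n choose 3) \<le> real n ^ 3 / 6"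
proof -
  have "(n choose 3) * fact 3 \<le> n ^ 3" by (rule binomial_fact_pow)
  then have "real ((n choose 3) * 6) \<le> real (n ^ 3)" by (simp only: of_nat_le_iff) (simp add: fact_numeral)
  then show ?thesis by simp
qed

abbreviation Kn_edges :: "nat \<Rightarrow> nat set set" where
  "Kn_edges n \<equiv> nsets {1..n} 2"

lemma finite_Kn_edges: "finite (Kn_edges n)"
  by (simp add: finite_imp_finite_nsets)

context
  fixes n :: nat and q :: real
  assumes q: "0 \<le> q" "q \<le> 1"
begin

private abbreviation (input) "Pr \<equiv> measure_pmf.prob (random_subset (Kn_edges n) q)"

text \<open>Chernoff's argument with base 1/2: on the event, 2 to the power \<open>D\<close> minus
  the degree is at least 1, and its expectation is at most
  \<open>2 ^ D * (1 - q / 2) ^ card F\<close>. The \<open>- 1\<close> allows for \<open>v\<close>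
  lying in \<open>M\<close>.\<close>

lemma prob_low_degree_le:
  assumes v: "v \<in> {1..n}" and M: "M \<subseteq> {1..n}"
  shows "Pr {S. card {u \<in> M. {v, u} \<in> S} < D} \<le> exp (real D - q / 2 * (real (card M) - 1))"
proof -
  let ?E = "measure_pmf.expectation (random_subset (Kn_edges n) q)"
  define F where "F = (\<lambda>u. {v, u}) ` (M - {v})"
  have finM: "finite M" using M finite_subset by blast
  have F: "F \<subseteq> Kn_edges n" using v M by (auto simp: F_def)
  have cF: "real (card M) - 1 \<le> real (card F)"
  proof -
    have "card F = card (M - {v})"
      unfolding F_def by (rule card_image) (auto simp: inj_on_def doubleton_eq_iff)
    then show ?thesis using finM by (simp add: card_Diff_singleton_if) linarith
  qed
  have "Pr {S. card {u \<in> M. {v, u} \<in> S} < D} = ?E (indicator {S. card {u \<in> M. {v, u} \<in> S} < D})" by simp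
  also have "\<dots> \<le> ?E (\<lambda>S. 2 ^ D * (1 / 2) ^ card (S \<inter> F))"
  proof (rule integral_mono)
    fix S
    have "card (S \<inter> F) \<le> card {u \<in> M. {v, u} \<in> S}"
    proof -
      have "S \<inter> F \<subseteq> (\<lambda>u. {v, u}) ` {u \<in> M. {v, u} \<in> S}" by (auto simp: F_def)
      then have "card (S \<inter> F) \<le> card ((\<lambda>u. {v, u}) ` {u \<in> M. {v, u} \<in> S})"
        using finM by (intro card_mono) auto
      also have "\<dots> \<le> card {u \<in> M. {v, u} \<in> S}" using finM by (intro card_image_le) auto
      finally show ?thesis .
    qed
    moreover have "1 \<le> 2 ^ D * (1 / 2 :: real) ^ j" if "j \<le> D" for j
      using power_increasing[OF that, of "2 :: real"] by (simp add: power_one_over field_simps)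
    ultimately show "indicator {S. card {u \<in> M. {v, u} \<in> S} < D} S \<le> (2 ^ D * (1 / 2) ^ card (S \<inter> F) :: real)"
      unfolding indicator_def by simp
  qed (rule integrable_random_subset[OF finite_Kn_edges])+
  also have "\<dots> = 2 ^ D * ?E (\<lambda>S. (1 / 2) ^ card (S \<inter> F))" by (rule integral_mult_right_zero)
  also have "?E (\<lambda>S. (1 / 2) ^ card (S \<inter> F)) = (1 - q / 2) ^ card F"
    unfolding expectation_random_subset_power[OF finite_Kn_edges F q] by simp
  also have "2 ^ D * (1 - q / 2) ^ card F \<le> exp 1 ^ D * exp (- (q / 2)) ^ card F"
  proof (intro mult_mono power_mono)
    show "2 \<le> exp (1::real)" using exp_ge_add_one_self[of 1] by simp
    show "1 - q / 2 \<le> exp (- (q / 2))" using exp_ge_add_one_self[of "- (q / 2)"] by simp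
  qed (use q in auto)
  also have "\<dots> = exp (real D - q / 2 * real (card F))"
    unfolding exp_of_nat_mult[symmetric] mult_exp_exp by (simp add: mult.commute)
  also have "\<dots> \<le> exp (real D - q / 2 * (real (card M) - 1))"
    using cF q by (simp add: mult_left_mono)
  finally show ?thesis .
qed

text \<open>The event requires \<open>r\<close> of at most z^2 / 2 possible edges. Because of
  \<open>24 * z * q \<le> d\<close>, the base in \<open>power_div_fact_le\<close> is at most 1/8,
  which is below \<open>exp (- 2)\<close>; the resulting exponent \<open>2 * r\<close> is at least
  \<open>d * z\<close>.\<close>

lemma prob_dense_set_le:
  assumes Z: "Z \<subseteq> {1..n}" "Z \<noteq> {}" and d: "24 * real (card Z) * q \<le> real d" "0 < d"
  shows "Pr {S. d * card Z \<le> 2 * card (S \<inter> nsets Z 2)} \<le> exp (- real d * real (card Z))"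
proof -
  define z where "z = card Z"
  \<comment> \<open>Half of \<open>d * z\<close>, rounded up, so that
    \<open>d * z \<le> 2 * r\<close> holds for every parity.\<close>
  define r where "r = (d * z + 1) div 2"
  \<comment> \<open>Edges become singletons: any set of edges is then a disjoint family, and the
    first-moment bound applies with \<open>m = 1\<close>.\<close>
  define \<F> where "\<F> = (\<lambda>e. {e}) ` nsets Z 2"
  have finZ: "finite Z" using Z finite_subset by blast
  have z: "0 < z" using Z finZ by (simp add: z_def card_gt_0_iff)
  have r: "d * z \<le> 2 * r" "0 < r" using z d by (auto simp: r_def)
  have \<F>: "\<F> \<subseteq> nsets (Kn_edges n) 1"
    using nsets_mono[OF Z(1), of 2] by (auto simp: \<F>_def nsets_one)
  have c\<F>: "card \<F> = z choose 2" by (simp add: \<F>_def card_image inj_on_def z_def)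
  have zc: "real (z choose 2) \<le> real z * real z / 2"
  proof -
    have "(z choose 2) * fact 2 \<le> z ^ 2" by (rule binomial_fact_pow)
    then have "real ((z choose 2) * 2) \<le> real (z ^ 2)" by (simp only: of_nat_le_iff) simp
    then show ?thesis by (simp add: power2_eq_square)
  qed
  have "Pr {S. d * card Z \<le> 2 * card (S \<inter> nsets Z 2)} \<le>
      Pr {S. \<exists>\<G>\<subseteq>\<F>. card \<G> = r \<and> disjoint \<G> \<and> \<Union>\<G> \<subseteq> S}"
  proof (rule measure_pmf.finite_measure_mono)
    show "{S. d * card Z \<le> 2 * card (S \<inter> nsets Z 2)} \<subseteq> {S. \<exists>\<G>\<subseteq>\<F>. card \<G> = r \<and> disjoint \<G> \<and> \<Union>\<G> \<subseteq> S}"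
    proof clarify
      fix S assume "d * card Z \<le> 2 * card (S \<inter> nsets Z 2)"
      then have "r \<le> card (S \<inter> nsets Z 2)" by (simp add: r_def z_def)
      then obtain J where J: "J \<subseteq> S \<inter> nsets Z 2" "card J = r" by (meson obtain_subset_with_card_n)
      show "\<exists>\<G>\<subseteq>\<F>. card \<G> = r \<and> disjoint \<G> \<and> \<Union>\<G> \<subseteq> S"
        using J by (intro exI[of _ "(\<lambda>e. {e}) ` J"]) (auto simp: \<F>_def card_image inj_on_def disjoint_def)
    qed
  qed simp
  also have "\<dots> \<le> (real (card \<F>) * q ^ 1) ^ r / fact r"
    by (rule prob_disjoint_members_le[OF finite_Kn_edges \<F> q])
  also have "\<dots> \<le> (3 * (real (card \<F>) * q ^ 1) / real r) ^ r"
    using q r by (intro power_div_fact_le) auto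
  also have "\<dots> \<le> exp (- 2) ^ r"
  proof (intro power_mono)
    have "real d * real z \<le> 2 * real r" using r by (metis of_nat_le_iff of_nat_mult of_nat_numeral)
    have "3 * (real (card \<F>) * q ^ 1) \<le> 3 * (real z * real z / 2 * q)"
      using mult_right_mono[OF zc q(1)] by (simp add: c\<F> mult_ac)
    also have "\<dots> = (24 * real z * q) * real z / 16" by simp
    also have "\<dots> \<le> real d * real z / 16"
      using d by (intro divide_right_mono mult_right_mono) (auto simp: z_def)
    also have "\<dots> \<le> real r / 8" using \<open>real d * real z \<le> 2 * real r\<close> by simp
    finally have "3 * (real (card \<F>) * q ^ 1) / real r \<le> 1 / 8" using r by (simp add: field_simps)
    also have "1 / 8 \<le> exp (- 2 :: real)"
    proof -
      have "exp (2 :: real) = exp 1 * exp 1" by (simp flip: exp_add)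
      also have "\<dots> \<le> 2.72 * 2.72" using e_less_272 by (intro mult_mono) auto
      finally show ?thesis by (simp add: exp_minus field_simps)
    qed
    finally show "3 * (real (card \<F>) * q ^ 1) / real r \<le> exp (- 2)" .
  qed (use q in auto)
  also have "\<dots> = exp (- (2 * real r))" by (simp flip: exp_of_nat_mult)
  also have "\<dots> \<le> exp (- real d * real (card Z))"
    using r by (simp add: z_def) (metis of_nat_le_iff of_nat_mult of_nat_numeral)
  finally show ?thesis .
qed

text \<open>The at most n^z sets of size \<open>z\<close> are outweighed by the exponent
  \<open>d * z\<close>: their total is at most \<open>(n * exp (- d)) ^ z\<close>, which is largest
  at \<open>z = 1\<close>, and at most \<open>n\<close> sizes occur.\<close>

lemma prob_dense_sets_le:
  assumes d: "24 * real N * q \<le> real d" "0 < d" and N: "N \<le> n" "real n * exp (- real d) \<le> 1"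
  shows "Pr (\<Union>Z\<in>{Z. Z \<subseteq> {1..n} \<and> Z \<noteq> {} \<and> card Z \<le> N}. {S. d * card Z \<le> 2 * card (S \<inter> nsets Z 2)})
    \<le> (real n)\<^sup>2 * exp (- real d)"
proof -
  let ?B = "\<lambda>Z. {S. d * card Z \<le> 2 * card (S \<inter> nsets Z 2)}"
  have "{Z. Z \<subseteq> {1..n} \<and> Z \<noteq> {} \<and> card Z \<le> N} = (\<Union>z\<in>{1..N}. nsets {1..n} z)"
    by (auto simp: nsets_def finite_subset card_gt_0_iff Suc_le_eq)
  then have "Pr (\<Union>Z\<in>{Z. Z \<subseteq> {1..n} \<and> Z \<noteq> {} \<and> card Z \<le> N}. ?B Z) = Pr (\<Union>z\<in>{1..N}. \<Union>Z\<in>nsets {1..n} z. ?B Z)"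
    by (simp add: UN_UN_flatten)
  also have "\<dots> \<le> (\<Sum>z\<in>{1..N}. Pr (\<Union>Z\<in>nsets {1..n} z. ?B Z))" by (rule prob_UN_le) simp
  also have "\<dots> \<le> (\<Sum>z\<in>{1..N}. real n * exp (- real d))"
  proof (rule sum_mono)
    fix z assume z: "z \<in> {1..N}"
    have "Pr (\<Union>Z\<in>nsets {1..n} z. ?B Z) \<le> (\<Sum>Z\<in>nsets {1..n} z. Pr (?B Z))"
      by (rule prob_UN_le) (simp add: finite_imp_finite_nsets)
    also have "\<dots> \<le> (\<Sum>Z\<in>nsets {1..n} z. exp (- real d * real z))"
    proof (rule sum_mono)
      fix Z assume Z: "Z \<in> nsets {1..n} z"
      then have Z': "Z \<subseteq> {1..n}" "card Z = z" "Z \<noteq> {}" using z by (auto simp: nsets_def)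
      have "24 * real z * q \<le> 24 * real N * q" using z q by (intro mult_right_mono) auto
      then show "Pr (?B Z) \<le> exp (- real d * real z)"
        using prob_dense_set_le[OF Z'(1,3)] d unfolding Z'(2) by simp
    qed
    also have "\<dots> = real (n choose z) * exp (- real d) ^ z"
      by (simp add: mult.commute flip: exp_of_nat_mult)
    also have "\<dots> \<le> real n ^ z * exp (- real d) ^ z"
    proof (intro mult_right_mono)
      have "(n choose z) * 1 \<le> (n choose z) * fact z" by (intro mult_le_mono2) (simp add: Suc_le_eq)
      also have "\<dots> \<le> n ^ z" by (rule binomial_fact_pow)
      finally show "real (n choose z) \<le> real n ^ z" by (simp flip: of_nat_power)
    qed simp
    also have "\<dots> = (real n * exp (- real d)) ^ z" by (simp add: power_mult_distrib)
    also have "\<dots> \<le> (real n * exp (- real d)) ^ 1" using N z by (intro power_decreasing) auto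
    finally show "Pr (\<Union>Z\<in>nsets {1..n} z. ?B Z) \<le> real n * exp (- real d)" by simp
  qed
  also have "\<dots> = real N * (real n * exp (- real d))" by simp
  also have "\<dots> \<le> real n * (real n * exp (- real d))" using N by (intro mult_right_mono) auto
  finally show ?thesis by (simp add: power2_eq_square)
qed

text \<open>There are at most 2^n choices for each of the two sets, and m^2 independent edges must
  all be missing.\<close>

lemma prob_hole_le:
  "Pr (\<Union>(A, B)\<in>{(A, B). A \<subseteq> {1..n} \<and> B \<subseteq> {1..n} \<and> A \<inter> B = {} \<and> card A = m \<and> card B = m}.
      {S. \<forall>a\<in>A. \<forall>b\<in>B. {a, b} \<notin> S}) \<le> 4 ^ n * exp (- q * (real m)\<^sup>2)"
proof -
  let ?I = "{(A, B). A \<subseteq> {1..n} \<and> B \<subseteq> {1..n} \<and> A \<inter> B = {} \<and> card A = m \<and> card B = m}"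
  have I: "?I \<subseteq> Pow {1..n} \<times> Pow {1..n}" by auto
  have finI: "finite ?I" by (rule finite_subset[OF I]) simp
  have "card ?I \<le> card (Pow {1..n} \<times> Pow {1..n})" by (rule card_mono[OF _ I]) simp
  also have "\<dots> = 4 ^ n" by (simp add: card_cartesian_product card_Pow flip: power_mult_distrib)
  finally have cI: "card ?I \<le> 4 ^ n" .
  have "Pr (\<Union>(A, B)\<in>?I. {S. \<forall>a\<in>A. \<forall>b\<in>B. {a, b} \<notin> S}) \<le>
      (\<Sum>i\<in>?I. Pr (case i of (A, B) \<Rightarrow> {S. \<forall>a\<in>A. \<forall>b\<in>B. {a, b} \<notin> S}))"
    by (rule prob_UN_le[OF finI])
  also have "\<dots> \<le> (\<Sum>i\<in>?I. exp (- q * (real m)\<^sup>2))"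
  proof (rule sum_mono)
    fix i assume "i \<in> ?I"
    then obtain A B where i: "i = (A, B)"
      and AB: "A \<subseteq> {1..n}" "B \<subseteq> {1..n}" "A \<inter> B = {}" "card A = m" "card B = m" by auto
    define F where "F = (\<lambda>(a, b). {a, b}) ` (A \<times> B)"
    have F: "F \<subseteq> Kn_edges n"
      unfolding F_def
    proof clarify
      fix a b assume "a \<in> A" "b \<in> B"
      then have "a \<in> {1..n}" "b \<in> {1..n}" "a \<noteq> b" using AB by blast+
      then show "{a, b} \<in> Kn_edges n" by simp
    qed
    have cF: "card F = m\<^sup>2"
    proof -
      have "card F = card (A \<times> B)"
        unfolding F_def using AB(3) by (intro card_image) (auto simp: inj_on_def doubleton_eq_iff)
      then show ?thesis using AB by (simp add: card_cartesian_product power2_eq_square)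
    qed
    have finF: "finite F" using F finite_Kn_edges finite_subset by blast
    have "{S. \<forall>a\<in>A. \<forall>b\<in>B. {a, b} \<notin> S} = {S. S \<inter> F = {}}" by (auto simp: F_def)
    \<comment> \<open>Since \<open>0 ^ 0 = 1\<close>, avoiding \<open>F\<close> is the generating
      function evaluated at 0.\<close>
    have ind: "indicator {S. S \<inter> F = {}} = (\<lambda>S. 0 ^ card (S \<inter> F) :: real)"
      by (rule ext) (simp add: indicator_def power_0_left finF)
    have "Pr {S. \<forall>a\<in>A. \<forall>b\<in>B. {a, b} \<notin> S} = Pr {S. S \<inter> F = {}}"
      by (simp add: \<open>{S. \<forall>a\<in>A. \<forall>b\<in>B. {a, b} \<notin> S} = {S. S \<inter> F = {}}\<close>)
    also have "\<dots> = measure_pmf.expectation (random_subset (Kn_edges n) q) (indicator {S. S \<inter> F = {}})" by simp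
    also have "\<dots> = measure_pmf.expectation (random_subset (Kn_edges n) q) (\<lambda>S. 0 ^ card (S \<inter> F))"
      unfolding ind ..
    also have "\<dots> = (1 - q) ^ m\<^sup>2"
      using expectation_random_subset_power[OF finite_Kn_edges F q, of 0] by (simp add: cF)
    also have "\<dots> \<le> exp (- q) ^ m\<^sup>2" using q exp_ge_add_one_self[of "- q"] by (intro power_mono) auto
    also have "\<dots> = exp (- q * (real m)\<^sup>2)" by (simp add: mult.commute flip: exp_of_nat_mult)
    finally show "Pr (case i of (A, B) \<Rightarrow> {S. \<forall>a\<in>A. \<forall>b\<in>B. {a, b} \<notin> S}) \<le> exp (- q * (real m)\<^sup>2)"
      unfolding i prod.case .
  qed
  also have "\<dots> = real (card ?I) * exp (- q * (real m)\<^sup>2)" by simp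
  also have "\<dots> \<le> real (4 ^ n) * exp (- q * (real m)\<^sup>2)" by (rule mult_right_mono[OF of_nat_mono[OF cI]]) simp
  finally show ?thesis by simp
qed

text \<open>Disjoint triangles have disjoint edge sets, so the first-moment bound applies to
  \<open>n div 24 + 1\<close> of them. The expected number of triangles is at most
  \<open>n ^ 3 * q ^ 3 / 6\<close>, and the hypothesis makes it small enough against n / 24 for the
  base to be at most 1/3, which is below \<open>exp (- 1)\<close>.\<close>

lemma prob_many_disjoint_triangles_le:
  assumes "12 * (real n)\<^sup>2 * q ^ 3 \<le> 1 / 3" "0 < n"
  shows "Pr {S. \<exists>\<S>\<subseteq>triangles {1..n} S. disjoint \<S> \<and> n < 24 * card \<S>} \<le> exp (- real n / 24)"
proof -
  define j where "j = n div 24 + 1"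
  define \<F> where "\<F> = (\<lambda>t. nsets t 2) ` nsets {1..n} 3"
  have \<F>: "\<F> \<subseteq> nsets (Kn_edges n) 3"
  proof
    fix x assume "x \<in> \<F>"
    then obtain t where t: "x = nsets t 2" "t \<subseteq> {1..n}" "finite t" "card t = 3" by (auto simp: \<F>_def nsets_def[of _ 3])
    then show "x \<in> nsets (Kn_edges n) 3"
      using nsets_mono[of t "{1..n}" 2] by (simp add: nsets_def[of _ 3] finite_imp_finite_nsets choose_two)
  qed
  have "card \<F> \<le> n choose 3"
    unfolding \<F>_def using card_image_le[of "nsets {1..n} 3" "\<lambda>t. nsets t 2"] by (simp add: finite_imp_finite_nsets)
  then have c\<F>: "real (card \<F>) \<le> real n ^ 3 / 6" using choose_3_le[of n] by (meson of_nat_le_iff order_trans)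
  have j: "real n / 24 \<le> real j" "0 < j" by (auto simp: j_def field_simps)
  have "Pr {S. \<exists>\<S>\<subseteq>triangles {1..n} S. disjoint \<S> \<and> n < 24 * card \<S>} \<le>
      Pr {S. \<exists>\<G>\<subseteq>\<F>. card \<G> = j \<and> disjoint \<G> \<and> \<Union>\<G> \<subseteq> S}"
  proof (rule measure_pmf.finite_measure_mono, clarify)
    fix S \<S> assume S: "\<S> \<subseteq> triangles {1..n} S" "disjoint \<S>" "n < 24 * card \<S>"
    then have "j \<le> card \<S>" by (simp add: j_def) 
    then obtain \<T> where T: "\<T> \<subseteq> \<S>" "card \<T> = j" by (meson obtain_subset_with_card_n)
    have sep: "nsets s 2 \<inter> nsets t 2 = {}" if "s \<in> \<T>" "t \<in> \<T>" "s \<noteq> t" for s t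
    proof -
      have "s \<inter> t = {}" using that T(1) disjointD[OF S(2), of s t] by blast
      then show ?thesis by (rule disjoint_nsets_2)
    qed
    have ne: "nsets s 2 \<noteq> {}" if "s \<in> \<T>" for s
    proof -
      have "s \<in> nsets {1..n} 3" using that T S(1) by (auto simp: triangles_def)
      then have "card (nsets s 2) = 3" by (simp add: nsets_def[of _ 3] choose_two)
      then show ?thesis by (metis card.empty zero_neq_numeral)
    qed
    have "inj_on (\<lambda>t. nsets t 2) \<T>"
    proof (rule inj_onI, rule ccontr)
      fix s t assume "s \<in> \<T>" "t \<in> \<T>" "nsets s 2 = nsets t 2" "s \<noteq> t"
      then show False using sep[of s t] ne[of s] by simp
    qed
    then have "card ((\<lambda>t. nsets t 2) ` \<T>) = j" using T by (simp add: card_image)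
    moreover have "disjoint ((\<lambda>t. nsets t 2) ` \<T>)" using sep by (auto simp: disjoint_def)
    moreover have "(\<lambda>t. nsets t 2) ` \<T> \<subseteq> \<F>" "\<Union>((\<lambda>t. nsets t 2) ` \<T>) \<subseteq> S"
      using T S by (auto simp: \<F>_def triangles_def)
    ultimately show "\<exists>\<G>\<subseteq>\<F>. card \<G> = j \<and> disjoint \<G> \<and> \<Union>\<G> \<subseteq> S" by blast
  qed simp
  also have "\<dots> \<le> (real (card \<F>) * q ^ 3) ^ j / fact j"
    by (rule prob_disjoint_members_le[OF finite_Kn_edges \<F> q])
  also have "\<dots> \<le> (3 * (real (card \<F>) * q ^ 3) / real j) ^ j"
    using q j by (intro power_div_fact_le) auto
  also have "\<dots> \<le> exp (- 1) ^ j"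
  proof (intro power_mono)
    have "3 * (real (card \<F>) * q ^ 3) \<le> 3 * (real n ^ 3 / 6 * q ^ 3)"
      using c\<F> q by (intro mult_left_mono mult_right_mono) auto
    also have "\<dots> = (12 * (real n)\<^sup>2 * q ^ 3) * (real n / 24)" by (simp add: eval_nat_numeral)
    also have "\<dots> \<le> (1 / 3) * real j" using assms j by (intro mult_mono) auto
    finally have "3 * (real (card \<F>) * q ^ 3) / real j \<le> 1 / 3" using j by (simp add: field_simps)
    also have "1 / 3 \<le> exp (- 1 :: real)" using exp_le by (simp add: exp_minus field_simps)
    finally show "3 * (real (card \<F>) * q ^ 3) / real j \<le> exp (- 1)" .
  qed (use q in auto)
  also have "\<dots> = exp (- real j)" by (simp flip: exp_of_nat_mult)
  also have "\<dots> \<le> exp (- real n / 24)" using j by simp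
  finally show ?thesis .
qed

text \<open>A member of \<open>\<F>\<close> is a triangle with one edge to \<open>v\<close>, four
  edges in all, and there are at most n^3 of them. For disjoint triangles avoiding \<open>v\<close>
  these edge sets are disjoint, since the edges at \<open>v\<close> have different ends.\<close>

lemma prob_many_adjacent_triangles_le:
  assumes v: "v \<in> {1..n}"
  shows "Pr {S. \<exists>\<S>\<subseteq>triangles {1..n} S. disjoint \<S> \<and> v \<notin> \<Union>\<S> \<and> (\<forall>t\<in>\<S>. \<exists>u\<in>t. {v, u} \<in> S) \<and> k \<le> card \<S>}
    \<le> (real n ^ 3 * q ^ 4) ^ k"
proof -
  define \<F> where "\<F> = (\<lambda>(t, u). insert {v, u} (nsets t 2)) ` {(t, u). t \<in> nsets {1..n} 3 \<and> v \<notin> t \<and> u \<in> t}"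
  have I: "{(t, u). t \<in> nsets {1..n} 3 \<and> v \<notin> t \<and> u \<in> t} \<subseteq> (SIGMA t:nsets {1..n} 3. t)" by auto
  have finI: "finite (SIGMA t:nsets {1..n} 3. t)"
    by (intro finite_SigmaI) (auto simp: finite_imp_finite_nsets nsets_def[of _ 3])
  have \<F>: "\<F> \<subseteq> nsets (Kn_edges n) 4"
  proof
    fix x assume "x \<in> \<F>"
    then obtain t u where t: "x = insert {v, u} (nsets t 2)" "t \<subseteq> {1..n}" "finite t" "card t = 3" "v \<notin> t" "u \<in> t"
      by (auto simp: \<F>_def nsets_def[of _ 3])
    have "{v, u} \<notin> nsets t 2" using t by simp
    then have "card x = 4" using t by (simp add: finite_imp_finite_nsets choose_two)
    moreover have "x \<subseteq> Kn_edges n" using t v nsets_mono[of t "{1..n}" 2] by auto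
    moreover have "finite x" using t by (simp add: finite_imp_finite_nsets)
    ultimately show "x \<in> nsets (Kn_edges n) 4" by (simp add: nsets_def[of _ 4])
  qed
  have "card \<F> \<le> card {(t, u). t \<in> nsets {1..n} 3 \<and> v \<notin> t \<and> u \<in> t}"
    unfolding \<F>_def by (rule card_image_le[OF finite_subset[OF I finI]])
  also have "\<dots> \<le> card (SIGMA t:nsets {1..n} 3. t)" by (rule card_mono[OF finI I])
  also have "\<dots> = (\<Sum>t\<in>nsets {1..n} 3. card t)"
    by (intro card_SigmaI) (auto simp: finite_imp_finite_nsets nsets_def[of _ 3])
  also have "\<dots> = (\<Sum>t\<in>nsets {1..n} 3. 3)" by (intro sum.cong) (auto simp: nsets_def[of _ 3])
  finally have "card \<F> \<le> 3 * (n choose 3)" by simp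
  then have "real (card \<F>) \<le> 3 * real (n choose 3)" by (metis of_nat_le_iff of_nat_mult of_nat_numeral)
  then have c\<F>: "real (card \<F>) \<le> real n ^ 3" using choose_3_le[of n] zero_le_power[of "real n" 3] by linarith
  have "Pr {S. \<exists>\<S>\<subseteq>triangles {1..n} S. disjoint \<S> \<and> v \<notin> \<Union>\<S> \<and> (\<forall>t\<in>\<S>. \<exists>u\<in>t. {v, u} \<in> S) \<and> k \<le> card \<S>} \<le>
      Pr {S. \<exists>\<G>\<subseteq>\<F>. card \<G> = k \<and> disjoint \<G> \<and> \<Union>\<G> \<subseteq> S}"
  proof (rule measure_pmf.finite_measure_mono, clarify)
    fix S \<S> assume S: "\<S> \<subseteq> triangles {1..n} S" "disjoint \<S>" "v \<notin> \<Union>\<S>" "\<forall>t\<in>\<S>. \<exists>u\<in>t. {v, u} \<in> S" "k \<le> card \<S>"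
    then obtain \<T> where T: "\<T> \<subseteq> \<S>" "card \<T> = k" by (meson obtain_subset_with_card_n)
    obtain u where u: "\<forall>t\<in>\<S>. u t \<in> t \<and> {v, u t} \<in> S"
      using bchoice[of \<S> "\<lambda>t u. u \<in> t \<and> {v, u} \<in> S"] S(4) by blast
    define g where "g = (\<lambda>t. insert {v, u t} (nsets t 2))"
    have sep: "g s \<inter> g t = {}" if "s \<in> \<T>" "t \<in> \<T>" "s \<noteq> t" for s t
    proof -
      have "s \<in> \<S>" "t \<in> \<S>" using that T by blast+
      then have st: "s \<inter> t = {}" "v \<notin> s" "v \<notin> t" "u s \<in> s" "u t \<in> t"
        using that(3) disjointD[OF S(2), of s t] S(3) u by blast+
      have "nsets s 2 \<inter> nsets t 2 = {}" by (rule disjoint_nsets_2[OF st(1)])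
      moreover have "{v, u s} \<noteq> {v, u t}" using st by (auto simp: doubleton_eq_iff)
      moreover have "{v, u s} \<notin> nsets t 2" "{v, u t} \<notin> nsets s 2" using st(2,3) by simp_all
      ultimately show ?thesis unfolding g_def by blast
    qed
    have ne: "g s \<noteq> {}" for s by (simp add: g_def)
    have "inj_on g \<T>"
    proof (rule inj_onI, rule ccontr)
      fix s t assume "s \<in> \<T>" "t \<in> \<T>" "g s = g t" "s \<noteq> t"
      then show False using sep[of s t] ne[of s] by simp
    qed
    then have "card (g ` \<T>) = k" using T by (simp add: card_image)
    moreover have "disjoint (g ` \<T>)" using sep by (auto simp: disjoint_def)
    moreover have "g ` \<T> \<subseteq> \<F>"
    proof clarify
      fix t assume "t \<in> \<T>"
      then have "t \<in> nsets {1..n} 3 \<and> v \<notin> t \<and> u t \<in> t" using T S u by (auto simp: triangles_def)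
      then show "g t \<in> \<F>" unfolding \<F>_def g_def by (intro image_eqI[of _ _ "(t, u t)"]) auto
    qed
    moreover have "\<Union>(g ` \<T>) \<subseteq> S" using T S u by (auto simp: g_def triangles_def)
    ultimately show "\<exists>\<G>\<subseteq>\<F>. card \<G> = k \<and> disjoint \<G> \<and> \<Union>\<G> \<subseteq> S" by blast
  qed simp
  also have "\<dots> \<le> (real (card \<F>) * q ^ 4) ^ k / fact k"
    by (rule prob_disjoint_members_le[OF finite_Kn_edges \<F> q])
  also have "\<dots> \<le> (real (card \<F>) * q ^ 4) ^ k / 1"
    using q by (intro divide_left_mono) (auto simp: fact_ge_1)
  also have "\<dots> \<le> (real n ^ 3 * q ^ 4) ^ k"
    using c\<F> q by (simp add: power_mono mult_right_mono)
  finally show ?thesis .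
qed

end

text \<open>A union bound over the failure of the six conditions; the two degree conditions share
  the first summand.\<close>

lemma prob_not_good_graph_le:
  assumes q: "0 \<le> q" "q \<le> 1" and n: "40 \<le> n"
    and D: "real (d + 3 * k) \<le> real n * q / 20"
    and d: "0 < d" "48 * real m * q \<le> real d" "real n * exp (- real d) \<le> 1" and m: "2 * m \<le> n"
    and small: "12 * (real n)\<^sup>2 * q ^ 3 \<le> 1 / 3"
  shows "measure_pmf.prob (random_subset (Kn_edges n) q) {S. \<not> good_graph n d k m S} \<le>
    2 * real n * exp (- (real n * q / 20)) + (real n)\<^sup>2 * exp (- real d) +
    4 ^ n * exp (- q * (real m)\<^sup>2) + real n * (real n ^ 3 * q ^ 4) ^ k + exp (- real n / 24)"
proof -
  let ?P = "measure_pmf.prob (random_subset (Kn_edges n) q)"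
  define B1 where "B1 = (\<Union>v\<in>{1..n}. {S. card {u \<in> {1..n div 4}. {v, u} \<in> S} < d + 3 * k})"
  define B2 where "B2 = (\<Union>v\<in>{1..n}. {S. card {u \<in> {n - n div 4 + 1..n}. {v, u} \<in> S} < d + 3 * k})"
  define B3 where "B3 = (\<Union>Z\<in>{Z. Z \<subseteq> {1..n} \<and> Z \<noteq> {} \<and> card Z \<le> 2 * m}. {S. d * card Z \<le> 2 * card (S \<inter> nsets Z 2)})"
  define B4 where "B4 = (\<Union>(A, B)\<in>{(A, B). A \<subseteq> {1..n} \<and> B \<subseteq> {1..n} \<and> A \<inter> B = {} \<and> card A = m \<and> card B = m}.
      {S. \<forall>a\<in>A. \<forall>b\<in>B. {a, b} \<notin> S})"
  define B5 where "B5 = (\<Union>v\<in>{1..n}. {S. \<exists>\<S>\<subseteq>triangles {1..n} S. disjoint \<S> \<and> v \<notin> \<Union>\<S> \<and> (\<forall>t\<in>\<S>. \<exists>u\<in>t. {v, u} \<in> S) \<and> k \<le> card \<S>})"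
  define B6 where "B6 = {S. \<exists>\<S>\<subseteq>triangles {1..n} S. disjoint \<S> \<and> n < 24 * card \<S>}"
  have low: "?P (\<Union>v\<in>{1..n}. {S. card {u \<in> M. {v, u} \<in> S} < d + 3 * k}) \<le> real n * exp (- (real n * q / 20))"
    if M: "M \<subseteq> {1..n}" "card M = n div 4" for M
  proof -
    have "?P (\<Union>v\<in>{1..n}. {S. card {u \<in> M. {v, u} \<in> S} < d + 3 * k}) \<le>
        (\<Sum>v\<in>{1..n}. ?P {S. card {u \<in> M. {v, u} \<in> S} < d + 3 * k})" by (rule prob_UN_le) simp
    also have "\<dots> \<le> (\<Sum>v\<in>{1..n}. exp (- (real n * q / 20)))"
    proof (rule sum_mono)
      fix v assume v: "v \<in> {1..n}"
      have "real n \<le> 4 * real (n div 4) + 3" by linarith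
      then have "real n / 5 \<le> real (card M) - 1" using M n by simp
      then have "q / 2 * (real n / 5) \<le> q / 2 * (real (card M) - 1)" using q by (intro mult_left_mono) auto
      then have "real (d + 3 * k) - q / 2 * (real (card M) - 1) \<le> - (real n * q / 20)"
        using D by (simp add: field_simps)
      then show "?P {S. card {u \<in> M. {v, u} \<in> S} < d + 3 * k} \<le> exp (- (real n * q / 20))"
        by (intro order_trans[OF prob_low_degree_le[OF q v M(1)]]) simp
    qed
    finally show ?thesis by simp
  qed
  have 1: "?P B1 \<le> real n * exp (- (real n * q / 20))" unfolding B1_def by (rule low) auto
  have 2: "?P B2 \<le> real n * exp (- (real n * q / 20))" unfolding B2_def by (rule low) auto
  have 3: "?P B3 \<le> (real n)\<^sup>2 * exp (- real d)"
    unfolding B3_def by (rule prob_dense_sets_le[OF q]) (use d m in auto)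
  have 4: "?P B4 \<le> 4 ^ n * exp (- q * (real m)\<^sup>2)" unfolding B4_def by (rule prob_hole_le[OF q])
  have 5: "?P B5 \<le> real n * (real n ^ 3 * q ^ 4) ^ k"
  proof -
    have "?P B5 \<le> (\<Sum>v\<in>{1..n}. ?P {S. \<exists>\<S>\<subseteq>triangles {1..n} S. disjoint \<S> \<and> v \<notin> \<Union>\<S> \<and> (\<forall>t\<in>\<S>. \<exists>u\<in>t. {v, u} \<in> S) \<and> k \<le> card \<S>})"
      unfolding B5_def by (rule prob_UN_le) simp
    also have "\<dots> \<le> (\<Sum>v\<in>{1..n}. (real n ^ 3 * q ^ 4) ^ k)"
      by (intro sum_mono prob_many_adjacent_triangles_le[OF q])
    finally show ?thesis by simp
  qed
  have 6: "?P B6 \<le> exp (- real n / 24)"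
    unfolding B6_def by (rule prob_many_disjoint_triangles_le[OF q small]) (use n in simp)
  have "good_graph n d k m S" if "S \<notin> B1" "S \<notin> B2" "S \<notin> B3" "S \<notin> B4" "S \<notin> B5" "S \<notin> B6" for S
  proof
    show "d + 3 * k \<le> card {u \<in> {1..n div 4}. {v, u} \<in> S}" if "v \<in> {1..n}" for v
      using that \<open>S \<notin> B1\<close> unfolding B1_def by (auto simp: not_less)
    show "d + 3 * k \<le> card {u \<in> {n - n div 4 + 1..n}. {v, u} \<in> S}" if "v \<in> {1..n}" for v
      using that \<open>S \<notin> B2\<close> unfolding B2_def by (auto simp: not_less)
    show "2 * card (S \<inter> nsets Z 2) < d * card Z" if "Z \<subseteq> {1..n}" "Z \<noteq> {}" "card Z \<le> 2 * m" for Z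
    proof (rule ccontr)
      assume "\<not> ?thesis"
      then have "S \<in> {S. d * card Z \<le> 2 * card (S \<inter> nsets Z 2)}" by (simp add: not_less)
      then have "S \<in> B3" unfolding B3_def using that by (intro UN_I[of Z]) (simp_all only: mem_Collect_eq simp_thms)
      then show False using \<open>S \<notin> B3\<close> by simp
    qed
    show "\<exists>s\<in>A. \<exists>t\<in>B. {s, t} \<in> S" if "A \<subseteq> {1..n}" "B \<subseteq> {1..n}" "A \<inter> B = {}" "card A = m" "card B = m" for A B
    proof (rule ccontr)
      assume "\<not> ?thesis"
      then have "S \<in> {S. \<forall>a\<in>A. \<forall>b\<in>B. {a, b} \<notin> S}" by blast
      then have "S \<in> B4" unfolding B4_def using that by (intro UN_I[of "(A, B)"]) auto
      then show False using \<open>S \<notin> B4\<close> by simp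
    qed
    show "card \<S> < k" if "v \<in> {1..n}" "\<S> \<subseteq> triangles {1..n} S" "disjoint \<S>" "v \<notin> \<Union>\<S>"
      "\<And>t. t \<in> \<S> \<Longrightarrow> \<exists>u\<in>t. {v, u} \<in> S" for v \<S>
    proof (rule ccontr)
      assume "\<not> card \<S> < k"
      moreover have "\<forall>t\<in>\<S>. \<exists>u\<in>t. {v, u} \<in> S" using that(5) by blast
      ultimately have "\<exists>\<S>\<subseteq>triangles {1..n} S. disjoint \<S> \<and> v \<notin> \<Union>\<S> \<and> (\<forall>t\<in>\<S>. \<exists>u\<in>t. {v, u} \<in> S) \<and> k \<le> card \<S>"
        using that(2-4) unfolding not_less by (intro exI[of _ \<S>] conjI)
      then have "S \<in> B5" unfolding B5_def by (intro UN_I[OF that(1)] CollectI)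
      then show False using \<open>S \<notin> B5\<close> by simp
    qed
    show "24 * card \<S> \<le> n" if "\<S> \<subseteq> triangles {1..n} S" "disjoint \<S>" for \<S>
    proof (rule ccontr)
      assume "\<not> ?thesis"
      then have "S \<in> B6" unfolding B6_def using that by (intro CollectI exI[of _ \<S>]) auto
      then show False using \<open>S \<notin> B6\<close> by simp
    qed
    show "4 \<le> n" using n by simp
  qed
  then have "{S. \<not> good_graph n d k m S} \<subseteq> B1 \<union> B2 \<union> B3 \<union> B4 \<union> B5 \<union> B6" by blast
  then have "?P {S. \<not> good_graph n d k m S} \<le> ?P (B1 \<union> B2 \<union> B3 \<union> B4 \<union> B5 \<union> B6)"
    by (rule measure_pmf.finite_measure_mono) simp
  also have "\<dots> \<le> ?P B1 + ?P B2 + ?P B3 + ?P B4 + ?P B5 + ?P B6"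
  proof -
    have sub: "?P (A \<union> B) \<le> ?P A + ?P B" for A B by (rule measure_Un_le) simp_all
    show ?thesis
      using sub[of B1 B2] sub[of "B1 \<union> B2" B3] sub[of "B1 \<union> B2 \<union> B3" B4]
        sub[of "B1 \<union> B2 \<union> B3 \<union> B4" B5] sub[of "B1 \<union> B2 \<union> B3 \<union> B4 \<union> B5" B6] by linarith
  qed
  finally show ?thesis using 1 2 3 4 5 6 by linarith
qed

section \<open>The error of the approximation by the triangle count\<close>

definition chi_defect :: "nat \<Rightarrow> nat set set \<Rightarrow> real" where
  "chi_defect n S = chi n (Kn_edges n - S) - (real n - real (card (triangles {1..n} S))) / 2"

lemma chi_defect_nonneg: "0 \<le> chi_defect n S"
proof -
  have "card {1..n} \<le> 2 * chromatic_number {1..n} (Kn_edges n - S) + card (triangles {1..n} S)"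
    by (rule card_le_chromatic_number_complement) simp
  then show ?thesis unfolding chi_defect_def chi_def by simp
qed

lemma chi_defect_le_good:
  assumes "good_graph n d k m S"
  shows "chi_defect n S \<le> real (card (touching_pairs {1..n} S)) / 2 + 1"
proof -
  interpret good_graph n d k m S by fact
  have "2 * chromatic_number {1..n} (Kn_edges n - S) + card (triangles {1..n} S) \<le> n + 1 + card (touching_pairs {1..n} S)"
    using two_chromatic_number_le card_triangles_le[of "{1..n}" S] by simp
  from of_nat_mono[OF this, where 'a=real] show ?thesis
    unfolding chi_defect_def chi_def by (simp add: field_simps)
qed

text \<open>A trivial bound from the cover by singletons, for graphs that are not good; its square
  \<open>4 * n ^ 6\<close> has to be offset by the probability of that event.\<close>

lemma chi_defect_le:
  assumes "0 < n"
  shows "chi_defect n S \<le> 2 * real n ^ 3"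
proof -
  have "chromatic_number {1..n} (Kn_edges n - S) \<le> card ((\<lambda>v. {v}) ` {1..n})"
    by (rule chromatic_number_complement_le) (auto simp: nsets_singleton_iff)
  also have "\<dots> = n" by (simp add: card_image)
  finally have "real (chromatic_number {1..n} (Kn_edges n - S)) \<le> real n" by simp
  moreover have "real (card (triangles {1..n} S)) \<le> real n ^ 3"
  proof -
    have "card (triangles {1..n} S) \<le> card (nsets {1..n} 3)"
      by (rule card_mono) (auto simp: triangles_def finite_imp_finite_nsets)
    then have "real (card (triangles {1..n} S)) \<le> real (n choose 3)" by simp
    then show ?thesis using choose_3_le[of n] zero_le_power[of "real n" 3] by linarith
  qed
  moreover have "real n ^ 1 \<le> real n ^ 3" using assms by (intro power_increasing) auto
  moreover have "c - (a - b) / 2 \<le> 2 * N" if "c \<le> a" "b \<le> N" "a ^ 1 \<le> N" "0 \<le> a" for a b c N :: real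
    using that by (simp add: field_simps)
  ultimately show ?thesis unfolding chi_defect_def chi_def using of_nat_0_le_iff by metis
qed

lemma expectation_chi_defect_square_le:
  assumes q: "0 \<le> q" "q \<le> 1" and n: "0 < n"
  shows "measure_pmf.expectation (random_subset (Kn_edges n) q) (\<lambda>S. (chi_defect n S)\<^sup>2) \<le>
    measure_pmf.expectation (random_subset (Kn_edges n) q) (\<lambda>S. (real (card (touching_pairs {1..n} S)))\<^sup>2) + 2 +
    4 * real n ^ 6 * measure_pmf.prob (random_subset (Kn_edges n) q) {S. \<not> good_graph n d k m S}"
proof -
  let ?E = "measure_pmf.expectation (random_subset (Kn_edges n) q)"
  let ?Y = "\<lambda>S. real (card (touching_pairs {1..n} S))"
  let ?B = "{S. \<not> good_graph n d k m S}"
  note int = integrable_random_subset[OF finite_Kn_edges]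
  have "?E (\<lambda>S. (chi_defect n S)\<^sup>2) \<le> ?E (\<lambda>S. (?Y S)\<^sup>2 + 2 + 4 * real n ^ 6 * indicator ?B S)"
  proof (rule integral_mono[OF int int])
    fix S
    show "(chi_defect n S)\<^sup>2 \<le> (?Y S)\<^sup>2 + 2 + 4 * real n ^ 6 * indicator ?B S"
    proof (cases "good_graph n d k m S")
      case True
      have "(chi_defect n S)\<^sup>2 \<le> (?Y S / 2 + 1)\<^sup>2"
        by (rule power_mono[OF chi_defect_le_good[OF True] chi_defect_nonneg])
      also have "\<dots> \<le> (?Y S)\<^sup>2 + 2" 
      proof -
        have "y\<^sup>2 + 2 - (y / 2 + 1)\<^sup>2 = (y / 2 - 1)\<^sup>2 + y\<^sup>2 / 2" for y :: real
          by (simp add: power2_eq_square field_simps)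
        moreover have "0 \<le> (y / 2 - 1)\<^sup>2 + y\<^sup>2 / 2" for y :: real by simp
        ultimately show ?thesis by (metis diff_ge_0_iff_ge)
      qed
      finally show ?thesis using True by simp
    next
      case False
      have "(chi_defect n S)\<^sup>2 \<le> (2 * real n ^ 3)\<^sup>2"
        by (rule power_mono[OF chi_defect_le[OF n] chi_defect_nonneg])
      also have "\<dots> = 4 * real n ^ 6" by (simp add: power_mult_distrib flip: power_mult)
      also have "\<dots> = 4 * real n ^ 6 * indicator ?B S" using False by simp
      finally show ?thesis using zero_le_power2[of "?Y S"] by linarith
    qed
  qed
  also have "\<dots> = ?E (\<lambda>S. (?Y S)\<^sup>2) + 2 + 4 * real n ^ 6 * measure_pmf.prob (random_subset (Kn_edges n) q) ?B"
    unfolding Bochner_Integration.integral_add[OF int int] by simp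
  finally show ?thesis .
qed

section \<open>Normal limits under a small perturbation\<close>

text \<open>\<open>Y\<close> is a constant minus half of \<open>X\<close>, with an error whose mean
  square is small against the variance. The standardised variables of \<open>Y\<close> and of
  \<open>- X\<close> are thus close in mean, which is transferred to characteristic functions;
  Levy's continuity theorem concludes.\<close>

lemma normal_limit_of_perturbation:
  fixes M :: "nat \<Rightarrow> 'a pmf" and X R Y :: "nat \<Rightarrow> 'a \<Rightarrow> real" and l c :: "nat \<Rightarrow> real"
  defines "E \<equiv> \<lambda>n f. measure_pmf.expectation (M n) (f :: 'a \<Rightarrow> real)"
  assumes fin: "\<And>n. finite (set_pmf (M n))"
    and l: "filterlim l at_top sequentially"
    and Y: "\<And>n x. x \<in> set_pmf (M n) \<Longrightarrow> Y n x = c n - X n x / 2 + R n x"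
    and EX: "\<And>n. E n (X n) = l n"
    and VX: "(\<lambda>n. E n (\<lambda>x. (X n x - l n)\<^sup>2) / l n) \<longlonglongrightarrow> 1"
    and ER: "(\<lambda>n. E n (\<lambda>x. (R n x)\<^sup>2) / l n) \<longlonglongrightarrow> 0"
    and char: "\<And>t. (\<lambda>n. measure_pmf.expectation (M n) (\<lambda>x. iexp (t * ((X n x - l n) / sqrt (l n))))) \<longlonglongrightarrow> exp (- (t\<^sup>2 / 2))"
  shows "(\<lambda>n. measure_pmf.variance (M n) (Y n) / l n) \<longlonglongrightarrow> 1 / 4"
    and "weak_conv_m (\<lambda>n. distr (M n) borel (\<lambda>x. (Y n x - measure_pmf.expectation (M n) (Y n)) /
       sqrt (measure_pmf.variance (M n) (Y n)))) std_normal_distribution"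
proof -
  note int [simp] = integrable_measure_pmf_finite[OF fin]
  have mono: "E n f \<le> E n g" if "\<And>x. f x \<le> g x" for n f g
    unfolding E_def by (rule integral_mono[OF int int that])
  have add: "E n (\<lambda>x. f x + g x) = E n f + E n g" for n f g
    unfolding E_def by (rule Bochner_Integration.integral_add[OF int int])
  have diff: "E n (\<lambda>x. f x - g x) = E n f - E n g" for n f g
    unfolding E_def by (rule Bochner_Integration.integral_diff[OF int int])
  have mult: "E n (\<lambda>x. a * f x) = a * E n f" for n a f unfolding E_def by simp
  have const: "E n (\<lambda>x. a) = a" for n a unfolding E_def by simp
  define D where "D = (\<lambda>n x. X n x - l n)"
  define S where "S = (\<lambda>n x. R n x - E n (R n))"
  \<comment> \<open>The extra \<open>1 / l n\<close> keeps \<open>\<epsilon> n\<close> positive even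
    if \<open>R n\<close> vanishes, so that \<open>amgm\<close> can use it as a weight; it does not
    affect the limit 0.\<close>
  define \<epsilon> where "\<epsilon> = (\<lambda>n. sqrt (E n (\<lambda>x. (R n x)\<^sup>2) / l n + 1 / l n))"
  define v where "v = (\<lambda>n. E n (\<lambda>x. (D n x)\<^sup>2) / l n)"
  have pos: "\<forall>\<^sub>F n in sequentially. 0 < l n" using l by (simp add: filterlim_at_top_dense)
  have v: "v \<longlonglongrightarrow> 1" using VX by (simp add: v_def D_def)
  have ER0: "0 \<le> E n (\<lambda>x. (R n x)\<^sup>2)" for n unfolding E_def by simp
  have "(\<lambda>n. 1 / l n) \<longlonglongrightarrow> 0" by (intro tendsto_divide_0[OF tendsto_const] filterlim_at_top_imp_at_infinity l)
  from tendsto_real_sqrt[OF tendsto_add[OF ER this]] have eps0: "\<epsilon> \<longlonglongrightarrow> 0" by (simp add: \<epsilon>_def)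
  have eps: "0 < \<epsilon> n" "E n (\<lambda>x. (S n x)\<^sup>2) \<le> (\<epsilon> n)\<^sup>2 * l n" if "0 < l n" for n
  proof -
    show "0 < \<epsilon> n" using that ER0[of n] by (simp add: \<epsilon>_def add_nonneg_pos)
    have "E n (\<lambda>x. (S n x)\<^sup>2) = E n (\<lambda>x. (R n x)\<^sup>2 - (2 * E n (R n)) * R n x + (E n (R n))\<^sup>2)"
      by (simp add: S_def power2_diff mult_ac algebra_simps)
    also have "\<dots> = E n (\<lambda>x. (R n x)\<^sup>2) - (E n (R n))\<^sup>2"
      unfolding add diff mult const by (simp add: power2_eq_square)
    also have "\<dots> \<le> E n (\<lambda>x. (R n x)\<^sup>2) + 1" using zero_le_power2[of "E n (R n)"] by linarith
    also have "\<dots> = (\<epsilon> n)\<^sup>2 * l n" using that ER0[of n] by (simp add: \<epsilon>_def field_simps)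
    finally show "E n (\<lambda>x. (S n x)\<^sup>2) \<le> (\<epsilon> n)\<^sup>2 * l n" .
  qed
  \<comment> \<open>Takes the place of the Cauchy-Schwarz inequality: with weight
    \<open>\<epsilon> n\<close> it bounds the mixed moment of \<open>S\<close> and \<open>D\<close>,
    and with one factor equal to 1 it bounds first absolute moments by second moments.\<close>
  have amgm: "\<bar>a * b\<bar> \<le> e / 2 * a\<^sup>2 + b\<^sup>2 / (2 * e)" if "0 < e" for a b e :: real
  proof -
    have "0 \<le> (e * \<bar>a\<bar> - \<bar>b\<bar>)\<^sup>2 / (2 * e)" using that by simp
    also have "\<dots> = e / 2 * a\<^sup>2 + b\<^sup>2 / (2 * e) - \<bar>a * b\<bar>"
      using that by (simp add: power2_diff power_mult_distrib field_simps power2_eq_square abs_mult)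
    finally show ?thesis by simp
  qed
  have absS: "E n (\<lambda>x. \<bar>S n x\<bar>) / sqrt (l n) \<le> \<epsilon> n" if "0 < l n" for n
  proof -
    define a where "a = \<epsilon> n * sqrt (l n)"
    have a: "0 < a" "a\<^sup>2 = (\<epsilon> n)\<^sup>2 * l n" using that eps[OF that] by (simp_all add: a_def power_mult_distrib)
    have "E n (\<lambda>x. \<bar>S n x\<bar>) \<le> E n (\<lambda>x. a / 2 + (1 / (2 * a)) * (S n x)\<^sup>2)"
      using amgm[of a 1] a by (intro mono) simp
    also have "\<dots> = a / 2 + (1 / (2 * a)) * E n (\<lambda>x. (S n x)\<^sup>2)" unfolding add mult const ..
    also have "\<dots> \<le> a / 2 + (1 / (2 * a)) * a\<^sup>2"
      using eps(2)[OF that] a by (intro add_left_mono mult_left_mono) auto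
    also have "\<dots> = a" using a(1) by (simp add: power2_eq_square)
    finally show ?thesis using that by (simp add: a_def field_simps)
  qed
  have absD: "E n (\<lambda>x. \<bar>D n x\<bar>) / sqrt (l n) \<le> (1 + v n) / 2" if "0 < l n" for n
  proof -
    define a where "a = sqrt (l n)"
    have a: "0 < a" "a\<^sup>2 = l n" using that by (simp_all add: a_def)
    have "E n (\<lambda>x. \<bar>D n x\<bar>) \<le> E n (\<lambda>x. a / 2 + (1 / (2 * a)) * (D n x)\<^sup>2)"
      using amgm[of a 1] a by (intro mono) simp
    also have "\<dots> = a / 2 + (1 / (2 * a)) * E n (\<lambda>x. (D n x)\<^sup>2)" unfolding add mult const ..
    also have "E n (\<lambda>x. (D n x)\<^sup>2) = v n * a\<^sup>2" using that by (simp add: v_def a)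
    finally show ?thesis using a by (simp add: a_def[symmetric] field_simps power2_eq_square)
  qed
  have EY: "E n (Y n) = c n - l n / 2 + E n (R n)" for n
  proof -
    have "E n (Y n) = E n (\<lambda>x. (c n - (1 / 2) * X n x) + R n x)"
      unfolding E_def by (intro integral_cong_AE) (auto simp: AE_measure_pmf_iff Y)
    also have "\<dots> = c n - l n / 2 + E n (R n)" unfolding add diff mult const by (simp add: EX)
    finally show ?thesis .
  qed
  have Ydiff: "Y n x - E n (Y n) = S n x - D n x / 2" if "x \<in> set_pmf (M n)" for n x
    using Y[OF that] by (simp add: EY S_def D_def field_simps)
  define V where "V = (\<lambda>n. measure_pmf.variance (M n) (Y n))"
  have V: "V n = E n (\<lambda>x. (S n x)\<^sup>2) - E n (\<lambda>x. S n x * D n x) + E n (\<lambda>x. (D n x)\<^sup>2) / 4" for n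
  proof -
    have "V n = E n (\<lambda>x. (S n x - D n x / 2)\<^sup>2)"
      unfolding V_def E_def[symmetric] using Ydiff
      by (simp add: E_def) (intro integral_cong_AE; auto simp: AE_measure_pmf_iff)
    also have "\<dots> = E n (\<lambda>x. (S n x)\<^sup>2 - S n x * D n x + (1 / 4) * (D n x)\<^sup>2)"
      by (intro arg_cong[where f="E n"]) (simp add: fun_eq_iff power2_diff power_divide)
    finally show ?thesis unfolding add diff mult by simp
  qed
  have "(\<lambda>n. V n / l n - v n / 4) \<longlonglongrightarrow> 0"
  proof (rule Lim_null_comparison)
    show "(\<lambda>n. (\<epsilon> n)\<^sup>2 + (\<epsilon> n / 2 * v n + \<epsilon> n / 2)) \<longlonglongrightarrow> 0"
      by (rule tendsto_eq_intros eps0 v refl | simp)+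
    show "\<forall>\<^sub>F n in sequentially. norm (V n / l n - v n / 4) \<le> (\<epsilon> n)\<^sup>2 + (\<epsilon> n / 2 * v n + \<epsilon> n / 2)"
      using pos
    proof eventually_elim
      case (elim n)
      note e = eps[OF elim]
      have S0: "0 \<le> E n (\<lambda>x. (S n x)\<^sup>2)" unfolding E_def by simp
      have "\<bar>E n (\<lambda>x. S n x * D n x)\<bar> \<le> E n (\<lambda>x. \<bar>S n x * D n x\<bar>)"
        unfolding E_def by (rule integral_abs_bound)
      also have "\<dots> \<le> E n (\<lambda>x. \<epsilon> n / 2 * (D n x)\<^sup>2 + (1 / (2 * \<epsilon> n)) * (S n x)\<^sup>2)"
        using amgm[OF e(1)] by (intro mono) (simp add: mult.commute[of "S n _"])
      also have "\<dots> = \<epsilon> n / 2 * E n (\<lambda>x. (D n x)\<^sup>2) + (1 / (2 * \<epsilon> n)) * E n (\<lambda>x. (S n x)\<^sup>2)"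
        unfolding add mult ..
      also have "\<dots> \<le> \<epsilon> n / 2 * (v n * l n) + (1 / (2 * \<epsilon> n)) * ((\<epsilon> n)\<^sup>2 * l n)"
        using e elim by (intro add_mono mult_left_mono) (auto simp: v_def)
      also have "\<dots> = (\<epsilon> n / 2 * v n + \<epsilon> n / 2) * l n"
        using e by (simp add: power2_eq_square field_simps)
      finally have c: "\<bar>E n (\<lambda>x. S n x * D n x)\<bar> \<le> (\<epsilon> n / 2 * v n + \<epsilon> n / 2) * l n" .
      have "V n / l n - v n / 4 = (E n (\<lambda>x. (S n x)\<^sup>2) - E n (\<lambda>x. S n x * D n x)) / l n"
        by (simp add: V v_def add_divide_distrib diff_divide_distrib)
      also have "norm \<dots> = \<bar>E n (\<lambda>x. (S n x)\<^sup>2) - E n (\<lambda>x. S n x * D n x)\<bar> / l n" using elim by simp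
      also have "\<dots> \<le> ((\<epsilon> n)\<^sup>2 * l n + (\<epsilon> n / 2 * v n + \<epsilon> n / 2) * l n) / l n"
        using e c S0 elim by (intro divide_right_mono) linarith+
      also have "\<dots> = (\<epsilon> n)\<^sup>2 + (\<epsilon> n / 2 * v n + \<epsilon> n / 2)" using elim by (simp add: field_simps)
      finally show ?case .
    qed
  qed
  from tendsto_add[OF this tendsto_divide[OF v tendsto_const[of 4]]]
  show Vlim: "(\<lambda>n. measure_pmf.variance (M n) (Y n) / l n) \<longlonglongrightarrow> 1 / 4" by (simp add: V_def)
  define \<sigma> where "\<sigma> = (\<lambda>n. sqrt (V n))"
  have "(\<lambda>n. sqrt (V n / l n)) \<longlonglongrightarrow> sqrt (1 / 4)"
    by (rule tendsto_real_sqrt) (use Vlim in \<open>simp add: V_def\<close>)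
  moreover have "sqrt (1 / 4) = 1 / 2" by (simp add: real_sqrt_divide)
  ultimately have ratio: "(\<lambda>n. sqrt (l n) / \<sigma> n) \<longlonglongrightarrow> 2"
    using tendsto_inverse[of "\<lambda>n. sqrt (V n / l n)" "1 / 2"] by (simp add: \<sigma>_def real_sqrt_divide)
  define Z where "Z = (\<lambda>n x. (Y n x - E n (Y n)) / \<sigma> n)"
  show "weak_conv_m (\<lambda>n. distr (M n) borel (\<lambda>x. (Y n x - measure_pmf.expectation (M n) (Y n)) /
       sqrt (measure_pmf.variance (M n) (Y n)))) std_normal_distribution"
  proof (rule levy_continuity)
    show "real_distribution (distr (M n) borel (\<lambda>x. (Y n x - measure_pmf.expectation (M n) (Y n)) /
       sqrt (measure_pmf.variance (M n) (Y n))))" for n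
      by (rule prob_space.real_distribution_distr[OF measure_pmf.prob_space_axioms]) simp
    show "real_distribution std_normal_distribution" by (rule real_dist_normal_dist)
    fix t :: real
    have lim: "(\<lambda>n. measure_pmf.expectation (M n) (\<lambda>x. iexp (t * Z n x)) -
       measure_pmf.expectation (M n) (\<lambda>x. iexp (- t * ((X n x - l n) / sqrt (l n))))) \<longlonglongrightarrow> 0"
    proof (rule Lim_null_comparison)
      show "(\<lambda>n. \<bar>t\<bar> * (\<bar>1 - sqrt (l n) / \<sigma> n / 2\<bar> * ((1 + v n) / 2) + \<epsilon> n * (sqrt (l n) / \<sigma> n))) \<longlonglongrightarrow> 0"
        by (rule tendsto_eq_intros eps0 v ratio refl | simp)+
      show "\<forall>\<^sub>F n in sequentially. norm (measure_pmf.expectation (M n) (\<lambda>x. iexp (t * Z n x)) -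
       measure_pmf.expectation (M n) (\<lambda>x. iexp (- t * ((X n x - l n) / sqrt (l n))))) \<le>
        \<bar>t\<bar> * (\<bar>1 - sqrt (l n) / \<sigma> n / 2\<bar> * ((1 + v n) / 2) + \<epsilon> n * (sqrt (l n) / \<sigma> n))"
        using pos
      proof eventually_elim
        case (elim n)
        \<comment> \<open>This ratio tends to 2, since the standard deviation of \<open>Y\<close> is
          asymptotically half of \<open>sqrt (l n)\<close>; hence the coefficient
          \<open>1 - r / 2\<close> of \<open>D\<close> disappears in the limit.\<close>
        define r where "r = sqrt (l n) / \<sigma> n"
        have r0: "0 \<le> r" using elim by (simp add: r_def \<sigma>_def V_def)
        have "norm (measure_pmf.expectation (M n) (\<lambda>x. iexp (t * Z n x)) -
         measure_pmf.expectation (M n) (\<lambda>x. iexp (- t * ((X n x - l n) / sqrt (l n))))) =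
          norm (measure_pmf.expectation (M n) (\<lambda>x. iexp (t * Z n x) - iexp (- t * ((X n x - l n) / sqrt (l n)))))"
          by (subst Bochner_Integration.integral_diff) simp_all
        also have "\<dots> \<le> measure_pmf.expectation (M n) (\<lambda>x. norm (iexp (t * Z n x) - iexp (- t * ((X n x - l n) / sqrt (l n)))))"
          by (rule integral_norm_bound)
        also have "\<dots> \<le> measure_pmf.expectation (M n) (\<lambda>x. \<bar>t\<bar> * (\<bar>1 - r / 2\<bar> / sqrt (l n) * \<bar>D n x\<bar> + r / sqrt (l n) * \<bar>S n x\<bar>))"
        proof (rule integral_mono_AE)
          show "AE x in M n. norm (iexp (t * Z n x) - iexp (- t * ((X n x - l n) / sqrt (l n)))) \<le>
             \<bar>t\<bar> * (\<bar>1 - r / 2\<bar> / sqrt (l n) * \<bar>D n x\<bar> + r / sqrt (l n) * \<bar>S n x\<bar>)"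
            unfolding AE_measure_pmf_iff
          proof
            fix x assume x: "x \<in> set_pmf (M n)"
            have "norm (iexp (t * Z n x) - iexp (- t * ((X n x - l n) / sqrt (l n)))) \<le>
              \<bar>t * Z n x - (- t * ((X n x - l n) / sqrt (l n)))\<bar>" by (rule iexp_diff_le)
            also have "t * Z n x - (- t * ((X n x - l n) / sqrt (l n))) =
               t * ((1 - r / 2) / sqrt (l n) * D n x + r / sqrt (l n) * S n x)"
            proof -
              \<comment> \<open>Valid also for \<open>\<sigma> n = 0\<close>, where division by zero
                makes both sides 0.\<close>
              have inv: "1 / \<sigma> n = r / sqrt (l n)" using elim by (simp add: r_def)
              have "Z n x = 1 / \<sigma> n * (S n x - D n x / 2)" by (simp add: Z_def Ydiff[OF x])
              then have Zeq: "Z n x = r / sqrt (l n) * (S n x - D n x / 2)" unfolding inv .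
              have Deq: "X n x - l n = D n x" by (simp add: D_def)
              have "t * (r / s * (a - b / 2)) - (- t * (b / s)) = t * ((1 - r / 2) / s * b + r / s * a)"
                if "s \<noteq> 0" for s a b
                using that by (simp add: field_simps)
              then show ?thesis unfolding Zeq Deq using elim by simp
            qed
            also have "\<bar>\<dots>\<bar> \<le> \<bar>t\<bar> * (\<bar>1 - r / 2\<bar> / sqrt (l n) * \<bar>D n x\<bar> + r / sqrt (l n) * \<bar>S n x\<bar>)"
              unfolding abs_mult
            proof (intro mult_left_mono)
              show "\<bar>(1 - r / 2) / sqrt (l n) * D n x + r / sqrt (l n) * S n x\<bar> \<le>
                \<bar>1 - r / 2\<bar> / sqrt (l n) * \<bar>D n x\<bar> + r / sqrt (l n) * \<bar>S n x\<bar>"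
                using abs_triangle_ineq[of "(1 - r / 2) / sqrt (l n) * D n x" "r / sqrt (l n) * S n x"] r0 elim
                by (simp add: abs_mult)
            qed simp
            finally show "norm (iexp (t * Z n x) - iexp (- t * ((X n x - l n) / sqrt (l n)))) \<le>
             \<bar>t\<bar> * (\<bar>1 - r / 2\<bar> / sqrt (l n) * \<bar>D n x\<bar> + r / sqrt (l n) * \<bar>S n x\<bar>)" .
          qed
        qed simp_all
        also have "\<dots> = E n (\<lambda>x. \<bar>t\<bar> * (\<bar>1 - r / 2\<bar> / sqrt (l n) * \<bar>D n x\<bar> + r / sqrt (l n) * \<bar>S n x\<bar>))"
          by (simp add: E_def)
        also have "\<dots> = \<bar>t\<bar> * (\<bar>1 - r / 2\<bar> / sqrt (l n) * E n (\<lambda>x. \<bar>D n x\<bar>) + r / sqrt (l n) * E n (\<lambda>x. \<bar>S n x\<bar>))"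
          unfolding mult add ..
        also have "\<dots> = \<bar>t\<bar> * (\<bar>1 - r / 2\<bar> * (E n (\<lambda>x. \<bar>D n x\<bar>) / sqrt (l n)) + r * (E n (\<lambda>x. \<bar>S n x\<bar>) / sqrt (l n)))" by simp
        also have "\<dots> \<le> \<bar>t\<bar> * (\<bar>1 - r / 2\<bar> * ((1 + v n) / 2) + r * \<epsilon> n)"
          by (intro mult_left_mono add_mono absD[OF elim] absS[OF elim] r0) auto
        finally show ?case by (simp add: r_def mult.commute)
      qed
    qed
    \<comment> \<open>\<open>X\<close> enters \<open>Y\<close> with a negative sign, hence the
      argument \<open>- t\<close>; the normal limit is even in \<open>t\<close>.\<close>
    have "(\<lambda>n. measure_pmf.expectation (M n) (\<lambda>x. iexp (t * Z n x))) \<longlonglongrightarrow> exp (- (t\<^sup>2 / 2))"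
      using tendsto_add[OF lim char[of "- t"]] by simp
    then show "(\<lambda>n. char (distr (M n) borel (\<lambda>x. (Y n x - measure_pmf.expectation (M n) (Y n)) /
       sqrt (measure_pmf.variance (M n) (Y n)))) t) \<longlonglongrightarrow> char std_normal_distribution t"
      unfolding char_std_normal_distribution
      by (simp add: char_def integral_distr Z_def E_def \<sigma>_def V_def exp_of_real)
  qed
qed

section \<open>Asymptotics\<close>

lemma real_choose_3: "real (n choose 3) = real n * (real n - 1) * (real n - 2) / 6"
  by (simp add: binomial_gbinomial gbinomial_prod_rev numeral_3_eq_3 fact_numeral atLeast0_lessThan_Suc mult_ac)

locale sparse_complement =
  fixes q :: "nat \<Rightarrow> real"
  assumes q: "\<And>n. 0 \<le> q n" "\<And>n. q n \<le> 1"
    and lower: "(\<lambda>n. ln (real n) / real n) \<in> o(q)"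
    and upper: "q \<in> o(\<lambda>n. real n powr (- 7 / 9))"
begin

lemma eventually_ln_le:
  assumes "0 < K"
  shows "\<forall>\<^sub>F n in sequentially. K * ln (real n) \<le> real n * q n"
proof -
  have "\<forall>\<^sub>F n in sequentially. norm (ln (real n) / real n) \<le> 1 / K * norm (q n)"
    by (rule landau_o.smallD[OF lower]) (use assms in simp)
  then show ?thesis
    using eventually_gt_at_top[of 0]
  proof eventually_elim
    case (elim n)
    then have "\<bar>ln (real n)\<bar> * K \<le> \<bar>q n\<bar> * real n" using assms by (simp add: field_simps)
    moreover have "ln (real n) * K \<le> \<bar>ln (real n)\<bar> * K" using assms by (intro mult_right_mono) auto
    ultimately show ?case using q(1)[of n] by (simp add: mult_ac)
  qed
qed

lemma mean_degree_at_top: "filterlim (\<lambda>n. real n * q n) at_top sequentially"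
proof (rule filterlim_at_top_mono)
  show "filterlim (\<lambda>n. ln (real n)) at_top sequentially" by real_asymp
  show "\<forall>\<^sub>F n in sequentially. ln (real n) \<le> real n * q n" using eventually_ln_le[of 1] by simp
qed

text \<open>The monomial is at most the \<open>b\<close>-th power of n^(7/9) q, which itself tends
  to 0, so equality of the exponents is allowed; the critical n^7 q^9 is such a case.\<close>

lemma monomial_tendsto_0:
  assumes "0 < b" "9 * a \<le> 7 * b"
  shows "(\<lambda>n. real n ^ a * q n ^ b) \<longlonglongrightarrow> 0"
proof (rule Lim_null_comparison)
  have "(\<lambda>n. (q n / real n powr (- 7 / 9)) ^ b) \<longlonglongrightarrow> 0 ^ b"
    by (intro tendsto_power smalloD_tendsto upper)
  then show "(\<lambda>n. (q n / real n powr (- 7 / 9)) ^ b) \<longlonglongrightarrow> 0" using assms by (simp add: zero_power)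
  show "\<forall>\<^sub>F n in sequentially. norm (real n ^ a * q n ^ b) \<le> (q n / real n powr (- 7 / 9)) ^ b"
    using eventually_gt_at_top[of 0]
  proof eventually_elim
    case (elim n)
    have "real n ^ a = real n powr a" using elim by (simp add: powr_realpow)
    also have "\<dots> \<le> real n powr (7 / 9 * b)" using assms elim by (intro powr_mono) auto
    also have "\<dots> = (real n powr (7 / 9)) ^ b"
      by (subst powr_power) (use elim in \<open>simp_all add: mult.commute\<close>)
    finally have "real n ^ a * q n ^ b \<le> (real n powr (7 / 9)) ^ b * q n ^ b"
      using q by (intro mult_right_mono) auto
    also have "\<dots> = (q n / real n powr (- 7 / 9)) ^ b"
    proof -
      have "q n / real n powr (- 7 / 9) = real n powr (7 / 9) * q n"
        using powr_minus_divide[of "real n" "7 / 9"] by simp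
      then show ?thesis by (simp only: power_mult_distrib)
    qed
    finally show ?case using q by simp
  qed
qed

lemma cube_at_top: "filterlim (\<lambda>n. real n ^ 3 * q n ^ 3) at_top sequentially"
  unfolding power_mult_distrib[symmetric] using mean_degree_at_top by (intro filterlim_pow_at_top) auto

definition "lam n = real (n choose 3) * q n ^ 3"

lemma lam_ratio: "(\<lambda>n. lam n / (real n ^ 3 * q n ^ 3)) \<longlonglongrightarrow> 1 / 6"
proof -
  have "(\<lambda>n. real n * (real n - 1) * (real n - 2) / 6 / real n ^ 3) \<longlonglongrightarrow> 1 / 6" by real_asymp
  moreover have "\<forall>\<^sub>F n in sequentially. real n * (real n - 1) * (real n - 2) / 6 / real n ^ 3 = lam n / (real n ^ 3 * q n ^ 3)"
    using filterlim_at_top_dense[THEN iffD1, OF mean_degree_at_top, rule_format, of 0]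
    by eventually_elim (auto simp: lam_def real_choose_3)
  ultimately show ?thesis by (rule Lim_transform_eventually)
qed

lemma lam_at_top: "filterlim lam at_top sequentially"
proof -
  have "filterlim (\<lambda>n. lam n / (real n ^ 3 * q n ^ 3) * (real n ^ 3 * q n ^ 3)) at_top sequentially"
    by (rule filterlim_tendsto_pos_mult_at_top[OF lam_ratio _ cube_at_top]) simp
  moreover have "\<forall>\<^sub>F n in sequentially. lam n / (real n ^ 3 * q n ^ 3) * (real n ^ 3 * q n ^ 3) = lam n"
    using filterlim_at_top_dense[THEN iffD1, OF mean_degree_at_top, rule_format, of 0]
    by eventually_elim auto
  ultimately show ?thesis by (simp cong: filterlim_cong)
qed

lemma eventually_mean_degree_ge: "\<forall>\<^sub>F n in sequentially. K \<le> real n * q n"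
  using mean_degree_at_top by (simp add: filterlim_at_top)

text \<open>The factor n^6 comes from \<open>chi_defect_le\<close>, and each of the five summands of
  \<open>prob_not_good_graph_le\<close> contributes at most 1. With \<open>k = 72\<close> the
  adjacency term is n^223 q^288, and 9 * 223 is at most 7 * 288. The choice of \<open>d\<close> uses
  half of the threshold \<open>n * q / 20\<close>, leaving the other half for \<open>3 * 72\<close>;
  \<open>n div 4000\<close> is small enough for \<open>48 * m * q \<le> d\<close> and large enough
  for \<open>q * m\<^sup>2\<close> to exceed \<open>3 * n\<close>.\<close>

lemma eventually_prob_not_good_le:
  "\<forall>\<^sub>F n in sequentially. real n ^ 6 * measure_pmf.prob (random_subset (Kn_edges n) (q n))
     {S. \<not> good_graph n (nat \<lfloor>real n * q n / 40\<rfloor>) 72 (n div 4000) S} \<le> 5"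
proof -
  have lim: "(\<lambda>n. real n ^ 223 * q n ^ 288) \<longlonglongrightarrow> 0" by (rule monomial_tendsto_0) auto
  have lim': "(\<lambda>n. (real n)\<^sup>2 * q n ^ 3) \<longlonglongrightarrow> 0" by (rule monomial_tendsto_0) auto
  have "\<forall>\<^sub>F n in sequentially. real n ^ 223 * q n ^ 288 < 1" by (rule order_tendstoD(2)[OF lim]) simp
  moreover have "\<forall>\<^sub>F n in sequentially. (real n)\<^sup>2 * q n ^ 3 < 1 / 36" by (rule order_tendstoD(2)[OF lim']) simp
  moreover have "\<forall>\<^sub>F n in sequentially. real n ^ 6 * exp (- real n) \<le> 1" by real_asymp
  moreover have "\<forall>\<^sub>F n in sequentially. real n ^ 6 * exp (- real n / 24) \<le> 1" by real_asymp
  moreover have "\<forall>\<^sub>F n in sequentially. 1 \<le> ln (real n)" by real_asymp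
  \<comment> \<open>\<open>440\<close> gives d at least 11 ln n - 1, hence at least 10 ln n. The
    bound \<open>8000\<close> ensures \<open>n / 8000 \<le> m\<close>, and then
    \<open>2 * 10 ^ 8\<close> gives \<open>3 * n \<le> q * m\<^sup>2\<close>, which beats 4^n, at
    most exp (2 n).\<close>
  moreover note eventually_ln_le[of 440, simplified] eventually_mean_degree_ge[of "2 * 10 ^ 8"]
    eventually_ge_at_top[of "8000 :: nat"]
  ultimately show ?thesis
  proof eventually_elim
    case (elim n)
    define d where "d = nat \<lfloor>real n * q n / 40\<rfloor>"
    define m where "m = n div 4000"
    have nq: "440 * ln (real n) \<le> real n * q n" "2 * 10 ^ 8 \<le> real n * q n" and n: "8000 \<le> n" "1 \<le> ln (real n)"
      using elim by auto
    have d: "real d \<le> real n * q n / 40" "real n * q n / 40 - 1 \<le> real d"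
      using nq by (auto simp: d_def) linarith+
    have d10: "10 * ln (real n) \<le> real d" using d nq n by linarith
    have m: "real m \<le> real n / 4000" "real n / 8000 \<le> real m"
    proof -
      have "real n \<le> 4000 * real m + 3999" unfolding m_def by linarith
      then show "real n / 8000 \<le> real m" using n by simp
      show "real m \<le> real n / 4000" unfolding m_def by linarith
    qed
    have expln: "exp (- (10 * ln (real n))) = 1 / real n ^ 10"
    proof -
      have "exp (10 * ln (real n)) = real n ^ 10"
        using exp_of_nat_mult[of 10 "ln (real n)"] n by simp
      then show ?thesis by (simp add: exp_minus inverse_eq_divide)
    qed
    have e1: "exp (- (real n * q n / 20)) \<le> 1 / real n ^ 10"
      unfolding expln[symmetric] using nq n by simp
    have e2: "exp (- real d) \<le> 1 / real n ^ 10"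
      unfolding expln[symmetric] using d10 by simp
    have mq: "48 * real m * q n \<le> real d"
    proof -
      have "48 * real m * q n \<le> 48 * (real n / 4000) * q n" using m q by (intro mult_right_mono mult_left_mono) auto
      then show ?thesis using d nq by simp
    qed
    have P: "measure_pmf.prob (random_subset (Kn_edges n) (q n)) {S. \<not> good_graph n d 72 m S} \<le>
      2 * real n * exp (- (real n * q n / 20)) + (real n)\<^sup>2 * exp (- real d) +
      4 ^ n * exp (- q n * (real m)\<^sup>2) + real n * (real n ^ 3 * q n ^ 4) ^ 72 + exp (- real n / 24)"
    proof (rule prob_not_good_graph_le[OF q])
      show "real n * exp (- real d) \<le> 1"
      proof -
        have "real n * exp (- real d) \<le> real n * (1 / real n ^ 10)" by (intro mult_left_mono e2) simp
        also have "\<dots> = 1 / real n ^ 9" using n power_Suc[of "real n" 9] by simp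
        also have "\<dots> \<le> 1" using n by (simp add: one_le_power)
        finally show ?thesis .
      qed
      show "0 < d" using d nq by (cases "d = 0") auto
    qed (use n d nq mq m elim in \<open>auto simp: m_def\<close>)
    have t1: "real n ^ 6 * (2 * real n * exp (- (real n * q n / 20))) \<le> 1"
    proof -
      have "real n ^ 6 * (2 * real n * exp (- (real n * q n / 20))) \<le> real n ^ 6 * (2 * real n * (1 / real n ^ 10))"
        by (intro mult_left_mono e1) auto
      also have "\<dots> = real n ^ 6 * (2 * real n) / real n ^ 10" by simp
      also have "\<dots> \<le> 1"
      proof -
        have "2 * real n \<le> real n * real n" using n by (intro mult_right_mono) auto
        also have "\<dots> \<le> real n ^ 4"
          using n power_increasing[of 2 4 "real n"] by (simp add: power2_eq_square)
        finally have "real n ^ 6 * (2 * real n) \<le> real n ^ 6 * real n ^ 4" by (intro mult_left_mono) auto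
        also have "\<dots> = real n ^ 10" by (simp flip: power_add)
        finally show ?thesis using n by (simp add: divide_le_eq_1)
      qed
      finally show ?thesis .
    qed
    have t2: "real n ^ 6 * ((real n)\<^sup>2 * exp (- real d)) \<le> 1"
    proof -
      have "real n ^ 6 * ((real n)\<^sup>2 * exp (- real d)) \<le> real n ^ 6 * ((real n)\<^sup>2 * (1 / real n ^ 10))"
        by (intro mult_left_mono e2) auto
      also have "\<dots> = (real n ^ 6 * (real n)\<^sup>2) / real n ^ 10" by simp
      also have "real n ^ 6 * (real n)\<^sup>2 = real n ^ 8" by (simp flip: power_add)
      also have "real n ^ 8 / real n ^ 10 \<le> 1"
        using n power_increasing[of 8 10 "real n"] by (simp only: divide_le_eq_1) simp
      finally show ?thesis .
    qed
    have t3: "real n ^ 6 * (4 ^ n * exp (- q n * (real m)\<^sup>2)) \<le> 1"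
    proof -
      have "(4 :: real) \<le> exp 2"
        using exp_ge_add_one_self[of 1] mult_mono[of 2 "exp 1 :: real" 2 "exp 1 :: real"] by (simp flip: exp_add)
      then have "(4 :: real) ^ n \<le> exp 2 ^ n" by (intro power_mono) auto
      also have "\<dots> = exp (2 * real n)" by (simp add: mult.commute flip: exp_of_nat_mult)
      finally have four: "(4 :: real) ^ n \<le> exp (2 * real n)" .
      have "3 * real n \<le> (real n * q n) * (real n / 64000000)" using nq n mult_right_mono[OF nq(2), of "real n / 64000000"] by simp
      also have "\<dots> = q n * (real n / 8000)\<^sup>2" by (simp add: power2_eq_square)
      also have "\<dots> \<le> q n * (real m)\<^sup>2" using m q by (intro mult_left_mono power_mono) auto
      finally have "exp (- q n * (real m)\<^sup>2) \<le> exp (- 3 * real n)" by simp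
      then have "4 ^ n * exp (- q n * (real m)\<^sup>2) \<le> exp (2 * real n) * exp (- 3 * real n)"
        using four by (intro mult_mono) auto
      also have "\<dots> = exp (- real n)" by (simp flip: exp_add)
      finally have "real n ^ 6 * (4 ^ n * exp (- q n * (real m)\<^sup>2)) \<le> real n ^ 6 * exp (- real n)"
        by (intro mult_left_mono) auto
      then show ?thesis using elim by linarith
    qed
    have t4: "real n ^ 6 * (real n * (real n ^ 3 * q n ^ 4) ^ 72) \<le> 1"
    proof -
      have "x ^ 6 * (x * (x ^ 3 * y ^ 4) ^ 72) = x ^ 223 * y ^ 288" for x y :: real
      proof -
        have "x ^ 223 = x ^ 6 * (x * x ^ 216)" by (simp flip: power_Suc power_add)
        moreover have "(x ^ 3 * y ^ 4) ^ 72 = x ^ 216 * y ^ 288"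
          using power_mult[of x 3 72] power_mult[of y 4 72] by (simp add: power_mult_distrib)
        ultimately show ?thesis by simp
      qed
      then have "real n ^ 6 * (real n * (real n ^ 3 * q n ^ 4) ^ 72) = real n ^ 223 * q n ^ 288" .
      then show ?thesis using elim by simp
    qed
    have "real n ^ 6 * measure_pmf.prob (random_subset (Kn_edges n) (q n)) {S. \<not> good_graph n d 72 m S} \<le>
      real n ^ 6 * (2 * real n * exp (- (real n * q n / 20)) + (real n)\<^sup>2 * exp (- real d) +
      4 ^ n * exp (- q n * (real m)\<^sup>2) + real n * (real n ^ 3 * q n ^ 4) ^ 72 + exp (- real n / 24))"
      by (intro mult_left_mono P) simp
    also have "\<dots> \<le> 5" unfolding distrib_left using t1 t2 t3 t4 elim by linarith
    finally show ?case by (simp add: d_def m_def)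
  qed
qed

text \<open>After division by n^3 q^3, the squares of \<open>a\<close> (bowties) and
  \<open>b\<close> (diamonds) become n^7 q^9 and n^5 q^7; all other contributions are absorbed by
  these squares or by a constant, which vanishes against the growing mean.\<close>

lemma chi_defect_square_tendsto_0:
  "(\<lambda>n. measure_pmf.expectation (random_subset (Kn_edges n) (q n)) (\<lambda>S. (chi_defect n S)\<^sup>2) / lam n) \<longlonglongrightarrow> 0"
proof -
  let ?E = "\<lambda>n. measure_pmf.expectation (random_subset (Kn_edges n) (q n)) (\<lambda>S. (chi_defect n S)\<^sup>2)"
  let ?L = "\<lambda>n. real n ^ 3 * q n ^ 3"
  \<comment> \<open>\<open>22\<close> collects 2 from the good graphs and \<open>4 * 5\<close> from
    the others; \<open>100500\<^sup>2\<close> pays for absorbing \<open>100500 * (a + b)\<close>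
    into the squares of \<open>a\<close> and \<open>b\<close>.\<close>
  define C where "C = 100500\<^sup>2 + (22 :: real)"
  have lims: "(\<lambda>n. real n ^ 7 * q n ^ 9) \<longlonglongrightarrow> 0" "(\<lambda>n. real n ^ 5 * q n ^ 7) \<longlonglongrightarrow> 0"
    "(\<lambda>n. real n ^ 1 * q n ^ 2) \<longlonglongrightarrow> 0" "(\<lambda>n. real n ^ 2 * q n ^ 3) \<longlonglongrightarrow> 0"
    by (rule monomial_tendsto_0; simp)+
  have "(\<lambda>n. ?E n / ?L n) \<longlonglongrightarrow> 0"
  proof (rule Lim_null_comparison)
    have "(\<lambda>n. C / ?L n) \<longlonglongrightarrow> 0"
      by (intro tendsto_divide_0[OF tendsto_const] filterlim_at_top_imp_at_infinity cube_at_top)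
    from tendsto_add[OF tendsto_add[OF tendsto_mult_right_zero[OF lims(1), of 6] tendsto_mult_right_zero[OF lims(2), of 6]] this]
    show "(\<lambda>n. 6 * (real n ^ 7 * q n ^ 9) + 6 * (real n ^ 5 * q n ^ 7) + C / ?L n) \<longlonglongrightarrow> 0" by simp
    have "\<forall>\<^sub>F n in sequentially. real n ^ 1 * q n ^ 2 < 1" by (rule order_tendstoD(2)[OF lims(3)]) simp
    moreover have "\<forall>\<^sub>F n in sequentially. real n ^ 2 * q n ^ 3 < 1" by (rule order_tendstoD(2)[OF lims(4)]) simp
    moreover note eventually_prob_not_good_le eventually_gt_at_top[of 0] eventually_mean_degree_ge[of 1]
    ultimately show "\<forall>\<^sub>F n in sequentially. norm (?E n / ?L n) \<le> 6 * (real n ^ 7 * q n ^ 9) + 6 * (real n ^ 5 * q n ^ 7) + C / ?L n"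
    proof eventually_elim
      case (elim n)
      define a b where "a = real n ^ 5 * q n ^ 6" and "b = real n ^ 4 * q n ^ 5"
      have Lpos: "0 < ?L n" using elim by (simp flip: power_mult_distrib)
      have T: "measure_pmf.expectation (random_subset (Kn_edges n) (q n)) (\<lambda>S. (real (card (touching_pairs {1..n} S)))\<^sup>2) \<le>
        (a + b) * (2 * a + b + 100500)"
        using expectation_touching_pairs_square_le'[OF _ q, of "{1..n}" n] elim by (simp add: a_def b_def mult.assoc)
      have "?E n \<le> (a + b) * (2 * a + b + 100500) + 2 + 4 * 5"
        using expectation_chi_defect_square_le[OF q elim(4), of n "nat \<lfloor>real n * q n / 40\<rfloor>" 72 "n div 4000"] T elim(3)
        by linarith
      also have "\<dots> \<le> 6 * a\<^sup>2 + 6 * b\<^sup>2 + C"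
      proof -
        have "0 \<le> (a - b)\<^sup>2" "0 \<le> (a + b - 100500)\<^sup>2" by simp_all
        then have "2 * (a * b) \<le> a * a + b * b" "201000 * (a + b) \<le> a * a + b * b + 2 * (a * b) + 100500\<^sup>2"
          by (simp_all add: power2_eq_square algebra_simps)
        moreover have "(a + b) * (2 * a + b + 100500) = 2 * (a * a) + 3 * (a * b) + b * b + 100500 * (a + b)"
          by (simp add: algebra_simps)
        moreover have "0 \<le> a * a" "0 \<le> b * b" by simp_all
        moreover have "(100500 :: real)\<^sup>2 = 10100250000" by simp
        moreover have "C = 10100250022" by (simp add: C_def)
        ultimately show ?thesis unfolding power2_eq_square[of a] power2_eq_square[of b] by linarith
      qed
      also have "a\<^sup>2 = (real n ^ 7 * q n ^ 9) * ?L n"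
      proof -
        have "(x ^ 5 * y ^ 6)\<^sup>2 = (x ^ 7 * y ^ 9) * (x ^ 3 * y ^ 3)" for x y :: real
        proof -
          have "x ^ 7 * x ^ 3 = (x ^ 5)\<^sup>2" "y ^ 9 * y ^ 3 = (y ^ 6)\<^sup>2" by (simp_all flip: power_add power_mult)
          then show ?thesis by (simp only: power_mult_distrib mult_ac) (metis mult.assoc mult.commute)
        qed
        then show ?thesis by (simp only: a_def)
      qed
      also have "b\<^sup>2 = (real n ^ 5 * q n ^ 7) * ?L n"
      proof -
        have "(x ^ 4 * y ^ 5)\<^sup>2 = (x ^ 5 * y ^ 7) * (x ^ 3 * y ^ 3)" for x y :: real
        proof -
          have "x ^ 5 * x ^ 3 = (x ^ 4)\<^sup>2" "y ^ 7 * y ^ 3 = (y ^ 5)\<^sup>2" by (simp_all flip: power_add power_mult)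
          then show ?thesis by (simp only: power_mult_distrib mult_ac) (metis mult.assoc mult.commute)
        qed
        then show ?thesis by (simp only: b_def)
      qed
      finally have "?E n / ?L n \<le> (6 * ((real n ^ 7 * q n ^ 9) * ?L n) + 6 * ((real n ^ 5 * q n ^ 7) * ?L n) + C) / ?L n"
        using Lpos by (intro divide_right_mono) auto
      also have "\<dots> = 6 * (real n ^ 7 * q n ^ 9) + 6 * (real n ^ 5 * q n ^ 7) + C / ?L n"
      proof -
        have "(6 * (x * u) + 6 * (y * u) + C) / u = 6 * x + 6 * y + C / u" if "0 < u" for x y u
          using that by (simp add: field_simps)
        then show ?thesis using Lpos .
      qed
      finally show ?case using Lpos by (simp add: abs_of_nonneg)
    qed
  qed
  from tendsto_divide[OF this lam_ratio]
  have "(\<lambda>n. (?E n / ?L n) / (lam n / ?L n)) \<longlonglongrightarrow> 0" by simp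
  moreover have "\<forall>\<^sub>F n in sequentially. (?E n / ?L n) / (lam n / ?L n) = ?E n / lam n"
    using eventually_mean_degree_ge[of 1] by eventually_elim auto
  ultimately show ?thesis by (rule Lim_transform_eventually)
qed

end

section \<open>Limits for the triangle count and their transfer to the chromatic number\<close>

context sparse_complement
begin

lemma coupling_error_tendsto_0: "(\<lambda>n. coupling_error {1..n} (q n)) \<longlonglongrightarrow> 0"
proof -
  have "(\<lambda>n. real n ^ 0 * q n ^ 3 + 3 * (real n ^ 1 * q n ^ 2)) \<longlonglongrightarrow> 0 + 3 * 0"
    by (intro tendsto_add tendsto_mult tendsto_const monomial_tendsto_0) auto
  then show ?thesis by (simp add: coupling_error_def[OF _ q] mult.assoc)
qed

lemma triangles_mean:
  "measure_pmf.expectation (random_subset (Kn_edges n) (q n)) (\<lambda>S. real (card (triangles {1..n} S))) = lam n"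
  using expectation_triangles[OF finite_atLeastAtMost q, of 1 n n] by (simp add: lam_def)

lemma triangles_variance:
  "(\<lambda>n. measure_pmf.expectation (random_subset (Kn_edges n) (q n))
     (\<lambda>S. (real (card (triangles {1..n} S)) - lam n)\<^sup>2) / lam n) \<longlonglongrightarrow> 1"
proof -
  let ?E = "\<lambda>n. measure_pmf.expectation (random_subset (Kn_edges n) (q n))"
  let ?X = "\<lambda>n S. real (card (triangles {1..n} S))"
  have int [simp]: "integrable (random_subset (Kn_edges n) (q n)) f" for n and f :: "nat set set \<Rightarrow> real"
    by (rule integrable_random_subset[OF finite_Kn_edges])
  have "(\<lambda>n. ?E n (\<lambda>S. (?X n S - lam n)\<^sup>2) / lam n - 1) \<longlonglongrightarrow> 0"
  proof (rule Lim_null_comparison[OF _ coupling_error_tendsto_0])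
    show "\<forall>\<^sub>F n in sequentially. norm (?E n (\<lambda>S. (?X n S - lam n)\<^sup>2) / lam n - 1) \<le> coupling_error {1..n} (q n)"
      using filterlim_at_top_dense[THEN iffD1, OF lam_at_top, rule_format, of 0]
    proof eventually_elim
      case (elim n)
      have "?E n (\<lambda>S. (?X n S - lam n)\<^sup>2) = ?E n (\<lambda>S. (?X n S)\<^sup>2 - (2 * lam n) * ?X n S + (lam n)\<^sup>2)"
        by (intro arg_cong[where f="?E n"]) (simp add: fun_eq_iff power2_diff algebra_simps)
      also have "\<dots> = ?E n (\<lambda>S. (?X n S)\<^sup>2) - 2 * lam n * lam n + (lam n)\<^sup>2"
        unfolding Bochner_Integration.integral_add[OF int int] Bochner_Integration.integral_diff[OF int int]
          integral_mult_right_zero triangles_mean by simp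
      finally have "?E n (\<lambda>S. (?X n S - lam n)\<^sup>2) - lam n = ?E n (\<lambda>S. (?X n S)\<^sup>2) - ((lam n)\<^sup>2 + lam n)"
        by (simp add: power2_eq_square)
      moreover have "\<bar>?E n (\<lambda>S. (?X n S)\<^sup>2) - ((lam n)\<^sup>2 + lam n)\<bar> \<le> lam n * coupling_error {1..n} (q n)"
        using expectation_triangles_square_bounds[OF finite_atLeastAtMost q, of 1 n n] by (simp add: lam_def)
      moreover have "?E n (\<lambda>S. (?X n S - lam n)\<^sup>2) / lam n - 1 = (?E n (\<lambda>S. (?X n S - lam n)\<^sup>2) - lam n) / lam n"
        using elim by (simp add: diff_divide_distrib)
      ultimately show ?case using elim by (simp add: abs_divide pos_divide_le_eq mult.commute)
    qed
  qed
  from tendsto_add[OF this tendsto_const[of 1]] show ?thesis by simp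
qed

text \<open>At \<open>s = t / sqrt (lam n)\<close> the product \<open>lam n * s\<^sup>2\<close>
  equals \<open>t\<^sup>2\<close>, so the error of \<open>triangles_char_approx\<close> is a
  constant times \<open>coupling_error\<close> although the mean grows. Centring only multiplies by
  a factor of modulus 1.\<close>

lemma triangles_char_limit:
  "(\<lambda>n. measure_pmf.expectation (random_subset (Kn_edges n) (q n))
     (\<lambda>S. iexp (t * ((real (card (triangles {1..n} S)) - lam n) / sqrt (lam n))))) \<longlonglongrightarrow> exp (- (t\<^sup>2 / 2))"
proof -
  let ?E = "\<lambda>n. measure_pmf.expectation (random_subset (Kn_edges n) (q n))"
  let ?X = "\<lambda>n S. real (card (triangles {1..n} S))"
  let ?f = "\<lambda>n. exp (lam n * (iexp (t / sqrt (lam n)) - 1) - \<i> * t * sqrt (lam n)) :: complex"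
  have "(\<lambda>n. ?E n (\<lambda>S. iexp (t * ((?X n S - lam n) / sqrt (lam n)))) - ?f n) \<longlonglongrightarrow> 0"
  proof (rule Lim_null_comparison)
    show "(\<lambda>n. t\<^sup>2 * exp (t\<^sup>2 / 2) * coupling_error {1..n} (q n)) \<longlonglongrightarrow> 0"
      by (rule tendsto_mult_right_zero[OF coupling_error_tendsto_0])
    show "\<forall>\<^sub>F n in sequentially. norm (?E n (\<lambda>S. iexp (t * ((?X n S - lam n) / sqrt (lam n)))) - ?f n) \<le>
       t\<^sup>2 * exp (t\<^sup>2 / 2) * coupling_error {1..n} (q n)"
      using filterlim_at_top_dense[THEN iffD1, OF lam_at_top, rule_format, of 0]
    proof eventually_elim
      case (elim n)
      define s where "s = t / sqrt (lam n)"
      have s: "s * lam n = t * sqrt (lam n)" "lam n * s\<^sup>2 = t\<^sup>2"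
      proof -
        have "s * lam n = t * (lam n / sqrt (lam n))" by (simp add: s_def)
        then show "s * lam n = t * sqrt (lam n)" using elim by (simp only: real_div_sqrt less_imp_le)
        show "lam n * s\<^sup>2 = t\<^sup>2" using elim by (simp add: s_def power_divide)
      qed
      have split: "iexp (- (t * u) + w) = exp (- (\<i> * t * u)) * iexp w" for u w :: real
        unfolding mult_exp_exp by (simp add: algebra_simps)
      have "iexp (t * ((?X n S - lam n) / sqrt (lam n))) = exp (- (\<i> * t * sqrt (lam n))) * iexp (s * ?X n S)" for S
      proof -
        have "t * ((?X n S - lam n) / sqrt (lam n)) = - (t * sqrt (lam n)) + s * ?X n S"
          unfolding s(1)[symmetric] by (simp add: s_def algebra_simps diff_divide_distrib)
        then show ?thesis by (simp only: split)
      qed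
      then have A: "?E n (\<lambda>S. iexp (t * ((?X n S - lam n) / sqrt (lam n)))) =
          exp (- (\<i> * t * sqrt (lam n))) * ?E n (\<lambda>S. iexp (s * ?X n S))" by simp
      have B: "?f n = exp (- (\<i> * t * sqrt (lam n))) * exp (lam n * (iexp s - 1))"
        unfolding s_def[symmetric] by (simp add: mult_exp_exp)
      have "norm (?E n (\<lambda>S. iexp (t * ((?X n S - lam n) / sqrt (lam n)))) - ?f n) =
          norm (exp (- (\<i> * t * sqrt (lam n)))) * norm (?E n (\<lambda>S. iexp (s * ?X n S)) - exp (lam n * (iexp s - 1)))"
        unfolding A B right_diff_distrib[symmetric] norm_mult ..
      also have "norm (exp (- (\<i> * t * sqrt (lam n)))) = 1" by (simp add: norm_exp_eq_Re)
      also have "norm (?E n (\<lambda>S. iexp (s * ?X n S)) - exp (lam n * (iexp s - 1))) \<le>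
         lam n * s\<^sup>2 * coupling_error {1..n} (q n) * exp (lam n * s\<^sup>2 / 2)"
        using triangles_char_approx[OF finite_atLeastAtMost q, of 1 n n s] by (simp add: lam_def)
      finally show ?case by (simp add: s(2) mult_ac)
    qed
  qed
  from tendsto_add[OF this poisson_char_limit[OF lam_at_top, of t]]
  show ?thesis by (simp flip: exp_of_real)
qed

lemma chi_complement_limits:
  "(\<lambda>n. measure_pmf.variance (random_subset (Kn_edges n) (q n)) (\<lambda>S. chi n (Kn_edges n - S)) / lam n) \<longlonglongrightarrow> 1 / 4"
  "weak_conv_m (\<lambda>n. distr (random_subset (Kn_edges n) (q n)) borel
      (\<lambda>S. (chi n (Kn_edges n - S) - measure_pmf.expectation (random_subset (Kn_edges n) (q n)) (\<lambda>S. chi n (Kn_edges n - S))) /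
        sqrt (measure_pmf.variance (random_subset (Kn_edges n) (q n)) (\<lambda>S. chi n (Kn_edges n - S))))) std_normal_distribution"
proof -
  have Y: "chi n (Kn_edges n - S) = real n / 2 - real (card (triangles {1..n} S)) / 2 + chi_defect n S" for n S
    by (simp add: chi_defect_def field_simps)
  note lim = normal_limit_of_perturbation[where M="\<lambda>n. random_subset (Kn_edges n) (q n)"
      and X="\<lambda>n S. real (card (triangles {1..n} S))" and c="\<lambda>n. real n / 2" and R=chi_defect and l=lam
      and Y="\<lambda>n S. chi n (Kn_edges n - S)",
      OF finite_set_pmf_random_subset[OF finite_Kn_edges] lam_at_top Y triangles_mean triangles_variance
        chi_defect_square_tendsto_0 triangles_char_limit]
  show "(\<lambda>n. measure_pmf.variance (random_subset (Kn_edges n) (q n)) (\<lambda>S. chi n (Kn_edges n - S)) / lam n) \<longlonglongrightarrow> 1 / 4"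
    by (rule lim(1))
  show "weak_conv_m (\<lambda>n. distr (random_subset (Kn_edges n) (q n)) borel
      (\<lambda>S. (chi n (Kn_edges n - S) - measure_pmf.expectation (random_subset (Kn_edges n) (q n)) (\<lambda>S. chi n (Kn_edges n - S))) /
        sqrt (measure_pmf.variance (random_subset (Kn_edges n) (q n)) (\<lambda>S. chi n (Kn_edges n - S))))) std_normal_distribution"
    by (rule lim(2))
qed

end

theorem theorem1p4:
  fixes p :: "nat \<Rightarrow> real"
  assumes "\<And>n. 0 \<le> p n \<and> p n \<le> 1"
    and "(\<lambda>n. ln (real n) / real n) \<in> o(\<lambda>n. 1 - p n)"
    and "(\<lambda>n. 1 - p n) \<in> o(\<lambda>n. real n powr (- 7 / 9))"
  shows "weak_conv_m
           (\<lambda>n. distr (binomial_random_graph n (p n)) borel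
                  (\<lambda>E. (chi n E - mean_chi n (p n)) / sqrt (var_chi n (p n))))
           std_normal_distribution
         \<and> (\<lambda>n. var_chi n (p n)) \<in> \<Theta>(\<lambda>n. real n ^ 3 * (1 - p n) ^ 3)"
proof -
  define q where "q = (\<lambda>n. 1 - p n)"
  interpret sparse_complement q
    using assms by unfold_locales (auto simp: q_def)
  have G: "binomial_random_graph n (p n) = map_pmf (\<lambda>S. Kn_edges n - S) (random_subset (Kn_edges n) (q n))" for n
    using random_subset_complement[OF finite_Kn_edges q, of n n]
    by (simp add: binomial_random_graph_eq q_def)
  have mean: "mean_chi n (p n) = measure_pmf.expectation (random_subset (Kn_edges n) (q n)) (\<lambda>S. chi n (Kn_edges n - S))" for n
    by (simp add: mean_chi_def G)
  have var: "var_chi n (p n) = measure_pmf.variance (random_subset (Kn_edges n) (q n)) (\<lambda>S. chi n (Kn_edges n - S))" for n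
    by (simp add: var_chi_def G)
  have "distr (binomial_random_graph n (p n)) borel f = distr (random_subset (Kn_edges n) (q n)) borel (\<lambda>S. f (Kn_edges n - S))"
    for n and f :: "nat set set \<Rightarrow> real"
    by (simp add: G map_pmf_rep_eq distr_distr o_def)
  then have "weak_conv_m
           (\<lambda>n. distr (binomial_random_graph n (p n)) borel
                  (\<lambda>E. (chi n E - mean_chi n (p n)) / sqrt (var_chi n (p n))))
           std_normal_distribution"
    using chi_complement_limits(2) by (simp add: mean var)
  moreover have "(\<lambda>n. var_chi n (p n)) \<in> \<Theta>(\<lambda>n. real n ^ 3 * (1 - p n) ^ 3)"
  proof (rule bigthetaI_tendsto)
    \<comment> \<open>The limit 1/24 is the product of 1/4, from the factor 1/2 in front of the
      triangle count, and of 1/6, from the binomial coefficient in \<open>lam\<close>.\<close>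
    have "(\<lambda>n. var_chi n (p n) / lam n * (lam n / (real n ^ 3 * q n ^ 3))) \<longlonglongrightarrow> 1 / 4 * (1 / 6)"
      unfolding var by (intro tendsto_mult chi_complement_limits(1) lam_ratio)
    moreover have "\<forall>\<^sub>F n in sequentially. var_chi n (p n) / lam n * (lam n / (real n ^ 3 * q n ^ 3)) =
        var_chi n (p n) / (real n ^ 3 * (1 - p n) ^ 3)"
      using filterlim_at_top_dense[THEN iffD1, OF lam_at_top, rule_format, of 0]
      by eventually_elim (simp add: q_def)
    ultimately show "(\<lambda>n. var_chi n (p n) / (real n ^ 3 * (1 - p n) ^ 3)) \<longlonglongrightarrow> 1 / 24"
      by (simp add: Lim_transform_eventually)
  qed simp
  ultimately show ?thesis ..
qed

end
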